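(* Let $\mathcal V=\{L_1,L_2\}$ be a veering pair. If $g$ is a non-trivial laminar automorphism in $\operatorname{Aut}(\mathcal V)$, then $g$ falls into one of the following cases: (1) $g$ is elliptic and there is an interleaving pair of ideal polygons of $\mathcal V$ preserved by $g$. (2) $g$ is parabolic and there is an interleaving pair of crowns of $\mathcal V$ preserved by $g$. Furthermore, the pivot of the crowns is the fixed point of $g$. (3) $g$ is hyperbolic and each fixed point of $g$ is a rainbow point in both $L_1$ and $L_2$. (4) $g$ is a pA-like automorphism without fixed point and there is an interleaving pair $(G_1,G_2)$ of real ideal polygons preserved by $g$ such that $v(G_1)\cup v(G_2)=\operatorname{Per}(g)$. (5) $g$ is a properly pseudo-Anosov and there is an interleaving pair $(G_1,G_2)$ of real gaps preserved by $g$ such that $v(G_1)\cup v(G_2)=\operatorname{Fix}(g)$. Moreover, $G_i$ is the attracting gap of $g$ and $G_{i+1}$ is the repelling gap of $g$ for some $i\in\{1,2\}$ (cyclically indexed).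
   Context: Lamination systems. $S^1$ is the unit circle with its counter-clockwise circular order. For distinct $u,v\in S^1$, $(u,v)_{S^1}$ is the set of $z$ with $(u,z,v)$ counter-clockwise; such sets are called good intervals, and $(u,v)_{S^1}^*:=(v,u)_{S^1}$. For a good interval $I$ put $\ell(I)=\{I,I^*\}$; $\ell(I)$ lies on an open interval $J$ if $I\subseteq J$ or $I^*\subseteq J$. A lamination system is a nonempty set $L$ of good intervals such that (i) $I\in L\Rightarrow I^*\in L$; (ii) for $I,J\in L$, $\ell(I)$ lies on $J$ or on $J^*$; (iii) if $I_1\subseteq I_2\subseteq\cdots$ are in $L$ and $\bigcup_k I_k$ is a good interval, then $\bigcup_k I_k\in L$. The leaves of $L$ are the $\ell(I)$, $I\in L$. A gap of $L$ is a subset $G\subseteq L$ whose distinct elements are disjoint and such that every leaf of $L$ lies on some element of $G$. Each leaf is itself a gap; a non-leaf gap is a gap which is not a leaf. The vertex set of $G$ is $v(G)=S^1\setminus\bigcup G$; a tip of $G$ is an isolated point of $v(G)$. $E(L)=\bigcup_{I\in L}v(\ell(I))$. An ideal polygon is a gap with finitely many vertices (leaves included). A crown is a gap $G=\{(t_k,t_{k+1})_{S^1}:k\in\mathbb Z\}$ with $v(G)=\{t_k:k\in\mathbb Z\}\cup\{p\}$ and $p\neq t_k$ for all $k$; $p$ is its pivot. $L$ is quite full if every gap is an ideal polygon or a crown; a quite full $L$ is loose if distinct non-leaf gaps have disjoint vertex sets. A point $p$ is a rainbow point of $L$ if there is a descending sequence $\{I_k\}_{k\in\mathbb N}$ in $L$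 with $\bigcap_k I_k=\{p\}$. A sequence of leaves $\ell_k$ converges to a good interval $I$ if there are $I_k\in L$ with $\ell_k=\ell(I_k)$ and $I\subseteq\liminf I_k\subseteq\limsup I_k\subseteq\overline I$. $I\in L$ is isolated if there is no sequence of leaves $\ell_k\ne\ell(I)$ of $L$ lying on $I$ and converging to $I$. A gap is real if none of its elements is isolated. Veering pairs. Gaps $G_1$ of $L_1$ and $G_2$ of $L_2$ interleave if for each $i\in\{1,2\}$ (cyclic indices) $I\cap v(G_{i+1})$ is a singleton for every $I\in G_i$; then $(G_1,G_2)$ is an interleaving pair (interleaving crowns have the same pivot). A pair $\{L_1,L_2\}$ of lamination systems is a veering pair if both are quite full and loose, $E(L_1)\cap E(L_2)=\emptyset$, and each non-leaf gap of $L_1$ or $L_2$ has an interleaving gap in the other system. Automorphisms. $\operatorname{Aut}(\mathcal V)$ is the group of orientation preserving homeomorphisms $g$ of $S^1$ with $g(L_1)=L_1$ and $g(L_2)=L_2$. $\operatorname{Fix}(g)$ and $\operatorname{Per}(g)$ are the sets of fixed and periodic points on $S^1$. A fixed point $p$ is attracting if there is a good interval $I$ with $I\cap\operatorname{Fix}(g)=\{p\}$ and $g(\overline I)\subset I$, and repelling if there is a good interval $I$ with $I\cap\operatorname{Fix}(g)=\{p\}$ and $I\subset g(\overline I)$. A non-trivial $g$ is elliptic if it has finite order, parabolic if it has a unique fixed point, hyperbolic if it has exactly two fixed points, one attracting and one repelling; $g\in\operatorname{Aut}(\mathcal V)$ is pA-like if it is neither elliptic nor parabolic and preserves an interleaving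 pair; a properly pseudo-Anosov is a pA-like automorphism with non-empty fixed point set. In (5), a gap is the attracting (resp. repelling) gap of $g$ if its tips are attracting (resp. repelling) fixed points of $g$. *)

theory Defs
  imports "HOL-Analysis.Analysis"
begin

section \<open>Circular order and good intervals\<close>

abbreviation S1 :: "complex set"
  where "S1 \<equiv> sphere 0 1"

definition ccw :: "complex \<Rightarrow> complex \<Rightarrow> complex \<Rightarrow> bool"
  where "ccw u z v \<longleftrightarrow> u \<in> S1 \<and> z \<in> S1 \<and> v \<in> S1 \<and>
           0 < Arg2pi (z / u) \<and> Arg2pi (z / u) < Arg2pi (v / u)"

definition open_arc :: "complex \<Rightarrow> complex \<Rightarrow> complex set"
  where "open_arc u v = {z. ccw u z v}"

definition good_interval :: "complex set \<Rightarrow> bool"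
  where "good_interval I \<longleftrightarrow> (\<exists>u v. u \<in> S1 \<and> v \<in> S1 \<and> u \<noteq> v \<and> I = open_arc u v)"

text \<open>The dual interval \<open>I\<^sup>*\<close>; it is well defined on good intervals by
  \<open>dual_interval_open_arc\<close> below.\<close>

definition dual_interval :: "complex set \<Rightarrow> complex set"
  where "dual_interval I =
    (THE J. \<exists>u v. u \<in> S1 \<and> v \<in> S1 \<and> u \<noteq> v \<and> I = open_arc u v \<and> J = open_arc v u)"

lemma open_arc_eq_image:
  assumes "u \<in> S1" "v \<in> S1"
  shows "open_arc u v = (\<lambda>t. u * cis t) ` {0<..<Arg2pi (v / u)}"
proof -
  have u0: "u \<noteq> 0" and nu: "norm u = 1" using assms by auto
  have A: "u * cis (Arg2pi (z / u)) = z" if "norm z = 1" for z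
    using complex_norm_eq_1_exp[of "z / u"] that u0 nu by (simp add: cis_conv_exp norm_divide)
  have B: "Arg2pi ((u * cis t) / u) = t" if "0 < t" "t < 2 * pi" for t
    using u0 that by (intro Arg2pi_unique[of 1]) (auto simp: cis_conv_exp)
  show ?thesis
  proof (intro equalityI subsetI)
    fix z assume "z \<in> open_arc u v"
    then show "z \<in> (\<lambda>t. u * cis t) ` {0<..<Arg2pi (v / u)}"
      using A[of z] by (intro image_eqI[of _ _ "Arg2pi (z / u)"]) (auto simp: open_arc_def ccw_def)
  next
    fix z assume "z \<in> (\<lambda>t. u * cis t) ` {0<..<Arg2pi (v / u)}"
    then obtain t where t: "0 < t" "t < Arg2pi (v / u)" "z = u * cis t" by auto
    have "t < 2 * pi" using t Arg2pi_lt_2pi[of "v / u"] by linarith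
    then show "z \<in> open_arc u v"
      using t B[of t] assms nu by (auto simp: open_arc_def ccw_def norm_mult)
  qed
qed

lemma open_arc_swap:
  assumes "u \<in> S1" "v \<in> S1" "u \<noteq> v"
  shows "open_arc v u = S1 - closure (open_arc u v)"
proof -
  define b where "b = Arg2pi (v / u)"
  have u0: "u \<noteq> 0" "norm u = 1" and v0: "v \<noteq> 0" "norm v = 1" using assms by auto
  have v: "v = u * cis b"
    using complex_norm_eq_1_exp[of "v / u"] u0 v0 by (simp add: cis_conv_exp norm_divide b_def)
  have "b \<noteq> 0" using v \<open>u \<noteq> v\<close> by auto
  then have b: "0 < b" "b < 2 * pi"
    using Arg2pi_ge_0[of "v / u"] Arg2pi_lt_2pi[of "v / u"] unfolding b_def by linarith+
  have c: "Arg2pi (u / v) = 2 * pi - b"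
  proof (rule Arg2pi_unique[of 1])
    have "exp (\<i> * of_real (2 * pi - b)) = cis (2 * pi - b)" by (simp add: cis_conv_exp)
    also have "\<dots> = inverse (cis b)" by (simp flip: cis_divide add: inverse_eq_divide)
    also have "\<dots> = u / v" using u0 by (simp add: v field_simps)
    finally show "of_real 1 * exp (\<i> * of_real (2 * pi - b)) = u / v" by simp
  qed (use b in auto)
  have 1: "open_arc v u = (\<lambda>t. u * cis t) ` {b<..<2 * pi}"
  proof -
    have "open_arc v u = (\<lambda>t. u * cis (b + t)) ` {0<..<2 * pi - b}"
      using open_arc_eq_image[OF assms(2,1)] c by (simp add: v cis_mult mult.assoc)
    also have "\<dots> = (\<lambda>t. u * cis t) ` ((+) b ` {0<..<2 * pi - b})"
      by (simp add: image_image)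
    also have "(+) b ` {0<..<2 * pi - b} = {b<..<2 * pi}"
    proof (intro equalityI subsetI)
      fix x assume "x \<in> {b<..<2 * pi}"
      then show "x \<in> (+) b ` {0<..<2 * pi - b}"
        by (intro image_eqI[of _ _ "x - b"]) auto
    qed auto
    finally show ?thesis .
  qed
  have cont: "continuous_on A (\<lambda>t. u * cis t)" for A
    by (intro continuous_intros)
  have 2: "closure (open_arc u v) = (\<lambda>t. u * cis t) ` {0..b}"
  proof (intro equalityI closure_minimal)
    have "compact ((\<lambda>t. u * cis t) ` {0..b})"
      by (intro compact_continuous_image cont) auto
    then show "closed ((\<lambda>t. u * cis t) ` {0..b})" by (rule compact_imp_closed)
    show "open_arc u v \<subseteq> (\<lambda>t. u * cis t) ` {0..b}"
      using open_arc_eq_image[OF assms(1,2)] by (auto simp: b_def)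
    have "(\<lambda>t. u * cis t) ` closure {0<..<b} \<subseteq> closure (open_arc u v)"
      by (intro image_closure_subset cont closed_closure)
         (use open_arc_eq_image[OF assms(1,2)] closure_subset in \<open>auto simp: b_def\<close>)
    then show "(\<lambda>t. u * cis t) ` {0..b} \<subseteq> closure (open_arc u v)"
      using b by simp
  qed
  have inj: "s = t" if "u * cis s = u * cis t" "0 \<le> s" "s < 2 * pi" "0 \<le> t" "t < 2 * pi" for s t
    using that u0 Arg2pi_unique[of 1 s "cis s"] Arg2pi_unique[of 1 t "cis s"]
    by (simp add: cis_conv_exp)
  have surj: "\<exists>t\<in>{0..<2 * pi}. z = u * cis t" if "z \<in> S1" for z
    using complex_norm_eq_1_exp[of "z / u"] that u0 Arg2pi_ge_0[of "z / u"] Arg2pi_lt_2pi[of "z / u"]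
    by (intro bexI[of _ "Arg2pi (z / u)"]) (simp_all add: cis_conv_exp norm_divide)
  show ?thesis
    unfolding 1 2
  proof (intro equalityI subsetI)
    fix z assume "z \<in> (\<lambda>t. u * cis t) ` {b<..<2 * pi}"
    then obtain t where t: "b < t" "t < 2 * pi" "z = u * cis t" by auto
    have "z \<notin> (\<lambda>t. u * cis t) ` {0..b}"
    proof
      assume "z \<in> (\<lambda>t. u * cis t) ` {0..b}"
      then obtain s where "0 \<le> s" "s \<le> b" "z = u * cis s" by auto
      with inj[of s t] t b show False by auto
    qed
    then show "z \<in> S1 - (\<lambda>t. u * cis t) ` {0..b}"
      using t u0 by (auto simp: norm_mult)
  next
    fix z assume z: "z \<in> S1 - (\<lambda>t. u * cis t) ` {0..b}"
    then obtain t where t: "t \<in> {0..<2 * pi}" "z = u * cis t" using surj by blast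
    with z have "t \<notin> {0..b}" by blast
    with t show "z \<in> (\<lambda>t. u * cis t) ` {b<..<2 * pi}" by auto
  qed
qed

lemma dual_interval_open_arc:
  assumes "u \<in> S1" "v \<in> S1" "u \<noteq> v"
  shows "dual_interval (open_arc u v) = open_arc v u"
  unfolding dual_interval_def
proof (rule the_equality)
  show "\<exists>u' v'. u' \<in> S1 \<and> v' \<in> S1 \<and> u' \<noteq> v' \<and> open_arc u v = open_arc u' v' \<and>
          open_arc v u = open_arc v' u'"
    using assms by blast
  show "J = open_arc v u"
    if "\<exists>u' v'. u' \<in> S1 \<and> v' \<in> S1 \<and> u' \<noteq> v' \<and> open_arc u v = open_arc u' v' \<and>
          J = open_arc v' u'" for J
    using that assms open_arc_swap by metis
qed


section \<open>Lamination systems\<close>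

definition leaf :: "complex set \<Rightarrow> complex set set"
  where "leaf I = {I, dual_interval I}"

definition lies_on :: "complex set set \<Rightarrow> complex set \<Rightarrow> bool"
  where "lies_on l J \<longleftrightarrow> (\<exists>I\<in>l. I \<subseteq> J)"

definition lamination_system :: "complex set set \<Rightarrow> bool"
  where "lamination_system L \<longleftrightarrow>
    L \<noteq> {} \<and> (\<forall>I\<in>L. good_interval I) \<and>
    (\<forall>I\<in>L. dual_interval I \<in> L) \<and>
    (\<forall>I\<in>L. \<forall>J\<in>L. lies_on (leaf I) J \<or> lies_on (leaf I) (dual_interval J)) \<and>
    (\<forall>I :: nat \<Rightarrow> complex set.
       range I \<subseteq> L \<and> incseq I \<and> good_interval (\<Union>k. I k) \<longrightarrow> (\<Union>k. I k) \<in> L)"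

definition leaves :: "complex set set \<Rightarrow> complex set set set"
  where "leaves L = leaf ` L"

definition gap :: "complex set set \<Rightarrow> complex set set \<Rightarrow> bool"
  where "gap L G \<longleftrightarrow> G \<subseteq> L \<and> disjoint G \<and> (\<forall>l\<in>leaves L. \<exists>J\<in>G. lies_on l J)"

definition nonleaf_gap :: "complex set set \<Rightarrow> complex set set \<Rightarrow> bool"
  where "nonleaf_gap L G \<longleftrightarrow> gap L G \<and> G \<notin> leaves L"

definition vertices :: "complex set set \<Rightarrow> complex set"
  where "vertices G = S1 - \<Union>G"

definition tips :: "complex set set \<Rightarrow> complex set"
  where "tips G = {x. x isolated_in vertices G}"

definition endpoints :: "complex set set \<Rightarrow> complex set"
  where "endpoints L = (\<Union>I\<in>L. vertices (leaf I))"

definition ideal_polygon :: "complex set set \<Rightarrow> complex set set \<Rightarrow> bool"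
  where "ideal_polygon L G \<longleftrightarrow> gap L G \<and> finite (vertices G)"

definition crown_with_pivot :: "complex set set \<Rightarrow> complex set set \<Rightarrow> complex \<Rightarrow> bool"
  where "crown_with_pivot L G p \<longleftrightarrow> gap L G \<and>
    (\<exists>t :: int \<Rightarrow> complex. range t \<subseteq> S1 \<and> G = range (\<lambda>k. open_arc (t k) (t (k + 1))) \<and>
       vertices G = range t \<union> {p} \<and> p \<notin> range t)"

definition crown :: "complex set set \<Rightarrow> complex set set \<Rightarrow> bool"
  where "crown L G \<longleftrightarrow> (\<exists>p. crown_with_pivot L G p)"

definition quite_full :: "complex set set \<Rightarrow> bool"
  where "quite_full L \<longleftrightarrow>
    lamination_system L \<and> (\<forall>G. gap L G \<longrightarrow> ideal_polygon L G \<or> crown L G)"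

definition loose :: "complex set set \<Rightarrow> bool"
  where "loose L \<longleftrightarrow> quite_full L \<and>
    (\<forall>G H. nonleaf_gap L G \<and> nonleaf_gap L H \<and> G \<noteq> H \<longrightarrow> vertices G \<inter> vertices H = {})"

definition rainbow_point :: "complex set set \<Rightarrow> complex \<Rightarrow> bool"
  where "rainbow_point L p \<longleftrightarrow>
    (\<exists>I :: nat \<Rightarrow> complex set. range I \<subseteq> L \<and> decseq I \<and> (\<Inter>k. I k) = {p})"

definition leaves_converge ::
  "complex set set \<Rightarrow> (nat \<Rightarrow> complex set set) \<Rightarrow> complex set \<Rightarrow> bool"
  where "leaves_converge L l I \<longleftrightarrow>
    (\<exists>J :: nat \<Rightarrow> complex set. (\<forall>k. J k \<in> L \<and> l k = leaf (J k)) \<and>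
       I \<subseteq> liminf J \<and> liminf J \<subseteq> limsup J \<and> limsup J \<subseteq> closure I)"

definition isolated_interval :: "complex set set \<Rightarrow> complex set \<Rightarrow> bool"
  where "isolated_interval L I \<longleftrightarrow> I \<in> L \<and>
    \<not> (\<exists>l :: nat \<Rightarrow> complex set set.
         (\<forall>k. l k \<in> leaves L \<and> l k \<noteq> leaf I \<and> lies_on (l k) I) \<and> leaves_converge L l I)"

definition real_gap :: "complex set set \<Rightarrow> complex set set \<Rightarrow> bool"
  where "real_gap L G \<longleftrightarrow> gap L G \<and> (\<forall>I\<in>G. \<not> isolated_interval L I)"


section \<open>Veering pairs\<close>

definition interleave :: "complex set set \<Rightarrow> complex set set \<Rightarrow> bool"
  where "interleave G1 G2 \<longleftrightarrow>
    (\<forall>I\<in>G1. is_singleton (I \<inter> vertices G2)) \<and> (\<forall>I\<in>G2. is_singleton (I \<inter> vertices G1))"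

definition interleaving_pair ::
  "complex set set \<Rightarrow> complex set set \<Rightarrow> complex set set \<Rightarrow> complex set set \<Rightarrow> bool"
  where "interleaving_pair L1 L2 G1 G2 \<longleftrightarrow> gap L1 G1 \<and> gap L2 G2 \<and> interleave G1 G2"

definition veering_pair :: "complex set set \<Rightarrow> complex set set \<Rightarrow> bool"
  where "veering_pair L1 L2 \<longleftrightarrow>
    quite_full L1 \<and> loose L1 \<and> quite_full L2 \<and> loose L2 \<and>
    endpoints L1 \<inter> endpoints L2 = {} \<and>
    (\<forall>G1. nonleaf_gap L1 G1 \<longrightarrow> (\<exists>G2. interleaving_pair L1 L2 G1 G2)) \<and>
    (\<forall>G2. nonleaf_gap L2 G2 \<longrightarrow> (\<exists>G1. interleaving_pair L1 L2 G1 G2))"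


section \<open>Automorphisms\<close>

text \<open>A homeomorphism of the circle is represented by a function on \<open>complex\<close>; its values off
  the circle are irrelevant, so all notions below are relativised to \<open>S1\<close>.\<close>

definition orientation_preserving_homeo :: "(complex \<Rightarrow> complex) \<Rightarrow> bool"
  where "orientation_preserving_homeo g \<longleftrightarrow>
    (\<exists>h. homeomorphism S1 S1 g h) \<and> (\<forall>u z v. ccw u z v \<longrightarrow> ccw (g u) (g z) (g v))"

text \<open>A set of intervals (a lamination system or a gap) is mapped to itself setwise.\<close>

definition preserves :: "(complex \<Rightarrow> complex) \<Rightarrow> complex set set \<Rightarrow> bool"
  where "preserves g A \<longleftrightarrow> (\<lambda>I. g ` I) ` A = A"

definition Aut :: "complex set set \<Rightarrow> complex set set \<Rightarrow> (complex \<Rightarrow> complex) set"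
  where "Aut L1 L2 = {g. orientation_preserving_homeo g \<and> preserves g L1 \<and> preserves g L2}"

definition nontrivial :: "(complex \<Rightarrow> complex) \<Rightarrow> bool"
  where "nontrivial g \<longleftrightarrow> (\<exists>x\<in>S1. g x \<noteq> x)"

definition Fix :: "(complex \<Rightarrow> complex) \<Rightarrow> complex set"
  where "Fix g = {x \<in> S1. g x = x}"

definition Per :: "(complex \<Rightarrow> complex) \<Rightarrow> complex set"
  where "Per g = {x \<in> S1. \<exists>n>0. (g ^^ n) x = x}"

definition attracting :: "(complex \<Rightarrow> complex) \<Rightarrow> complex \<Rightarrow> bool"
  where "attracting g p \<longleftrightarrow> p \<in> Fix g \<and>
    (\<exists>I. good_interval I \<and> I \<inter> Fix g = {p} \<and> g ` closure I \<subset> I)"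

text \<open>The endpoints of \<open>I\<close> may be fixed here, so an attracting point lying between two other fixed
  points also satisfies this condition. If two interleaving gaps have \<open>Fix g\<close> as the union of their
  vertex sets and the tips of one are attracting, then their tips alternate, so that near every tip
  of the other one \<open>g\<close> does move points away on both sides.\<close>

definition repelling :: "(complex \<Rightarrow> complex) \<Rightarrow> complex \<Rightarrow> bool"
  where "repelling g p \<longleftrightarrow> p \<in> Fix g \<and>
    (\<exists>I. good_interval I \<and> I \<inter> Fix g = {p} \<and> I \<subset> g ` closure I)"

definition elliptic :: "(complex \<Rightarrow> complex) \<Rightarrow> bool"
  where "elliptic g \<longleftrightarrow> nontrivial g \<and> (\<exists>n>0. \<forall>x\<in>S1. (g ^^ n) x = x)"

definition parabolic :: "(complex \<Rightarrow> complex) \<Rightarrow> bool"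
  where "parabolic g \<longleftrightarrow> nontrivial g \<and> (\<exists>p. Fix g = {p})"

definition hyperbolic :: "(complex \<Rightarrow> complex) \<Rightarrow> bool"
  where "hyperbolic g \<longleftrightarrow> nontrivial g \<and>
    (\<exists>p q. p \<noteq> q \<and> Fix g = {p, q} \<and> attracting g p \<and> repelling g q)"

definition preserved_interleaving_pair ::
  "complex set set \<Rightarrow> complex set set \<Rightarrow> (complex \<Rightarrow> complex) \<Rightarrow>
   complex set set \<Rightarrow> complex set set \<Rightarrow> bool"
  where "preserved_interleaving_pair L1 L2 g G1 G2 \<longleftrightarrow>
    interleaving_pair L1 L2 G1 G2 \<and> preserves g G1 \<and> preserves g G2"

definition pA_like :: "complex set set \<Rightarrow> complex set set \<Rightarrow> (complex \<Rightarrow> complex) \<Rightarrow> bool"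
  where "pA_like L1 L2 g \<longleftrightarrow> g \<in> Aut L1 L2 \<and> \<not> elliptic g \<and> \<not> parabolic g \<and>
    (\<exists>G1 G2. preserved_interleaving_pair L1 L2 g G1 G2)"

definition properly_pseudo_Anosov ::
  "complex set set \<Rightarrow> complex set set \<Rightarrow> (complex \<Rightarrow> complex) \<Rightarrow> bool"
  where "properly_pseudo_Anosov L1 L2 g \<longleftrightarrow> pA_like L1 L2 g \<and> Fix g \<noteq> {}"

definition attracting_gap :: "(complex \<Rightarrow> complex) \<Rightarrow> complex set set \<Rightarrow> bool"
  where "attracting_gap g G \<longleftrightarrow> (\<forall>t\<in>tips G. attracting g t)"

definition repelling_gap :: "(complex \<Rightarrow> complex) \<Rightarrow> complex set set \<Rightarrow> bool"
  where "repelling_gap g G \<longleftrightarrow> (\<forall>t\<in>tips G. repelling g t)"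

end

theory Submission
  imports Defs
begin

text \<open>
  A point that is an endpoint of one lamination system is a rainbow point of the other, and a point
  that is a rainbow point of neither is the pivot of a pair of interleaving crowns. By looseness at
  most two leaves of a system end at a given point.

  Suppose \<open>g\<close> has a fixed point. If it is a pivot, then \<open>g\<close> preserves the two crowns: either
  it translates them, and \<open>g\<close> is parabolic, or fixed points accumulate at the pivot from both
  sides. Hence a fixed point that is not accumulated from both sides is a rainbow point of some
  \<open>L\<^sub>i\<close>, and unlinkedness of a small leaf around it with its image makes it isolated, attracting or
  repelling. If \<open>p < u < q\<close> are consecutive fixed points with \<open>p \<noteq> q\<close> and \<open>u\<close> is a rainbow point of
  \<open>L\<^sub>i\<close>, the union of the leaves around \<open>u\<close> inside \<open>(p, q)\<close> is invariant, so \<open>(p, q)\<close> itself lies in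
  \<open>L\<^sub>i\<close> and is not isolated. Thus consecutive fixed points are alternately endpoints of \<open>L\<^sub>1\<close> and
  \<open>L\<^sub>2\<close>, and the arcs \<open>(p, q)\<close> form two interleaving real gaps: if the chain of consecutive fixed
  points does not close up, its limit is a rainbow point of neither system, hence a pivot, and the
  chain consists of the tips of the two crowns.

  If \<open>g\<close> has no fixed point, the maximal intervals of \<open>L\<^sub>i\<close> displaced from themselves form an invariant
  polygon, so some power of \<open>g\<close> has a fixed point; either \<open>g\<close> has finite order or the analysis
  above applies to that power.
\<close>

section \<open>Circular order\<close>

text \<open>Four times a gap is produced by the same recipe: select one side of every leaf so that
  no two selected sides cover the circle, close under unions, and take the maximal sides
  (\<open>maximal_gap\<close>). The delicate point is always the union. It belongs to the system
  only if it is a good interval, and the circle minus one point is not one; so each application has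
  to exhibit further omitted points or to exploit their absence.

  With exactly two fixed points both neighbours of a fixed point are the same point, and there is no
  arc \<open>(p, q)\<close> to fill with leaves. That case needs its own argument, which shows that
  no leaf ends at a fixed point.

  In returning from a power \<open>f\<close> to its root \<open>g\<close>, the gaps found for
  \<open>f\<close> have to be invariant under \<open>g\<close> as well. Therefore their vertex sets
  are described by \<open>Fix f\<close> and the endpoint sets alone, without reference to the chain
  that produced them.\<close>

lemma S1_nonzero: "z \<in> S1 \<Longrightarrow> z \<noteq> 0"
  by auto

lemma S1_divide: "x \<in> S1 \<Longrightarrow> b \<in> S1 \<Longrightarrow> x / b \<in> S1"
  by (auto simp: norm_divide)

lemma S1_cis: "x \<in> S1 \<Longrightarrow> x * cis t \<in> S1"
  by (auto simp: norm_mult)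

lemma S1_polar: "z \<in> S1 \<Longrightarrow> z = cis (Arg2pi z)"
  using complex_norm_eq_1_exp[of z] by (simp add: cis_conv_exp)

lemma S1_polar_base: "\<lbrakk>z \<in> S1; b \<in> S1\<rbrakk> \<Longrightarrow> z = b * cis (Arg2pi (z / b))"
  using S1_polar[of "z / b"] S1_divide[of z b] S1_nonzero[of b] by (simp add: field_simps)

lemma S1_eq_iff: "\<lbrakk>x \<in> S1; y \<in> S1\<rbrakk> \<Longrightarrow> x = y \<longleftrightarrow> Arg2pi x = Arg2pi y"
  using S1_polar by metis

lemma S1_eq_iff_base: "\<lbrakk>x \<in> S1; y \<in> S1; b \<in> S1\<rbrakk> \<Longrightarrow> x = y \<longleftrightarrow> Arg2pi (x / b) = Arg2pi (y / b)"
  using S1_polar_base by metis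

lemma Arg2pi_cis: "\<lbrakk>0 \<le> t; t < 2 * pi\<rbrakk> \<Longrightarrow> Arg2pi (cis t) = t"
  by (intro Arg2pi_unique[of 1]) (auto simp: cis_conv_exp)

lemma Arg2pi_cis_base: "\<lbrakk>b \<in> S1; 0 \<le> t; t < 2 * pi\<rbrakk> \<Longrightarrow> Arg2pi (b * cis t / b) = t"
  using Arg2pi_cis[of t] S1_nonzero[of b] by simp

lemma Arg2pi_self: "b \<in> S1 \<Longrightarrow> Arg2pi (b / b) = 0"
  by (metis Arg2pi_cis_base cis_zero mult.right_neutral order_refl pi_gt_zero mult_pos_pos zero_less_numeral)

lemma arc_sub_S1: "z \<in> open_arc u v \<Longrightarrow> z \<in> S1" "z \<in> open_arc u v \<Longrightarrow> u \<in> S1"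
  "z \<in> open_arc u v \<Longrightarrow> v \<in> S1"
  by (auto simp: open_arc_def ccw_def)

text \<open>The circular order read off from the coordinate \<open>Arg2pi\<close>, so that statements about arcs become
  linear arithmetic.\<close>

definition cyc :: "real \<Rightarrow> real \<Rightarrow> real \<Rightarrow> bool" where
  "cyc a x b \<longleftrightarrow> a < x \<and> x < b \<or> b < a \<and> (a < x \<or> x < b)"

lemma cyc_dual: "cyc u z v \<Longrightarrow> \<not> cyc v z u"
  unfolding cyc_def by argo

lemma cyc_total: "u \<noteq> v \<Longrightarrow> z = u \<or> z = v \<or> cyc u z v \<or> cyc v z u"
  unfolding cyc_def by argo

lemma cyc_rotate: "cyc u z v \<longleftrightarrow> cyc z v u"
  unfolding cyc_def by argo

lemma cyc_subset:
  "\<lbrakk>\<not> cyc u x v; \<not> cyc u y v; u \<noteq> v; x \<noteq> y; cyc x u y \<or> cyc x v y \<or> u = x \<and> v = y;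
    cyc u z v\<rbrakk> \<Longrightarrow> cyc x z y"
  unfolding cyc_def by argo

text \<open>Dividing by \<open>u\<close> subtracts \<open>Arg2pi u\<close> from the angle modulo
  \<open>2 * pi\<close>; as both angles lie in one period, at most one turn has to be added. The
  second disjunct is the arc that crosses angle 0.\<close>

lemma arc_iff:
  assumes "u \<in> S1" "v \<in> S1"
  shows "z \<in> open_arc u v \<longleftrightarrow> z \<in> S1 \<and>
    (Arg2pi u < Arg2pi z \<and> Arg2pi z < Arg2pi v \<or>
     Arg2pi v < Arg2pi u \<and> (Arg2pi u < Arg2pi z \<or> Arg2pi z < Arg2pi v))"
proof (cases "z \<in> S1")
  case True
  have d: "Arg2pi (w / u) = (if Arg2pi u \<le> Arg2pi w then Arg2pi w - Arg2pi u
        else Arg2pi w - Arg2pi u + 2 * pi)" if "w \<in> S1" for w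
  proof -
    have e: "w / u = cis (Arg2pi w - Arg2pi u)"
      using S1_polar[OF that] S1_polar[OF assms(1)] by (metis cis_divide)
    also have "\<dots> = cis (Arg2pi w - Arg2pi u + 2 * pi)"
      by (simp add: cis_mult[symmetric])
    finally show ?thesis
      using e Arg2pi_cis[of "Arg2pi w - Arg2pi u"] Arg2pi_cis[of "Arg2pi w - Arg2pi u + 2 * pi"]
        Arg2pi[of w] Arg2pi[of u] by auto
  qed
  have b: "0 \<le> Arg2pi w" "Arg2pi w < 2 * pi" for w
    using Arg2pi by auto
  show ?thesis
    using assms True b[of u] b[of v] b[of z] unfolding open_arc_def ccw_def mem_Collect_eq d[OF True] d[OF assms(2)]
    by (auto split: if_splits)
qed (auto simp: open_arc_def ccw_def)

lemma arc_divide: "b \<in> S1 \<Longrightarrow> z / b \<in> open_arc (u / b) (v / b) \<longleftrightarrow> z \<in> open_arc u v"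
  by (auto simp: open_arc_def ccw_def norm_divide divide_eq_1_iff)

lemma arc_cyc:
  "\<lbrakk>u \<in> S1; v \<in> S1; z \<in> S1\<rbrakk> \<Longrightarrow> z \<in> open_arc u v \<longleftrightarrow> cyc (Arg2pi u) (Arg2pi z) (Arg2pi v)"
  by (simp only: cyc_def arc_iff simp_thms)

text \<open>Rotation moves the cut of the angular coordinate to \<open>b\<close>. With an endpoint,
  a pivot or an omitted point as \<open>b\<close>, arcs that miss \<open>b\<close> become real
  intervals.\<close>

lemma arc_cyc_base:
  assumes "u \<in> S1" "v \<in> S1" "z \<in> S1" "b \<in> S1"
  shows "z \<in> open_arc u v \<longleftrightarrow> cyc (Arg2pi (u / b)) (Arg2pi (z / b)) (Arg2pi (v / b))"
  by (simp only: arc_cyc[symmetric] S1_divide assms arc_divide)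

lemma arc_from: "u \<in> S1 \<Longrightarrow> v \<in> S1 \<Longrightarrow> z \<in> open_arc u v \<longleftrightarrow> z \<in> S1 \<and>
    0 < Arg2pi (z / u) \<and> Arg2pi (z / u) < Arg2pi (v / u)"
  by (auto simp: open_arc_def ccw_def)

lemma arc_memD:
  assumes "z \<in> open_arc u v"
  shows "cyc (Arg2pi u) (Arg2pi z) (Arg2pi v)"
  using arc_cyc[of u v z] arc_sub_S1[OF assms] assms by simp

lemma arc_refl [simp]: "open_arc u u = {}"
  using arc_memD[of _ u u] unfolding cyc_def by fastforce

lemma arc_ends [simp]: "u \<notin> open_arc u v" "v \<notin> open_arc u v"
  using arc_memD[of u u v] arc_memD[of v u v] unfolding cyc_def by argo+

lemma arc_not_dual:
  assumes "z \<in> open_arc u v"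
  shows "z \<notin> open_arc v u"
  using cyc_dual[OF arc_memD[OF assms]] arc_memD[of z v u] by blast

lemma arc_cases:
  assumes "u \<in> S1" "v \<in> S1" "z \<in> S1" "u \<noteq> v"
  shows "z = u \<or> z = v \<or> z \<in> open_arc u v \<or> z \<in> open_arc v u"
proof -
  have "Arg2pi u \<noteq> Arg2pi v" using assms(4) S1_eq_iff[OF assms(1,2)] by blast
  from cyc_total[OF this, of "Arg2pi z"] show ?thesis
    using assms(1-3) by (simp only: arc_cyc S1_eq_iff)
qed

lemma arc_rotate: "y \<in> open_arc x z \<longleftrightarrow> z \<in> open_arc y x"
proof (cases "x \<in> S1 \<and> y \<in> S1 \<and> z \<in> S1")
  case True
  then show ?thesis by (simp only: arc_cyc) (rule cyc_rotate)
qed (use arc_sub_S1 in blast)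

lemma arc_nonempty:
  assumes "u \<in> S1" "v \<in> S1" "u \<noteq> v"
  shows "\<exists>z. z \<in> open_arc u v"
proof -
  have "Arg2pi (v / u) \<noteq> 0" using S1_eq_iff_base[of v u u] Arg2pi_self[of u] assms by auto
  then have p: "Arg2pi (v / u) > 0" "Arg2pi (v / u) < 2 * pi" using Arg2pi[of "v/u"] by auto
  let ?z = "u * cis (Arg2pi (v / u) / 2)"
  have "Arg2pi (?z / u) = Arg2pi (v / u) / 2" using p by (intro Arg2pi_cis_base assms) auto
  then have "?z \<in> open_arc u v"
    unfolding arc_from[OF assms(1,2)] using p S1_cis[OF assms(1)] by (simp del: mem_sphere)
  then show ?thesis by blast
qed

lemma S1_other_point: assumes "a \<in> S1" shows "\<exists>b. b \<in> S1 \<and> b \<noteq> a"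
  by (rule exI[of _ "- a"]) (use assms S1_nonzero[OF assms] in auto)

lemma closure_arc:
  assumes "u \<in> S1" "v \<in> S1" "u \<noteq> v"
  shows "closure (open_arc u v) = insert u (insert v (open_arc u v))"
proof -
  have s: "closure (open_arc u v) \<subseteq> S1"
    by (intro closure_minimal) (auto dest: arc_sub_S1)
  have e: "open_arc v u = S1 - closure (open_arc u v)" by (rule open_arc_swap[OF assms])
  have "z \<in> closure (open_arc u v) \<longleftrightarrow> z = u \<or> z = v \<or> z \<in> open_arc u v" for z
  proof -
    have "z \<in> closure (open_arc u v) \<longleftrightarrow> z \<in> S1 \<and> z \<notin> open_arc v u" using e s by auto
    also have "\<dots> \<longleftrightarrow> z = u \<or> z = v \<or> z \<in> open_arc u v"
      using assms arc_cases[of u v z] arc_not_dual[of z u v] arc_sub_S1[of z u v] by auto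
    finally show ?thesis .
  qed
  then show ?thesis by auto
qed

lemma arc_openin: "u \<in> S1 \<Longrightarrow> v \<in> S1 \<Longrightarrow> u \<noteq> v \<Longrightarrow> openin (top_of_set S1) (open_arc u v)"
  using open_arc_swap[of v u] by (auto simp: openin_open intro!: exI[of _ "- closure (open_arc v u)"])

text \<open>An arc that misses both \<open>x\<close> and \<open>y\<close> lies in one of the two
  arcs they cut out. The last conjunct selects the right one: an endpoint inside it, or equal
  endpoints in the same order, since in the opposite order the arcs are complementary.\<close>

lemma arc_subset_iff:
  assumes "u \<in> S1" "v \<in> S1" "u \<noteq> v" "x \<in> S1" "y \<in> S1" "x \<noteq> y"
  shows "open_arc u v \<subseteq> open_arc x y \<longleftrightarrow> x \<notin> open_arc u v \<and> y \<notin> open_arc u v \<and>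
    (u \<in> open_arc x y \<or> v \<in> open_arc x y \<or> u = x \<and> v = y)" (is "?L \<longleftrightarrow> ?R")
proof
  assume ?R
  then show ?L
  proof (intro subsetI)
    fix z assume "?R" and z: "z \<in> open_arc u v"
    then show "z \<in> open_arc x y"
      using assms(1-6) arc_sub_S1(1)[OF z]
        cyc_subset[of "Arg2pi u" "Arg2pi x" "Arg2pi v" "Arg2pi y" "Arg2pi z"]
      by (simp only: arc_cyc S1_eq_iff) blast
  qed
next
  assume L: ?L
  obtain z where z: "z \<in> open_arc u v" using arc_nonempty[OF assms(1,2,3)] by blast
  have n: "x \<notin> open_arc u v" "y \<notin> open_arc u v" using L by auto
  have z': "z \<in> open_arc x y" using z L by auto
  have "u \<in> closure (open_arc x y)" "v \<in> closure (open_arc x y)"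
    using closure_mono[OF L] closure_arc[OF assms(1-3)] by auto
  then have "u = x \<or> u = y \<or> u \<in> open_arc x y" "v = x \<or> v = y \<or> v \<in> open_arc x y"
    using closure_arc[OF assms(4-6)] by auto
  then show ?R using n z z' assms(3) arc_not_dual[of z x y] by auto
qed

lemma arc_inj:
  assumes "u \<in> S1" "v \<in> S1" "u \<noteq> v" "x \<in> S1" "y \<in> S1" "x \<noteq> y" "open_arc u v = open_arc x y"
  shows "u = x \<and> v = y"
  using arc_subset_iff[OF assms(1-6)] assms(7) by (metis arc_ends order_refl)

text \<open>Openness does the work: an open set disjoint from an arc is disjoint from its closure,
  so \<open>x\<close> and \<open>y\<close> are missed as well.\<close>

lemma arc_disjoint_iff:
  assumes "u \<in> S1" "v \<in> S1" "u \<noteq> v" "x \<in> S1" "y \<in> S1" "x \<noteq> y"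
  shows "open_arc u v \<inter> open_arc x y = {} \<longleftrightarrow> open_arc u v \<subseteq> open_arc y x"
proof
  assume d: "open_arc u v \<inter> open_arc x y = {}"
  obtain T where T: "open T" "open_arc u v = S1 \<inter> T"
    using arc_openin[OF assms(1-3)] by (auto simp: openin_open)
  have "T \<inter> open_arc x y = {}" using d T by (auto dest: arc_sub_S1)
  then have "T \<inter> closure (open_arc x y) = {}" using open_Int_closure_eq_empty[OF T(1)] by blast
  then have "x \<notin> open_arc u v" "y \<notin> open_arc u v" using T closure_arc[OF assms(4-6)] by auto
  then show "open_arc u v \<subseteq> open_arc y x"
    using d arc_cases[of x y] assms(4-6) by (blast dest: arc_sub_S1)
qed (use arc_not_dual in blast)

lemma arc_subset_dual:
  assumes "u \<in> S1" "v \<in> S1" "u \<noteq> v" "x \<in> S1" "y \<in> S1" "x \<noteq> y"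
  shows "open_arc u v \<subseteq> open_arc x y \<longleftrightarrow> open_arc y x \<subseteq> open_arc v u"
  using arc_disjoint_iff[of u v y x] arc_disjoint_iff[of y x u v] assms by blast

lemma good_intervalE:
  assumes "good_interval I"
  obtains u v where "u \<in> S1" "v \<in> S1" "u \<noteq> v" "I = open_arc u v"
  using assms unfolding good_interval_def by blast

lemma good_interval_arc: "u \<in> S1 \<Longrightarrow> v \<in> S1 \<Longrightarrow> u \<noteq> v \<Longrightarrow> good_interval (open_arc u v)"
  unfolding good_interval_def by blast

lemma arc_left_trans: "x \<in> open_arc w y \<Longrightarrow> y \<in> open_arc w z \<Longrightarrow> x \<in> open_arc w z"
proof -
  assume a: "x \<in> open_arc w y" "y \<in> open_arc w z"
  note s = a[THEN arc_sub_S1(1)] a[THEN arc_sub_S1(2)] a[THEN arc_sub_S1(3)]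
  show ?thesis using a s by (simp only: arc_cyc cyc_def) argo
qed

lemma arc_between: "x \<in> open_arc w y \<Longrightarrow> y \<in> open_arc w z \<Longrightarrow> y \<in> open_arc x z"
proof -
  assume a: "x \<in> open_arc w y" "y \<in> open_arc w z"
  note s = a[THEN arc_sub_S1(1)] a[THEN arc_sub_S1(2)] a[THEN arc_sub_S1(3)]
  show ?thesis using a s by (simp only: arc_cyc cyc_def) argo
qed

lemma arc_between_left: "x \<in> open_arc w z \<Longrightarrow> y \<in> open_arc x z \<Longrightarrow> x \<in> open_arc w y"
proof -
  assume a: "x \<in> open_arc w z" "y \<in> open_arc x z"
  note s = a[THEN arc_sub_S1(1)] a[THEN arc_sub_S1(2)] a[THEN arc_sub_S1(3)]
  show ?thesis using a s by (simp only: arc_cyc cyc_def) argo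
qed

lemma arc_asym: "x \<in> open_arc w y \<Longrightarrow> y \<notin> open_arc w x"
  using arc_left_trans[of x w y x] arc_ends by blast

lemma arc_split:
  assumes "x \<in> open_arc a b" "w \<in> open_arc a b"
  shows "w \<in> open_arc a x \<or> w = x \<or> w \<in> open_arc x b"
  using assms assms[THEN arc_sub_S1(1)] assms[THEN arc_sub_S1(2)] assms[THEN arc_sub_S1(3)]
  by (simp only: arc_cyc cyc_def S1_eq_iff) argo

section \<open>Nearest points of closed sets and unions of chains of arcs\<close>

lemma closed_next:
  assumes "closed F" "F \<subseteq> S1" "F \<noteq> {}" "z \<in> S1"
  shows "\<exists>v\<in>F. open_arc z v \<inter> F = {}"
proof -
  define T where "T = {0..2*pi} \<inter> (\<lambda>t. z * cis t) -` F"
  have "closed T" unfolding T_def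
    by (intro continuous_closed_preimage assms) (auto intro!: continuous_intros)
  then have "compact T" unfolding T_def by (metis compact_Icc closed_Int_compact inf.left_idem inf_commute)
  have mem: "Arg2pi (x / z) \<in> T" if "x \<in> F" for x
    using that assms S1_polar_base[of x z] Arg2pi[of "x / z"] by (auto simp: T_def)
  then have "T \<noteq> {}" using assms(3) by blast
  then obtain t where t: "t \<in> T" "\<And>s. s \<in> T \<Longrightarrow> t \<le> s"
    using compact_attains_inf[OF \<open>compact T\<close>] by blast
  obtain x where x: "x \<in> F" using assms(3) by blast
  have "t < 2 * pi" using t(2)[OF mem[OF x]] Arg2pi[of "x / z"] by linarith
  then have th: "Arg2pi (z * cis t / z) = t" using t(1) assms(4) by (intro Arg2pi_cis_base) (auto simp: T_def)
  have "z * cis t \<in> F" using t(1) by (auto simp: T_def)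
  moreover have "w \<notin> F" if "w \<in> open_arc z (z * cis t)" for w
    using that arc_from[OF assms(4) S1_cis[OF assms(4)], of w t] th t(2)[of "Arg2pi (w / z)"] mem[of w] by fastforce
  ultimately show ?thesis by blast
qed

text \<open>Here the largest angle measured from \<open>z\<close> is wanted, and
  \<open>2 * pi\<close> is again an angle of \<open>z\<close>; excluding \<open>z\<close> from
  \<open>F\<close> keeps the maximum below it. In \<open>closed_next\<close> the minimum may be 0,
  which returns \<open>z\<close> itself with an empty arc.\<close>

lemma closed_prev:
  assumes "closed F" "F \<subseteq> S1" "F \<noteq> {}" "z \<in> S1" "z \<notin> F"
  shows "\<exists>v\<in>F. open_arc v z \<inter> F = {}"
proof -
  define T where "T = {0..2*pi} \<inter> (\<lambda>t. z * cis t) -` F"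
  have "closed T" unfolding T_def
    by (intro continuous_closed_preimage assms) (auto intro!: continuous_intros)
  then have "compact T" unfolding T_def by (metis compact_Icc closed_Int_compact inf.left_idem inf_commute)
  have mem: "Arg2pi (x / z) \<in> T" if "x \<in> F" for x
    using that assms S1_polar_base[of x z] Arg2pi[of "x / z"] by (auto simp: T_def)
  then have "T \<noteq> {}" using assms(3) by blast
  then obtain t where t: "t \<in> T" "\<And>s. s \<in> T \<Longrightarrow> s \<le> t"
    using compact_attains_sup[OF \<open>compact T\<close>] by blast
  have "t \<noteq> 2 * pi" using t(1) assms(5) by (auto simp: T_def)
  then have b: "0 \<le> t" "t < 2 * pi" using t(1) by (auto simp: T_def)
  then have th: "Arg2pi (z * cis t / z) = t" using assms(4) by (intro Arg2pi_cis_base) 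
  have v: "z * cis t \<in> F" using t(1) by (auto simp: T_def)
  moreover have "w \<notin> F" if w: "w \<in> open_arc (z * cis t) z" for w
  proof
    assume "w \<in> F"
    then have "Arg2pi (w / z) \<le> t" using t(2) mem by blast
    moreover have "z * cis t \<in> S1" "w \<in> S1" using v assms \<open>w \<in> F\<close> by blast+
    then have "cyc t (Arg2pi (w / z)) 0"
      using w assms(4) arc_cyc_base[of "z * cis t" z w z] th Arg2pi_self[OF assms(4)] by metis
    ultimately show False using Arg2pi[of "w / z"] by (auto simp: cyc_def)
  qed
  ultimately show ?thesis by blast
qed

lemma chain_seq:
  fixes F :: "complex set set"
  assumes "F \<noteq> {}" and op: "\<And>J. J \<in> F \<Longrightarrow> openin (top_of_set S1) J"
    and ch: "\<And>J K. J \<in> F \<Longrightarrow> K \<in> F \<Longrightarrow> J \<subseteq> K \<or> K \<subseteq> J"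
  shows "\<exists>I :: nat \<Rightarrow> complex set. range I \<subseteq> F \<and> incseq I \<and> (\<Union>k. I k) = \<Union>F"
proof -
  obtain F' where F': "F' \<subseteq> F" "countable F'" "\<Union>F' = \<Union>F"
    by (rule Lindelof_openin[of F S1]) (use op in auto)
  obtain J0 where "J0 \<in> F" using assms(1) by blast
  define C where "C = insert J0 F'"
  have C: "C \<subseteq> F" "countable C" "C \<noteq> {}" "\<Union>C = \<Union>F"
    using F' \<open>J0 \<in> F\<close> by (auto simp: C_def)
  define I where "I n = (\<Union>i\<le>n. from_nat_into C i)" for n
  have "I n \<in> F" for n
  proof (induction n)
    case 0
    have "I 0 = from_nat_into C 0" by (simp add: I_def)
    then show ?case using C(1) from_nat_into[OF C(3), of 0] by auto
  next
    case (Suc n)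
    have "I (Suc n) = I n \<union> from_nat_into C (Suc n)" by (auto simp: I_def atMost_Suc)
    moreover have e: "from_nat_into C (Suc n) \<in> F" using from_nat_into[OF C(3), of "Suc n"] C(1) by (rule rev_subsetD)
    ultimately have "I (Suc n) = I n \<or> I (Suc n) = from_nat_into C (Suc n)"
      using ch[OF Suc e] by blast
    then show ?case using Suc e by metis
  qed
  moreover have "incseq I" by (rule monoI) (unfold I_def, rule UN_mono, simp_all)
  moreover have "(\<Union>k. I k) = \<Union>C"
  proof
    show "(\<Union>k. I k) \<subseteq> \<Union>C" using from_nat_into[OF C(3)] unfolding I_def by blast
    show "\<Union>C \<subseteq> (\<Union>k. I k)"
    proof
      fix z assume "z \<in> \<Union>C"
      then obtain c where c: "c \<in> C" "z \<in> c" by blast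
      obtain n where "from_nat_into C n = c" using from_nat_into_surj[OF C(2) c(1)] by blast
      then show "z \<in> (\<Union>k. I k)" using c(2) unfolding I_def by blast
    qed
  qed
  ultimately have "range I \<subseteq> F \<and> incseq I \<and> (\<Union>k. I k) = \<Union>F" unfolding C(4) by blast
  then show ?thesis by (rule exI[where x = I])
qed

text \<open>Two omitted points are assumed because the circle minus one point is not a good
  interval. The first, \<open>x\<close>, serves as the cut: no member wraps around it, and the
  infimum and supremum of the angles belong to the endpoints of the union.\<close>

lemma chain_union_good:
  assumes "F \<noteq> {}" and gd: "\<And>J. J \<in> F \<Longrightarrow> good_interval J"
    and ch: "\<And>J K. J \<in> F \<Longrightarrow> K \<in> F \<Longrightarrow> J \<subseteq> K \<or> K \<subseteq> J"
    and xy: "x \<in> S1" "y \<in> S1" "x \<noteq> y" "x \<notin> \<Union>F" "y \<notin> \<Union>F"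
  shows "good_interval (\<Union>F)"
proof -
  define \<theta> where "\<theta> z = Arg2pi (z / x)" for z
  define S where "S = \<theta> ` \<Union>F"
  have bd: "0 \<le> \<theta> z" "\<theta> z < 2 * pi" for z using Arg2pi[of "z / x"] by (auto simp: \<theta>_def)
  have x0: "\<theta> x = 0" using Arg2pi_self[OF xy(1)] by (simp add: \<theta>_def)
  have y0: "\<theta> y > 0" using S1_eq_iff_base[OF xy(2,1,1)] xy(3) bd[of y] x0 by (auto simp: \<theta>_def)
  have cy: "z \<in> open_arc c d \<longleftrightarrow> cyc (\<theta> c) (\<theta> z) (\<theta> d)" if "c \<in> S1" "d \<in> S1" "z \<in> S1" for c d z
    using arc_cyc_base[OF that xy(1)] by (simp add: \<theta>_def)
  have arcs: "\<exists>c d. c \<in> S1 \<and> d \<in> S1 \<and> c \<noteq> d \<and> J = open_arc c d \<and> \<not> cyc (\<theta> c) 0 (\<theta> d)" if "J \<in> F" for J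
  proof -
    obtain c d where cd: "c \<in> S1" "d \<in> S1" "c \<noteq> d" "J = open_arc c d"
      using gd[OF \<open>J \<in> F\<close>] by (rule good_intervalE)
    then show ?thesis using cy[of c d x] x0 xy that by auto
  qed
  have US: "\<Union>F \<subseteq> S1" using arcs by (auto dest: arc_sub_S1)
  have ne: "S \<noteq> {}"
  proof -
    obtain J where "J \<in> F" using assms(1) by blast
    then show ?thesis using arcs[of J] arc_nonempty by (fastforce simp: S_def)
  qed
  have bb: "bdd_below S" "bdd_above S" using bd by (force simp: S_def bdd_below_def bdd_above_def intro: less_imp_le)+
  define a where "a = Inf S"
  define b where "b = Sup S"
  have mem: "z \<in> \<Union>F \<longleftrightarrow> z \<in> S1 \<and> a < \<theta> z \<and> \<theta> z < b" for z
  proof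
    assume z: "z \<in> \<Union>F"
    then obtain J where J: "J \<in> F" "z \<in> J" by blast
    then obtain c d where cd: "c \<in> S1" "d \<in> S1" "c \<noteq> d" "J = open_arc c d" "\<not> cyc (\<theta> c) 0 (\<theta> d)"
      using arcs by blast
    have zS: "z \<in> S1" using US z by blast
    have "z \<noteq> c" "z \<noteq> d" using J cd by auto
    obtain p where p: "p \<in> open_arc c z" using arc_nonempty[OF cd(1) zS] \<open>z \<noteq> c\<close> by metis
    obtain q where q: "q \<in> open_arc z d" using arc_nonempty[OF zS cd(2)] \<open>z \<noteq> d\<close> by metis
    have pq: "p \<in> S1" "q \<in> S1" using p q arc_sub_S1 by blast+
    have cz: "cyc (\<theta> c) (\<theta> z) (\<theta> d)" "cyc (\<theta> c) (\<theta> p) (\<theta> z)" "cyc (\<theta> z) (\<theta> q) (\<theta> d)"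
      using J p q cd cy zS pq by auto
    have "cyc (\<theta> c) (\<theta> p) (\<theta> d)" "\<theta> p < \<theta> z" "cyc (\<theta> c) (\<theta> q) (\<theta> d)" "\<theta> z < \<theta> q"
      using cz cd(5) bd[of c] bd[of d] bd[of p] bd[of q] bd[of z] unfolding cyc_def by argo+
    then have "\<theta> p \<in> S" "\<theta> q \<in> S" "\<theta> p < \<theta> z" "\<theta> z < \<theta> q"
      using cy[OF cd(1,2) pq(1)] cy[OF cd(1,2) pq(2)] cd(4) J by (auto simp: S_def)
    then show "z \<in> S1 \<and> a < \<theta> z \<and> \<theta> z < b"
      using cInf_lower[OF _ bb(1)] cSup_upper[OF _ bb(2)] zS unfolding a_def b_def by (meson le_less_trans less_le_trans)
  next
    assume z: "z \<in> S1 \<and> a < \<theta> z \<and> \<theta> z < b"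
    then obtain p q where "p \<in> \<Union>F" "\<theta> p < \<theta> z" "q \<in> \<Union>F" "\<theta> z < \<theta> q"
      using cInf_lessD[OF ne] less_cSupD[OF ne] unfolding a_def b_def S_def by blast
    moreover from this obtain J where J: "J \<in> F" "p \<in> J" "q \<in> J" using ch by blast
    moreover from arcs[OF J(1)] obtain c d where cd: "c \<in> S1" "d \<in> S1" "c \<noteq> d" "J = open_arc c d" "\<not> cyc (\<theta> c) 0 (\<theta> d)" by blast
    ultimately have "cyc (\<theta> c) (\<theta> p) (\<theta> d)" "cyc (\<theta> c) (\<theta> q) (\<theta> d)" "\<theta> p < \<theta> z" "\<theta> z < \<theta> q"
      using cy US by blast+
    then have "cyc (\<theta> c) (\<theta> z) (\<theta> d)"
      using cd(5) bd[of c] bd[of d] bd[of p] bd[of q] unfolding cyc_def by argo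
    then show "z \<in> \<Union>F" using cy cd z J by blast
  qed
  obtain z0 where z0: "z0 \<in> \<Union>F" using ne S_def by auto
  then have ab: "a < b" using mem by force
  have "0 \<le> a" unfolding a_def using ne bd by (intro cInf_greatest) (auto simp: S_def)
  have "b \<le> 2 * pi" unfolding b_def using ne bd by (intro cSup_least) (auto simp: S_def intro: less_imp_le)
  define u where "u = x * cis a"
  define v where "v = x * cis b"
  have uv: "u \<in> S1" "v \<in> S1" using S1_cis[OF xy(1)] by (simp_all only: u_def v_def)
  have tu: "\<theta> u = a" unfolding \<theta>_def u_def using ab \<open>0 \<le> a\<close> \<open>b \<le> 2 * pi\<close> by (intro Arg2pi_cis_base xy) auto
  \<comment> \<open>The supremum may be the full turn. Then the right endpoint is \<open>x\<close>
    itself, with angle 0, and the omitted point \<open>y\<close> keeps the left endpoint away from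
    it.\<close>
  have tv: "\<theta> v = b \<and> b < 2 * pi \<or> \<theta> v = 0 \<and> b = 2 * pi \<and> a > 0"
  proof (cases "b = 2 * pi")
    case True
    then have "v = x" by (simp add: v_def)
    moreover have "a > 0" using mem[of y] y0 xy bd[of y] True by auto
    ultimately show ?thesis using True x0 by simp
  next
    case False
    then show ?thesis unfolding \<theta>_def v_def using ab \<open>0 \<le> a\<close> \<open>b \<le> 2 * pi\<close> Arg2pi_cis_base[OF xy(1), of b] by auto
  qed
  have "z \<in> \<Union>F \<longleftrightarrow> z \<in> open_arc u v" for z
  proof (cases "z \<in> S1")
    case True
    have "z \<in> \<Union>F \<longleftrightarrow> cyc (\<theta> u) (\<theta> z) (\<theta> v)"
      using mem[of z] True tu tv bd[of z] ab unfolding cyc_def by argo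
    then show ?thesis using cy uv True by blast
  qed (use US arc_sub_S1 in blast)
  then have "\<Union>F = open_arc u v" by blast
  moreover have "u \<noteq> v" using tu tv ab by auto
  ultimately show ?thesis using good_interval_arc uv by metis
qed


text \<open>Coming counter-clockwise from the outside point \<open>c\<close>, the arc is entered
  through \<open>a\<close>.\<close>

lemma arc_avoid_left:
  assumes "p \<in> open_arc a b" "c \<in> S1" "c \<notin> open_arc a b"
  shows "a = c \<or> a \<in> open_arc c p"
proof -
  note s = arc_sub_S1[OF assms(1)]
  have "a = c \<or> p \<noteq> c" using assms by blast
  show ?thesis using assms s by (simp only: arc_cyc S1_eq_iff cyc_def) argo
qed

lemma arc_avoid_right:
  assumes "p \<in> open_arc a b" "c \<in> S1" "c \<notin> open_arc a b"
  shows "b = c \<or> b \<in> open_arc p c"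
proof -
  note s = arc_sub_S1[OF assms(1)]
  show ?thesis using assms s by (simp only: arc_cyc S1_eq_iff cyc_def) argo
qed

lemma arc_right_trans: "x \<in> open_arc z p \<Longrightarrow> y = x \<or> y \<in> open_arc x p \<Longrightarrow> y \<in> open_arc z p"
proof -
  assume a: "x \<in> open_arc z p" "y = x \<or> y \<in> open_arc x p"
  then have "y \<in> S1" using arc_sub_S1 by blast
  with a arc_sub_S1[OF a(1)] show ?thesis by (simp only: arc_cyc S1_eq_iff cyc_def) argo
qed

lemma arc_left_trans_eq: "x \<in> open_arc p z \<Longrightarrow> y = x \<or> y \<in> open_arc p x \<Longrightarrow> y \<in> open_arc p z"
  using arc_left_trans by blast

lemma arc_outside:
  assumes "x \<in> open_arc u y" "y \<in> open_arc u v" "w \<in> S1" "w \<notin> open_arc u v"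
  shows "w \<in> open_arc y x"
proof -
  have S: "x \<in> S1" "y \<in> S1" "x \<noteq> y" using assms(1) arc_sub_S1(1,3)[OF assms(1)] arc_ends by blast+
  have x: "x \<in> open_arc u v" by (rule arc_left_trans[OF assms(1,2)])
  have "w \<notin> open_arc x y" using arc_right_trans[OF assms(1)] arc_left_trans[OF _ assms(2)] assms(4) by blast
  then show ?thesis using arc_cases[OF S(1,2) assms(3) S(3)] x assms(2,4) by blast
qed

lemma rainbow_small:
  assumes "rainbow_point L p" "\<And>I. I \<in> L \<Longrightarrow> good_interval I" "c \<in> S1" "d \<in> S1" "c \<noteq> p" "d \<noteq> p" "p \<in> S1"
  shows "\<exists>a b. a \<in> S1 \<and> b \<in> S1 \<and> a \<noteq> b \<and> open_arc a b \<in> L \<and> p \<in> open_arc a b \<and> a \<in> open_arc c p \<and> b \<in> open_arc p d"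
proof -
  obtain I :: "nat \<Rightarrow> complex set" where I: "range I \<subseteq> L" "decseq I" "(\<Inter>k. I k) = {p}"
    using assms(1) unfolding rainbow_point_def by blast
  \<comment> \<open>Auxiliary points strictly inside the two arcs: an interval around
    \<open>p\<close> that omits them ends at or beyond them, hence strictly inside
    \<open>(c, p)\<close> and \<open>(p, d)\<close>.\<close>
  obtain c' where c': "c' \<in> open_arc c p" using arc_nonempty assms by metis
  obtain d' where d': "d' \<in> open_arc p d" using arc_nonempty assms by metis
  have "c' \<noteq> p" "d' \<noteq> p" using c' d' by auto
  then obtain k l where "c' \<notin> I k" "d' \<notin> I l" using I(3) by (metis INT_I UNIV_I singletonD)
  then have n: "c' \<notin> I (max k l)" "d' \<notin> I (max k l)"
    using decseqD[OF I(2), of k "max k l"] decseqD[OF I(2), of l "max k l"] by auto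
  have "good_interval (I (max k l))" "I (max k l) \<in> L" using I(1) assms(2) by blast+
  then obtain a b where ab: "a \<in> S1" "b \<in> S1" "a \<noteq> b" "I (max k l) = open_arc a b" by (metis good_intervalE)
  have p: "p \<in> open_arc a b" using I(3) ab(4) by blast
  have "a = c' \<or> a \<in> open_arc c' p" "b = d' \<or> b \<in> open_arc p d'"
    using arc_avoid_left[OF p] arc_avoid_right[OF p] n ab arc_sub_S1 c' d' by metis+
  then have "a \<in> open_arc c p" "b \<in> open_arc p d" using arc_right_trans[OF c'] arc_left_trans_eq[OF d'] by blast+
  then show ?thesis using ab p \<open>I (max k l) \<in> L\<close> by auto
qed

text \<open>Knaster--Tarski: no continuity is needed, only monotonicity on the closed arc.\<close>

lemma fixed_point_in_arc:
  assumes maps: "\<And>x. x \<in> S1 \<Longrightarrow> g x \<in> S1"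
    and ori: "\<And>x y z. y \<in> open_arc x z \<Longrightarrow> g y \<in> open_arc (g x) (g z)"
    and uv: "u \<in> S1" "v \<in> S1" "u \<noteq> v" "g u \<noteq> g v" and sub: "open_arc (g u) (g v) \<subseteq> open_arc u v"
  shows "\<exists>x\<in>S1. g x = x \<and> x \<notin> open_arc v u"
proof -
  define \<theta> where "\<theta> z = Arg2pi (z / u)" for z
  have bd: "0 \<le> \<theta> z" "\<theta> z < 2 * pi" for z using Arg2pi[of "z / u"] by (auto simp: \<theta>_def)
  have u0: "\<theta> u = 0" using Arg2pi_self[OF uv(1)] by (simp add: \<theta>_def)
  have inj: "x = y \<longleftrightarrow> \<theta> x = \<theta> y" if "x \<in> S1" "y \<in> S1" for x y
    using S1_eq_iff_base[OF that uv(1)] by (simp add: \<theta>_def)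
  have v0: "\<theta> v > 0" using inj[OF uv(2,1)] uv(3) bd[of v] u0 by auto
  have cy: "z \<in> open_arc c d \<longleftrightarrow> cyc (\<theta> c) (\<theta> z) (\<theta> d)" if "c \<in> S1" "d \<in> S1" "z \<in> S1" for c d z
    using arc_cyc_base[OF that uv(1)] by (simp add: \<theta>_def)
  have or: "cyc (\<theta> (g x)) (\<theta> (g y)) (\<theta> (g z))" if "cyc (\<theta> x) (\<theta> y) (\<theta> z)" "x \<in> S1" "y \<in> S1" "z \<in> S1" for x y z
    using ori[of y x z] that cy[of x z y] cy[of "g x" "g z" "g y"] maps by blast
  have gS: "g u \<in> S1" "g v \<in> S1" using maps uv by auto
  have H: "x \<notin> open_arc v u \<longleftrightarrow> \<theta> x \<le> \<theta> v" if "x \<in> S1" for x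
    using cy[OF uv(2,1) that] v0 bd[of x] u0 unfolding cyc_def by argo
  have "g u \<in> closure (open_arc u v)" "g v \<in> closure (open_arc u v)"
    using closure_mono[OF sub] closure_arc[OF gS uv(4)] by auto
  then have guH: "\<theta> (g u) \<le> \<theta> v" "\<theta> (g v) \<le> \<theta> v"
    using closure_arc[OF uv(1-3)] H[OF gS(1)] H[OF gS(2)] arc_not_dual[of _ u v] by auto
  have nn: "\<not> cyc (\<theta> (g u)) 0 (\<theta> (g v))" "\<not> cyc (\<theta> (g u)) (\<theta> v) (\<theta> (g v))"
    using sub cy[OF gS uv(1)] cy[OF gS uv(2)] u0 by auto
  have "\<theta> (g u) \<noteq> \<theta> (g v)" using inj gS uv by blast
  \<comment> \<open>The only competing order is that \<open>g\<close> exchanges \<open>u\<close> and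
    \<open>v\<close>; then the image arc is the complementary arc, which is not inside
    \<open>(u, v)\<close>.\<close>
  have lt: "\<theta> (g u) < \<theta> (g v)"
  proof (rule ccontr)
    assume "\<not> \<theta> (g u) < \<theta> (g v)"
    with \<open>\<theta> (g u) \<noteq> \<theta> (g v)\<close> have e: "\<theta> (g v) = 0" "\<theta> (g u) = \<theta> v" using nn guH bd[of "g v"] unfolding cyc_def by argo+
    then have "g v = u" "g u = v" using inj gS uv u0 by metis+
    then have "open_arc v u \<subseteq> open_arc u v" using sub by simp
    moreover obtain z where "z \<in> open_arc v u" using arc_nonempty[OF uv(2,1)] uv(3) by blast
    ultimately show False using arc_not_dual[of z u v] by blast
  qed
  have in_H: "\<theta> (g u) \<le> \<theta> (g x)" "\<theta> (g x) \<le> \<theta> (g v)" if "x \<in> S1" "\<theta> x \<le> \<theta> v" for x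
  proof -
    have "x = u \<or> x = v \<or> cyc (\<theta> u) (\<theta> x) (\<theta> v)"
      using that inj uv bd[of x] u0 unfolding cyc_def by (metis order_le_less)
    then have "\<theta> (g u) \<le> \<theta> (g x) \<and> \<theta> (g x) \<le> \<theta> (g v)"
      using or[of u x v] that uv lt by (auto simp: cyc_def)
    then show "\<theta> (g u) \<le> \<theta> (g x)" "\<theta> (g x) \<le> \<theta> (g v)" by auto
  qed
  have mono: "\<theta> (g x) \<le> \<theta> (g y)" if "x \<in> S1" "y \<in> S1" "\<theta> x \<le> \<theta> y" "\<theta> y \<le> \<theta> v" for x y
  proof -
    have "x = u \<or> x = y \<or> cyc (\<theta> u) (\<theta> x) (\<theta> y)"
      using that inj uv bd[of x] u0 unfolding cyc_def by (metis order_le_less)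
    then show ?thesis using or[of u x y] that uv in_H[of x] in_H[of y] by (auto simp: cyc_def)
  qed
  \<comment> \<open>The angles of points of the closed arc that are not moved backwards; by
    monotonicity the point at their supremum is fixed.\<close>
  define P where "P = {\<theta> x |x. x \<in> S1 \<and> \<theta> x \<le> \<theta> v \<and> \<theta> x \<le> \<theta> (g x)}"
  have P0: "0 \<in> P" using uv u0 v0 bd[of "g u"] by (auto simp: P_def intro!: exI[of _ u])
  have Pb: "bdd_above P" by (rule bdd_aboveI[of _ "\<theta> v"]) (auto simp: P_def)
  define s where "s = Sup P"
  have s: "0 \<le> s" "s \<le> \<theta> v" using cSup_upper[OF P0 Pb] P0 unfolding s_def by (auto intro!: cSup_least simp: P_def)
  define x where "x = u * cis s"
  have x: "x \<in> S1" unfolding x_def by (rule S1_cis[OF uv(1)])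
  have tx: "\<theta> x = s" unfolding \<theta>_def x_def using s bd[of v] by (intro Arg2pi_cis_base uv) auto
  have le: "s \<le> \<theta> (g x)" unfolding s_def
  proof (rule cSup_least)
    fix r assume "r \<in> P"
    then obtain y where y: "r = \<theta> y" "y \<in> S1" "\<theta> y \<le> \<theta> v" "\<theta> y \<le> \<theta> (g y)" by (auto simp: P_def)
    have "r \<le> s" using \<open>r \<in> P\<close> Pb unfolding s_def by (rule cSup_upper)
    then have "\<theta> (g y) \<le> \<theta> (g x)" using y x tx s by (intro mono) auto
    then show "r \<le> \<theta> (g x)" using y by simp
  qed (use P0 in blast)
  have gx: "g x \<in> S1" "\<theta> (g x) \<le> \<theta> v" using maps x in_H(2)[of x] tx s guH by auto
  have "\<theta> (g x) \<le> \<theta> (g (g x))" using x gx le tx by (intro mono) auto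
  then have "\<theta> (g x) \<in> P" using gx by (auto simp: P_def)
  then have "\<theta> (g x) \<le> s" using Pb unfolding s_def by (rule cSup_upper)
  then have "g x = x" using le tx inj gx x by auto
  then show ?thesis using H[OF x] tx s x by auto
qed

section \<open>Leaves and gaps\<close>

text \<open>A leaf together with a side: exchanging \<open>u\<close> and \<open>v\<close> describes
  the same leaf from the other side.\<close>

definition lf :: "complex set set \<Rightarrow> complex \<Rightarrow> complex \<Rightarrow> bool" where
  "lf L u v \<longleftrightarrow> u \<in> S1 \<and> v \<in> S1 \<and> u \<noteq> v \<and> open_arc u v \<in> L"

lemma lfD: "lf L u v \<Longrightarrow> u \<in> S1" "lf L u v \<Longrightarrow> v \<in> S1" "lf L u v \<Longrightarrow> u \<noteq> v"
  "lf L u v \<Longrightarrow> open_arc u v \<in> L"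
  by (auto simp only: lf_def)

lemma lam_good: "lamination_system L \<Longrightarrow> I \<in> L \<Longrightarrow> good_interval I"
  unfolding lamination_system_def by blast

lemma lam_arcE:
  assumes "lamination_system L" "I \<in> L"
  obtains u v where "lf L u v" "I = open_arc u v"
  using lam_good[OF assms] assms(2) unfolding lf_def by (metis good_intervalE)

lemma lf_sym: "lamination_system L \<Longrightarrow> lf L u v \<Longrightarrow> lf L v u"
  unfolding lamination_system_def lf_def using dual_interval_open_arc by metis

lemma dual_lf: "lf L u v \<Longrightarrow> dual_interval (open_arc u v) = open_arc v u"
  unfolding lf_def using dual_interval_open_arc by metis

lemma leaf_lf: "lf L u v \<Longrightarrow> leaf (open_arc u v) = {open_arc u v, open_arc v u}"
  unfolding leaf_def by (simp only: dual_lf)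

lemma lf_inj: "lf L u v \<Longrightarrow> lf L x y \<Longrightarrow> open_arc u v = open_arc x y \<Longrightarrow> u = x \<and> v = y"
  using arc_inj[of u v x y] lfD(1-3)[of L u v] lfD(1-3)[of L x y] by blast

lemma lf_cases:
  assumes "lamination_system L" "lf L u v" "lf L x y"
  shows "open_arc u v \<subseteq> open_arc x y \<or> open_arc u v \<subseteq> open_arc y x \<or>
    open_arc v u \<subseteq> open_arc x y \<or> open_arc v u \<subseteq> open_arc y x"
proof -
  have "lies_on (leaf (open_arc u v)) (open_arc x y) \<or> lies_on (leaf (open_arc u v)) (dual_interval (open_arc x y))"
    using assms(1) lfD(4)[OF assms(2)] lfD(4)[OF assms(3)] unfolding lamination_system_def by blast
  then show ?thesis
    unfolding lies_on_def leaf_lf[OF assms(2)] dual_lf[OF assms(3)] by blast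
qed

lemma lf_unlinked:
  assumes "lamination_system L" "lf L u v" "lf L x y" "x \<in> open_arc u v" "y \<in> open_arc v u"
  shows False
  using lf_cases[OF assms(1-3)] assms(4,5) arc_ends by blast

lemma lf_disjoint_iff: "lf L u v \<Longrightarrow> lf L x y \<Longrightarrow> open_arc u v \<inter> open_arc x y = {} \<longleftrightarrow> open_arc u v \<subseteq> open_arc y x"
  by (intro arc_disjoint_iff; rule lfD; assumption)

lemma lf_subset_dual: "lf L u v \<Longrightarrow> lf L x y \<Longrightarrow> open_arc u v \<subseteq> open_arc x y \<longleftrightarrow> open_arc y x \<subseteq> open_arc v u"
  by (intro arc_subset_dual; rule lfD; assumption)

lemma lf_subset_iff: "lf L u v \<Longrightarrow> lf L x y \<Longrightarrow> open_arc u v \<subseteq> open_arc x y \<longleftrightarrow> x \<notin> open_arc u v \<and> y \<notin> open_arc u v \<and>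
    (u \<in> open_arc x y \<or> v \<in> open_arc x y \<or> u = x \<and> v = y)"
  by (intro arc_subset_iff; rule lfD; assumption)

text \<open>In the fourth case the two intervals cover the circle up to the points \<open>u\<close>
  and \<open>v\<close>. Later uses exclude it by a point that both intervals omit.\<close>

lemma lf_nested:
  assumes "lamination_system L" "lf L u v" "lf L x y"
  shows "open_arc u v \<subseteq> open_arc x y \<or> open_arc x y \<subseteq> open_arc u v \<or>
    open_arc u v \<inter> open_arc x y = {} \<or> open_arc v u \<subseteq> open_arc x y"
  using lf_cases[OF assms] lf_disjoint_iff[OF assms(2,3)]
    lf_subset_dual[OF lf_sym[OF assms(1,2)] lf_sym[OF assms(1,3)]] by blast

text \<open>Covering intervals can both omit only \<open>u\<close> and \<open>v\<close>, so
  \<open>a\<close> and \<open>b\<close> would be these points; then the endpoints coincide and the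
  intervals are complementary, contrary to the common point \<open>p\<close>.\<close>

lemma lf_nested_avoid:
  assumes L: "lamination_system L" "lf L u v" "lf L x y" and p: "p \<in> open_arc u v" "p \<in> open_arc x y"
    and ab: "a \<in> S1" "b \<in> S1" "a \<noteq> b" "a \<notin> open_arc u v" "b \<notin> open_arc u v" "a \<notin> open_arc x y" "b \<notin> open_arc x y"
  shows "open_arc u v \<subseteq> open_arc x y \<or> open_arc x y \<subseteq> open_arc u v"
proof -
  have "\<not> open_arc v u \<subseteq> open_arc x y"
  proof
    assume s: "open_arc v u \<subseteq> open_arc x y"
    have "z = u \<or> z = v" if "z \<in> S1" "z \<notin> open_arc u v" "z \<notin> open_arc x y" for z
      using arc_cases[OF lfD(1-2)[OF L(2)] that(1) lfD(3)[OF L(2)]] that s by blast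
    then have "(a = u \<or> a = v) \<and> (b = u \<or> b = v)" using ab by blast
    then have "u \<notin> open_arc x y" "v \<notin> open_arc x y" using ab by auto
    then have "v = x \<and> u = y" using s lf_subset_iff[OF lf_sym[OF L(1,2)] L(3)] by blast
    then show False using p arc_not_dual by blast
  qed
  then show ?thesis using lf_nested[OF L] p by blast
qed

lemma lam_union:
  assumes L: "lamination_system L" and F: "F \<subseteq> L" "F \<noteq> {}"
    and ch: "\<And>J K. J \<in> F \<Longrightarrow> K \<in> F \<Longrightarrow> J \<subseteq> K \<or> K \<subseteq> J"
    and xy: "x \<in> S1" "y \<in> S1" "x \<noteq> y" "x \<notin> \<Union>F" "y \<notin> \<Union>F"
  shows "\<Union>F \<in> L"
proof -
  have g: "good_interval J" if "J \<in> F" for J using lam_good[OF L] that F by blast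
  have o: "openin (top_of_set S1) J" if "J \<in> F" for J
    using g[OF that] arc_openin by (metis good_intervalE)
  obtain I :: "nat \<Rightarrow> complex set" where I: "range I \<subseteq> F" "incseq I" "(\<Union>k. I k) = \<Union>F"
    using chain_seq[OF F(2) o ch] by blast
  have "good_interval (\<Union>F)" using chain_union_good[OF F(2) g ch xy] .
  then show ?thesis using L I F(1) unfolding lamination_system_def by (metis subset_trans)
qed

lemma lam_union_pt:
  assumes L: "lamination_system L" and F: "F \<subseteq> L" "F \<noteq> {}" "\<And>J. J \<in> F \<Longrightarrow> p \<in> J"
    and xy: "x \<in> S1" "y \<in> S1" "x \<noteq> y" "x \<notin> \<Union>F" "y \<notin> \<Union>F"
  shows "\<Union>F \<in> L" "\<And>J K. J \<in> F \<Longrightarrow> K \<in> F \<Longrightarrow> J \<subseteq> K \<or> K \<subseteq> J"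
proof -
  show ch: "J \<subseteq> K \<or> K \<subseteq> J" if JK: "J \<in> F" "K \<in> F" for J K
  proof -
    have JKL: "J \<in> L" "K \<in> L" using JK F(1) by blast+
    obtain u v where u: "lf L u v" "J = open_arc u v" using JKL(1) by (rule lam_arcE[OF L])
    obtain w z where w: "lf L w z" "K = open_arc w z" using JKL(2) by (rule lam_arcE[OF L])
    show ?thesis using lf_nested_avoid[OF L u(1) w(1), of p x y] u w JK F(3) xy by blast
  qed
  show "\<Union>F \<in> L" by (rule lam_union[OF L F(1,2) ch xy])
qed

section \<open>Gaps: construction from selected sides, and determination by their vertices\<close>

definition maximal_elements :: "'a set set \<Rightarrow> 'a set set" where
  "maximal_elements J = {I \<in> J. \<forall>K\<in>J. I \<subseteq> K \<longrightarrow> K = I}"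

text \<open>\<open>JJ\<close> selects sides of leaves. By \<open>cov\<close> no two selected sides
  cover the circle; applied to the two sides of one leaf it shows that only one of them is selected.
  Unlinkedness then leaves nested or disjoint sides, and \<open>un\<close> puts each below a maximal
  one.\<close>

lemma maximal_gap:
  assumes L: "lamination_system L" and JL: "JJ \<subseteq> L"
    and side: "\<And>u v. lf L u v \<Longrightarrow> open_arc u v \<in> JJ \<or> open_arc v u \<in> JJ"
    and cov: "\<And>u v x y. \<lbrakk>lf L u v; lf L x y; open_arc u v \<in> JJ; open_arc x y \<in> JJ\<rbrakk> \<Longrightarrow> \<not> open_arc v u \<subseteq> open_arc x y"
    and un: "\<And>I. I \<in> JJ \<Longrightarrow> \<Union>{J \<in> JJ. I \<subseteq> J} \<in> JJ"
  shows "gap L (maximal_elements JJ)" "\<And>I. I \<in> JJ \<Longrightarrow> \<exists>M\<in>maximal_elements JJ. I \<subseteq> M"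
proof -
  show max: "\<exists>M\<in>maximal_elements JJ. I \<subseteq> M" if "I \<in> JJ" for I
  proof
    let ?M = "\<Union>{J \<in> JJ. I \<subseteq> J}"
    show s: "I \<subseteq> ?M" using that by (intro Union_upper) simp
    have "K = ?M" if K: "K \<in> JJ" "?M \<subseteq> K" for K
      using Union_upper[of K "{J \<in> JJ. I \<subseteq> J}"] K s by (intro subset_antisym) auto
    then show "?M \<in> maximal_elements JJ" using un[OF that] unfolding maximal_elements_def by simp
  qed
  have nest: "I \<subseteq> J \<or> J \<subseteq> I \<or> I \<inter> J = {}" if IJ: "I \<in> JJ" "J \<in> JJ" for I J
  proof -
    have IJL: "I \<in> L" "J \<in> L" using IJ JL by blast+
    obtain u v where u: "lf L u v" "I = open_arc u v" using IJL(1) by (rule lam_arcE[OF L])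
    obtain w z where w: "lf L w z" "J = open_arc w z" using IJL(2) by (rule lam_arcE[OF L])
    show ?thesis using lf_nested[OF L u(1) w(1)] cov[OF u(1) w(1)] u w IJ by blast
  qed
  show "gap L (maximal_elements JJ)"
    unfolding gap_def
  proof (intro conjI ballI)
    show "maximal_elements JJ \<subseteq> L" using JL by (auto simp: maximal_elements_def)
    have "I = K \<or> I \<inter> K = {}" if IK: "I \<in> maximal_elements JJ" "K \<in> maximal_elements JJ" for I K
    proof -
      have "I \<in> JJ" "K \<in> JJ" "I \<subseteq> K \<Longrightarrow> K = I" "K \<subseteq> I \<Longrightarrow> I = K" using IK by (auto simp: maximal_elements_def)
      then show ?thesis using nest[of I K] by blast
    qed
    then show "disjoint (maximal_elements JJ)" unfolding disjoint_def by blast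
    fix l assume "l \<in> leaves L"
    then obtain I where I: "I \<in> L" "l = leaf I" by (auto simp: leaves_def)
    obtain u v where u: "lf L u v" "I = open_arc u v" using I(1) by (rule lam_arcE[OF L])
    show "\<exists>J\<in>maximal_elements JJ. lies_on l J"
      unfolding I(2) u(2) lies_on_def leaf_lf[OF u(1)]
      using side[OF u(1)] max[of "open_arc u v"] max[of "open_arc v u"] by blast
  qed
qed

lemma gap_lfE:
  assumes "lamination_system L" "gap L G" "I \<in> G"
  obtains u v where "lf L u v" "I = open_arc u v"
  using assms unfolding gap_def by (meson lam_arcE subsetD)

lemma gap_lf: "lamination_system L \<Longrightarrow> gap L G \<Longrightarrow> open_arc u v \<in> G \<Longrightarrow> u \<in> S1 \<Longrightarrow> v \<in> S1 \<Longrightarrow> u \<noteq> v \<Longrightarrow> lf L u v"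
  unfolding gap_def lf_def by blast

lemma gap_disjoint: "gap L G \<Longrightarrow> I \<in> G \<Longrightarrow> J \<in> G \<Longrightarrow> z \<in> I \<Longrightarrow> z \<in> J \<Longrightarrow> I = J"
  unfolding gap_def disjoint_def by blast

lemma gap_vertex:
  assumes L: "lamination_system L" and G: "gap L G" "open_arc u v \<in> G" and uv: "u \<in> S1" "v \<in> S1" "u \<noteq> v"
  shows "u \<in> vertices G" "v \<in> vertices G"
proof -
  have luv: "lf L u v" by (rule gap_lf[OF L G uv])
  have "u \<notin> M \<and> v \<notin> M" if M: "M \<in> G" for M
  proof (cases "M = open_arc u v")
    case False
    obtain x y where x: "lf L x y" "M = open_arc x y" using gap_lfE[OF L G(1) M] .
    have "open_arc x y \<inter> open_arc u v = {}" using gap_disjoint[OF G(1) M G(2)] False x by blast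
    then have "open_arc x y \<subseteq> open_arc v u" using lf_disjoint_iff[OF x(1) luv] by blast
    then show ?thesis using x arc_ends by blast
  qed (use arc_ends in blast)
  then show "u \<in> vertices G" "v \<in> vertices G" using uv unfolding vertices_def by blast+
qed

lemma vertices_S1: "vertices G \<subseteq> S1"
  unfolding vertices_def by blast

text \<open>The element of the gap that meets the arc has vertices as endpoints. None of these lies
  inside the arc, and neither \<open>x\<close> nor \<open>y\<close> lies inside the element, so the
  endpoints agree.\<close>

lemma gap_arc_of_vertices:
  assumes L: "lamination_system L" and G: "gap L G"
    and xy: "x \<in> vertices G" "y \<in> vertices G" "x \<noteq> y" "open_arc x y \<inter> vertices G = {}"
  shows "open_arc x y \<in> G"
proof -
  have S: "x \<in> S1" "y \<in> S1" using xy vertices_S1 by blast+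
  obtain z where z: "z \<in> open_arc x y" using arc_nonempty[OF S xy(3)] by blast
  then have "z \<in> \<Union>G" using xy(4) arc_sub_S1(1)[OF z] unfolding vertices_def by blast
  then obtain M where M: "M \<in> G" "z \<in> M" by blast
  obtain u v where u: "lf L u v" "M = open_arc u v" using gap_lfE[OF L G M(1)] .
  have uv: "u \<in> S1" "v \<in> S1" "u \<noteq> v" using lfD[OF u(1)] by auto
  have "u \<in> vertices G" "v \<in> vertices G" using gap_vertex[OF L G _ uv] M u by blast+
  then have n: "u \<notin> open_arc x y" "v \<notin> open_arc x y" using xy(4) by blast+
  have m: "x \<notin> open_arc u v" "y \<notin> open_arc u v" using xy M u unfolding vertices_def by blast+
  have "x = u" using arc_avoid_left[OF z, of u] arc_avoid_left[of z u v x] n m M u uv S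
      arc_not_dual arc_rotate by metis
  moreover have "y = v" using arc_avoid_right[OF z, of v] arc_avoid_right[of z u v y] n m M u uv S
      arc_not_dual arc_rotate by metis
  ultimately show ?thesis using M u by blast
qed

text \<open>The elements of a gap are the arcs between consecutive vertices. Invariance of a gap can
  thus be checked on its vertex set.\<close>

lemma gap_eqI:
  assumes L: "lamination_system L" and G: "gap L G" "gap L H" "vertices G = vertices H"
  shows "G = H"
proof -
  have "A \<subseteq> B" if g: "gap L A" "gap L B" "vertices A = vertices B" for A B
  proof
    fix I assume I: "I \<in> A"
    obtain u v where u: "lf L u v" "I = open_arc u v" using gap_lfE[OF L g(1) I] .
    show "I \<in> B" unfolding u(2)
    proof (rule gap_arc_of_vertices[OF L g(2)])
      show "u \<in> vertices B" "v \<in> vertices B"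
        using gap_vertex[OF L g(1) _ lfD(1-3)[OF u(1)]] I u g(3) by blast+
      show "u \<noteq> v" by (rule lfD[OF u(1)])
      show "open_arc u v \<inter> vertices B = {}" unfolding g(3)[symmetric] using I u unfolding vertices_def by blast
    qed
  qed
  then show ?thesis using G by (metis subset_antisym)
qed

lemma gap_leaf_side:
  assumes "gap L G" "lf L x y"
  shows "\<exists>M\<in>G. open_arc x y \<subseteq> M \<or> open_arc y x \<subseteq> M"
proof -
  have "leaf (open_arc x y) \<in> leaves L" using lfD(4)[OF assms(2)] by (auto simp: leaves_def)
  then obtain M where M: "M \<in> G" "lies_on (leaf (open_arc x y)) M" using assms(1) unfolding gap_def by blast
  then show ?thesis unfolding lies_on_def leaf_lf[OF assms(2)] by blast
qed

lemma lam_nonempty: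
  assumes "lamination_system L"
  obtains u v where "lf L u v"
proof -
  obtain I where "I \<in> L" using assms unfolding lamination_system_def by blast
  then show ?thesis using that by (metis lam_arcE[OF assms])
qed

lemma gap_nonempty:
  assumes L: "lamination_system L" and G: "gap L G"
  obtains u v where "lf L u v" "open_arc u v \<in> G"
proof -
  obtain u v where "lf L u v" using L by (rule lam_nonempty)
  then obtain M where "M \<in> G" using gap_leaf_side[OF G] by blast
  then show ?thesis using that by (metis gap_lfE[OF L G])
qed

lemma polygon_next:
  assumes L: "lamination_system L" and G: "ideal_polygon L G" and x: "x \<in> vertices G"
  obtains y where "lf L x y" "open_arc x y \<in> G"
proof -
  have g: "gap L G" and fin: "finite (vertices G)" using G unfolding ideal_polygon_def by auto
  obtain u v where u: "lf L u v" "open_arc u v \<in> G" using gap_nonempty[OF L g] .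
  have "u \<in> vertices G" "v \<in> vertices G" "u \<noteq> v" using gap_vertex[OF L g u(2)] lfD[OF u(1)] by blast+
  then have "vertices G - {x} \<noteq> {}" by blast
  moreover have "closed (vertices G - {x})" using fin by (intro finite_imp_closed) auto
  moreover have "vertices G - {x} \<subseteq> S1" "x \<in> S1" using vertices_S1 x by blast+
  ultimately obtain y where y: "y \<in> vertices G - {x}" "open_arc x y \<inter> (vertices G - {x}) = {}"
    using closed_next[of "vertices G - {x}" x] by blast
  then have "open_arc x y \<in> G" using x arc_ends(1)[of x y] by (intro gap_arc_of_vertices[OF L g]) blast+
  moreover have "lf L x y" using gap_lf[OF L g calculation] x y vertices_S1 by blast
  ultimately show ?thesis using that by blast
qed

lemma vertices_leaf:
  assumes "lf L u v"
  shows "vertices (leaf (open_arc u v)) = {u, v}"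
proof -
  note s = lfD[OF assms]
  have "z \<in> vertices (leaf (open_arc u v)) \<longleftrightarrow> z = u \<or> z = v" for z
    using arc_cases[OF s(1,2) _ s(3), of z] s(1,2) arc_ends[of u v] arc_ends[of v u]
    by (auto simp: vertices_def leaf_lf[OF assms])
  then show ?thesis by blast
qed

lemma endpoints_iff:
  assumes L: "lamination_system L"
  shows "x \<in> endpoints L \<longleftrightarrow> (\<exists>y. lf L x y)"
proof
  assume "x \<in> endpoints L"
  then obtain I where I: "I \<in> L" "x \<in> vertices (leaf I)" unfolding endpoints_def by blast
  obtain u v where u: "lf L u v" "I = open_arc u v" using I(1) by (rule lam_arcE[OF L])
  then have "x = u \<or> x = v" using I vertices_leaf[OF u(1)] by blast
  then show "\<exists>y. lf L x y" using u lf_sym[OF L u(1)] by blast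
next
  assume "\<exists>y. lf L x y"
  then obtain y where y: "lf L x y" by blast
  then show "x \<in> endpoints L" using vertices_leaf[OF y] lfD(4)[OF y] unfolding endpoints_def by blast
qed

lemma leaf_gap:
  assumes L: "lamination_system L" "lf L u v"
  shows "gap L {open_arc u v, open_arc v u}" "vertices {open_arc u v, open_arc v u} = {u, v}"
proof -
  show "vertices {open_arc u v, open_arc v u} = {u, v}" using vertices_leaf[OF L(2)] leaf_lf[OF L(2)] by simp
  have "\<exists>J\<in>{open_arc u v, open_arc v u}. lies_on l J" if l: "l \<in> leaves L" for l
  proof -
    obtain I where I: "I \<in> L" "l = leaf I" using l by (auto simp: leaves_def)
    obtain x y where x: "lf L x y" "I = open_arc x y" using I(1) by (rule lam_arcE[OF L(1)])
    show ?thesis unfolding I(2) x(2) lies_on_def leaf_lf[OF x(1)] using lf_cases[OF L(1) x(1) L(2)] by blast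
  qed
  then show "gap L {open_arc u v, open_arc v u}"
    unfolding gap_def disjoint_def using lfD(4)[OF L(2)] lfD(4)[OF lf_sym[OF L]] arc_not_dual by blast
qed

lemma leavesE:
  assumes L: "lamination_system L" and "G \<in> leaves L"
  obtains u v where "lf L u v" "G = {open_arc u v, open_arc v u}"
proof -
  obtain I where I: "I \<in> L" "G = leaf I" using assms(2) by (auto simp: leaves_def)
  obtain x y where x: "lf L x y" "I = open_arc x y" using I(1) by (rule lam_arcE[OF L])
  show ?thesis using that[OF x(1)] I x leaf_lf[OF x(1)] by simp
qed

lemma leaves_lf: "lf L u v \<Longrightarrow> {open_arc u v, open_arc v u} \<in> leaves L"
  using leaf_lf[of L u v] lfD(4)[of L u v] unfolding leaves_def by blast

lemma quite_fullD: "quite_full L \<Longrightarrow> lamination_system L" "quite_full L \<Longrightarrow> gap L G \<Longrightarrow> ideal_polygon L G \<or> crown L G"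
  unfolding quite_full_def by blast+

section \<open>Crowns and the trichotomy for points\<close>

lemma arc_linear:
  assumes "x \<in> S1" "y \<in> S1" "w \<in> S1" "x \<noteq> y" "x \<noteq> w" "y \<noteq> w"
  shows "x \<in> open_arc w y \<or> y \<in> open_arc w x"
  using arc_cases[OF assms(3,2,1)] assms arc_rotate by metis

lemma arc_left_eq:
  assumes "open_arc w d \<subseteq> open_arc c e" "w \<notin> open_arc c e" "w \<in> S1" "d \<in> S1" "w \<noteq> d"
  shows "c = w"
proof (rule ccontr)
  assume "c \<noteq> w"
  obtain z where z: "z \<in> open_arc w d" using arc_nonempty[OF assms(3-5)] by blast
  then have "z \<in> open_arc c e" using assms(1) by blast
  then have "c \<in> open_arc w z" using arc_avoid_left[of z c e w] assms(2,3) \<open>c \<noteq> w\<close> by blast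
  then have "c \<in> open_arc w d" using arc_left_trans z by blast
  then show False using assms(1) arc_ends by blast
qed

lemma arc_right_eq:
  assumes "open_arc d w \<subseteq> open_arc c e" "w \<notin> open_arc c e" "w \<in> S1" "d \<in> S1" "w \<noteq> d"
  shows "e = w"
proof (rule ccontr)
  assume "e \<noteq> w"
  obtain z where z: "z \<in> open_arc d w" using arc_nonempty[OF assms(4,3)] assms(5) by blast
  then have "z \<in> open_arc c e" using assms(1) by blast
  then have "e \<in> open_arc z w" using arc_avoid_right[of z c e w] assms(2,3) \<open>e \<noteq> w\<close> by blast
  then have "e \<in> open_arc d w" using arc_right_trans[OF z] by blast
  then show False using assms(1) arc_ends by blast
qed

text \<open>The last three clauses go beyond the definition of a crown: the tips are in order as
  seen from the pivot and accumulate at it from both sides. \<open>crownE\<close> derives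
  them.\<close>

definition crown_seq :: "complex set set \<Rightarrow> complex set set \<Rightarrow> complex \<Rightarrow> (int \<Rightarrow> complex) \<Rightarrow> bool" where
  "crown_seq L G p t \<longleftrightarrow> gap L G \<and> p \<in> S1 \<and> (\<forall>k. lf L (t k) (t (k + 1))) \<and>
    G = range (\<lambda>k. open_arc (t k) (t (k + 1))) \<and> vertices G = insert p (range t) \<and> p \<notin> range t \<and>
    (\<forall>j k. j < k \<longrightarrow> t j \<in> open_arc p (t k)) \<and>
    (\<forall>z\<in>S1. z \<noteq> p \<longrightarrow> (\<exists>k. t k \<in> open_arc z p)) \<and>
    (\<forall>z\<in>S1. z \<noteq> p \<longrightarrow> (\<exists>k. t k \<in> open_arc p z))"

lemma crown_seqD:
  assumes "crown_seq L G p t"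
  shows "gap L G" "p \<in> S1" "lf L (t k) (t (k + 1))" "G = range (\<lambda>k. open_arc (t k) (t (k + 1)))"
    "vertices G = insert p (range t)" "p \<notin> range t" "j < k \<Longrightarrow> t j \<in> open_arc p (t k)"
    "z \<in> S1 \<Longrightarrow> z \<noteq> p \<Longrightarrow> \<exists>k. t k \<in> open_arc z p" "z \<in> S1 \<Longrightarrow> z \<noteq> p \<Longrightarrow> \<exists>k. t k \<in> open_arc p z"
  using assms unfolding crown_seq_def by blast+

lemma crown_seq_inj:
  assumes t: "crown_seq L G p t" and e: "t j = t k"
  shows "j = k"
  using crown_seqD(7)[OF t, of j k] crown_seqD(7)[OF t, of k j] arc_ends(2)[of "t k" p] e by (metis linorder_less_linear)

text \<open>Measured from \<open>p\<close>, the angles of the tips increase, since no element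
  contains \<open>p\<close>. A supremum below the full turn would lie in no element, hence be the
  angle of a tip, and the next tip would exceed it; likewise for the infimum.\<close>

lemma crownE:
  assumes L: "lamination_system L" and C: "crown_with_pivot L G p"
  obtains t where "crown_seq L G p t"
proof -
  obtain t :: "int \<Rightarrow> complex" where g: "gap L G" and t: "range t \<subseteq> S1"
    "G = range (\<lambda>k. open_arc (t k) (t (k + 1)))" "vertices G = insert p (range t)" "p \<notin> range t"
    using C unfolding crown_with_pivot_def by auto
  have p: "p \<in> S1" using t(3) vertices_S1[of G] by blast
  have tS: "t k \<in> S1" for k using t(1) by blast
  have l: "lf L (t k) (t (k + 1))" for k
  proof -
    have "open_arc (t k) (t (k + 1)) \<in> L" using g t(2) unfolding gap_def by blast
    then obtain u v where uv: "lf L u v" "open_arc (t k) (t (k + 1)) = open_arc u v" by (rule lam_arcE[OF L])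
    have "open_arc u v \<noteq> {}" using arc_nonempty lfD(1-3)[OF uv(1)] by blast
    then have "t k \<noteq> t (k + 1)" using uv(2) arc_refl by metis
    then show ?thesis using uv(2) lfD(4)[OF uv(1)] tS unfolding lf_def by simp
  qed
  define \<theta> where "\<theta> z = Arg2pi (z / p)" for z
  have bd: "0 \<le> \<theta> z" "\<theta> z < 2 * pi" for z using Arg2pi[of "z / p"] by (auto simp: \<theta>_def)
  have p0: "\<theta> p = 0" using Arg2pi_self[OF p] by (simp add: \<theta>_def)
  have inj: "x = y \<longleftrightarrow> \<theta> x = \<theta> y" if "x \<in> S1" "y \<in> S1" for x y
    using S1_eq_iff_base[OF that p] by (simp add: \<theta>_def)
  have pos: "\<theta> x > 0" if "x \<in> S1" "x \<noteq> p" for x using inj[OF that(1) p] that(2) bd[of x] p0 by auto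
  have cy: "z \<in> open_arc c d \<longleftrightarrow> cyc (\<theta> c) (\<theta> z) (\<theta> d)" if "c \<in> S1" "d \<in> S1" "z \<in> S1" for c d z
    using arc_cyc_base[OF that p] by (simp add: \<theta>_def)
  have tp: "\<theta> (t k) > 0" for k using pos[OF tS[of k]] t(4) by (metis rangeI)
  have step: "\<theta> (t k) < \<theta> (t (k + 1))" for k
  proof -
    have "p \<notin> open_arc (t k) (t (k + 1))" using t(2,3) unfolding vertices_def by blast
    then have "\<not> cyc (\<theta> (t k)) 0 (\<theta> (t (k + 1)))" using cy[OF tS tS p] p0 by simp
    moreover have "\<theta> (t k) \<noteq> \<theta> (t (k + 1))" using inj[OF tS tS] lfD(3)[OF l] by blast
    ultimately show ?thesis using tp[of k] tp[of "k + 1"] by (auto simp: cyc_def)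
  qed
  have stepn: "\<theta> (t k) < \<theta> (t (k + 1 + int n))" for k n
  proof (induction n)
    case (Suc n)
    then show ?case using step[of "k + 1 + int n"] by (simp add: algebra_simps)
  qed (use step in simp)
  have sm: "\<theta> (t j) < \<theta> (t k)" if "j < k" for j k
    using stepn[of j "nat (k - j - 1)"] that by simp
  have mono: "t j \<in> open_arc p (t k)" if "j < k" for j k
    using cy[OF p tS tS] sm[OF that] tp[of j] p0 by (auto simp: cyc_def)
  have vert: "\<exists>j. s = \<theta> (t j)" if s: "0 < s" "s < 2 * pi" and no: "\<And>k. \<not> cyc (\<theta> (t k)) s (\<theta> (t (k + 1)))" for s
  proof -
    define x where "x = p * cis s"
    have x: "x \<in> S1" unfolding x_def by (rule S1_cis[OF p])
    have tx: "\<theta> x = s" unfolding \<theta>_def x_def using s by (intro Arg2pi_cis_base p) auto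
    have "x \<notin> \<Union>G" using no cy[OF tS tS x] unfolding t(2) tx by blast
    then have "x \<in> insert p (range t)" using x t(3) unfolding vertices_def by blast
    moreover have "x \<noteq> p" using tx p0 s by auto
    ultimately show ?thesis using tx by blast
  qed
  have ub: "\<exists>k. \<theta> z < \<theta> (t k)" if "z \<in> S1" for z
  proof (rule ccontr)
    assume "\<not> ?thesis"
    then have le: "\<theta> (t k) \<le> \<theta> z" for k by (meson not_less)
    then have bb: "bdd_above (range (\<lambda>k. \<theta> (t k)))" by (auto simp: bdd_above_def)
    define s where "s = (SUP k. \<theta> (t k))"
    have up: "\<theta> (t k) \<le> s" for k unfolding s_def by (rule cSUP_upper[OF _ bb]) simp
    have "s \<le> \<theta> z" unfolding s_def using le by (intro cSUP_least) auto
    moreover have "0 < s" using up[of 0] tp[of 0] by linarith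
    moreover have "\<not> cyc (\<theta> (t k)) s (\<theta> (t (k + 1)))" for k
      using up[of "k + 1"] step[of k] unfolding cyc_def by linarith
    ultimately obtain j where "s = \<theta> (t j)" using vert[of s] bd[of z] by force
    then show False using up[of "j + 1"] step[of j] by simp
  qed
  have lb: "\<exists>k. \<theta> (t k) < \<theta> z" if "z \<in> S1" "z \<noteq> p" for z
  proof (rule ccontr)
    assume "\<not> ?thesis"
    then have le: "\<theta> z \<le> \<theta> (t k)" for k by (meson not_less)
    then have bb: "bdd_below (range (\<lambda>k. \<theta> (t k)))" by (auto simp: bdd_below_def)
    define s where "s = (INF k. \<theta> (t k))"
    have up: "s \<le> \<theta> (t k)" for k unfolding s_def by (rule cINF_lower[OF bb]) simp
    have "\<theta> z \<le> s" unfolding s_def using le by (intro cINF_greatest) auto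
    then have "0 < s" using pos[OF that] by linarith
    moreover have "s < 2 * pi" using up[of 0] bd[of "t 0"] by linarith
    moreover have "\<not> cyc (\<theta> (t k)) s (\<theta> (t (k + 1)))" for k
      using up[of k] step[of k] unfolding cyc_def by linarith
    ultimately obtain j where "s = \<theta> (t j)" using vert[of s] by blast
    then show False using up[of "j - 1"] step[of "j - 1"] by simp
  qed
  have a1: "\<exists>k. t k \<in> open_arc z p" if zz: "z \<in> S1" "z \<noteq> p" for z
  proof -
    obtain k where "\<theta> z < \<theta> (t k)" using ub[OF zz(1)] by blast
    then have "t k \<in> open_arc z p" using cy[OF zz(1) p tS] pos[OF zz] p0 by (auto simp: cyc_def)
    then show ?thesis by blast
  qed
  have a2: "\<exists>k. t k \<in> open_arc p z" if zz: "z \<in> S1" "z \<noteq> p" for z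
  proof -
    obtain k where "\<theta> (t k) < \<theta> z" using lb[OF zz] by blast
    then have "t k \<in> open_arc p z" using cy[OF p zz(1) tS] tp[of k] p0 by (auto simp: cyc_def)
    then show ?thesis by blast
  qed
  show ?thesis
    by (rule that[of t]) (unfold crown_seq_def, intro conjI allI impI ballI g p l t(2-4) mono a1 a2)
qed

lemma crown_infinite:
  assumes "lamination_system L" "crown_with_pivot L G p"
  shows "infinite (vertices G)"
proof -
  obtain t where t: "crown_seq L G p t" using crownE[OF assms] .
  have "inj t" using crown_seq_inj[OF t] by (rule injI)
  then have "infinite (range t)" by (metis finite_imageD infinite_UNIV_int)
  then show ?thesis unfolding crown_seqD(5)[OF t] by simp
qed

text \<open>The element containing a side of the leaf has \<open>x\<close> in its closure but, as
  \<open>x\<close> is a vertex, not inside; so \<open>x\<close> is one of its endpoints.\<close>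

lemma vertex_endpoint:
  assumes L: "lamination_system L" and G: "gap L G" and xy: "lf L x y" "x \<in> vertices G"
  obtains w where "lf L x w" "open_arc x w \<in> G \<or> open_arc w x \<in> G"
proof -
  obtain M where M: "M \<in> G" "open_arc x y \<subseteq> M \<or> open_arc y x \<subseteq> M" using gap_leaf_side[OF G xy(1)] by blast
  obtain u v where u: "lf L u v" "M = open_arc u v" using gap_lfE[OF L G M(1)] .
  have "x \<in> closure M"
    using M(2) closure_mono[of "open_arc x y" M] closure_mono[of "open_arc y x" M]
      closure_arc[OF lfD(1-3)[OF xy(1)]] closure_arc[OF lfD(1-3)[OF lf_sym[OF L xy(1)]]] by blast
  moreover have "x \<notin> M" using M(1) xy(2) unfolding vertices_def by blast
  ultimately have "x = u \<or> x = v" unfolding u(2) closure_arc[OF lfD(1-3)[OF u(1)]] by blast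
  then show ?thesis using that[of u] that[of v] u M(1) lf_sym[OF L u(1)] by blast
qed

lemma pivot_not_endpoint:
  assumes L: "lamination_system L" and C: "crown_with_pivot L G p"
  shows "p \<notin> endpoints L"
proof
  assume "p \<in> endpoints L"
  then obtain y where y: "lf L p y" using endpoints_iff[OF L] by blast
  obtain t where "crown_seq L G p t" using crownE[OF L C] .
  note t = crown_seqD(1,3-6)[OF this]
  have "p \<in> vertices G" using t(4) by blast
  then obtain w where w: "lf L p w" "open_arc p w \<in> G \<or> open_arc w p \<in> G"
    using vertex_endpoint[OF L t(1) y] by blast
  have "p = a \<and> w = b" if "lf L a b" "open_arc p w = open_arc a b" for a b using lf_inj[OF w(1) that] .
  moreover have "w = a \<and> p = b" if "lf L a b" "open_arc w p = open_arc a b" for a b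
    using lf_inj[OF lf_sym[OF L w(1)] that] .
  ultimately have "\<exists>k. p = t k \<or> p = t (k + 1)" using w(2) t(2) unfolding t(3) by blast
  then show False using t(5) by blast
qed

lemma gap_next:
  assumes Q: "quite_full L" and G: "gap L G" "open_arc u v \<in> G" "lf L u v"
  obtains w where "lf L v w" "open_arc v w \<in> G"
proof -
  note L = quite_fullD(1)[OF Q]
  have v: "v \<in> vertices G" using gap_vertex[OF L G(1,2)] lfD[OF G(3)] by blast
  from quite_fullD(2)[OF Q G(1)] show ?thesis
  proof
    assume "ideal_polygon L G"
    then show ?thesis using polygon_next[OF L _ v] that by blast
  next
    assume "crown L G"
    then obtain p where "crown_with_pivot L G p" unfolding crown_def by blast
    then obtain t where "crown_seq L G p t" using crownE[OF L] by blast
    note t = crown_seqD(3,4)[OF this]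
    obtain k where "open_arc u v = open_arc (t k) (t (k + 1))" using G(2) t(2) by blast
    then have "v = t (k + 1)" using lf_inj[OF G(3) t(1)] by blast
    moreover have "open_arc (t (k + 1)) (t (k + 1 + 1)) \<in> G" using t(2) by blast
    ultimately show ?thesis using that t(1)[of "k + 1"] by blast
  qed
qed

text \<open>From each leaf select the side that omits \<open>x\<close>. A union of selected sides
  either omits a second point, and then belongs to \<open>L\<close>, or the dual intervals shrink to
  \<open>x\<close>, which would be a rainbow point. The resulting gap has \<open>x\<close> as a
  vertex; vertices of polygons and tips of crowns are endpoints, so \<open>x\<close> is a
  pivot.\<close>

lemma point_trichotomy:
  assumes Q: "quite_full L" and x: "x \<in> S1" "x \<notin> endpoints L" "\<not> rainbow_point L x"
  shows "\<exists>G. crown_with_pivot L G x"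
proof -
  note L = quite_fullD(1)[OF Q]
  define JJ where "JJ = {J \<in> L. x \<notin> J}"
  have ends: "x \<noteq> u \<and> x \<noteq> v" if "lf L u v" for u v
    using that lf_sym[OF L that] x(2) endpoints_iff[OF L] by blast
  have un: "\<Union>{J \<in> JJ. I \<subseteq> J} \<in> JJ" if I: "I \<in> JJ" for I
  proof -
    define F where "F = {J \<in> JJ. I \<subseteq> J}"
    have FL: "F \<subseteq> L" "I \<in> F" using I by (auto simp: F_def JJ_def)
    have xF: "x \<notin> \<Union>F" by (auto simp: F_def JJ_def)
    have IL: "I \<in> L" using I by (auto simp: JJ_def)
    obtain u v where u: "lf L u v" "I = open_arc u v" using IL by (rule lam_arcE[OF L])
    obtain p where p: "p \<in> I" using arc_nonempty lfD(1-3)[OF u(1)] u(2) by blast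
    have pF: "p \<in> J" if "J \<in> F" for J using that p by (auto simp: F_def)
    have ch: "J \<subseteq> K \<or> K \<subseteq> J" if JK: "J \<in> F" "K \<in> F" for J K
    proof -
      have JKL: "J \<in> L" "K \<in> L" using JK FL by blast+
      obtain a b where a: "lf L a b" "J = open_arc a b" using JKL(1) by (rule lam_arcE[OF L])
      obtain c d where c: "lf L c d" "K = open_arc c d" using JKL(2) by (rule lam_arcE[OF L])
      have "x \<in> open_arc b a"
        using arc_cases[OF lfD(1,2)[OF a(1)] x(1) lfD(3)[OF a(1)]] ends[OF a(1)] a(2) JK xF by blast
      moreover have "x \<notin> open_arc c d" using c(2) JK xF by blast
      ultimately have "\<not> open_arc b a \<subseteq> open_arc c d" by blast
      then show ?thesis using lf_nested[OF L a(1) c(1)] a c pF[OF JK(1)] pF[OF JK(2)] by blast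
    qed
    have "\<exists>y\<in>S1. y \<noteq> x \<and> y \<notin> \<Union>F"
    proof (rule ccontr)
      assume "\<not> ?thesis"
      then have all: "y \<in> \<Union>F" if "y \<in> S1" "y \<noteq> x" for y using that by blast
      have o: "openin (top_of_set S1) J" if "J \<in> F" for J
        using lam_good[OF L, of J] that FL(1) arc_openin by (metis good_intervalE subsetD)
      have Fne: "F \<noteq> {}" using FL(2) by blast
      from chain_seq[OF Fne o ch] obtain K :: "nat \<Rightarrow> complex set"
        where KK: "range K \<subseteq> F \<and> incseq K \<and> (\<Union>k. K k) = \<Union>F" by (rule exE)
      from KK have K: "range K \<subseteq> F" "incseq K" "(\<Union>k. K k) = \<Union>F" by simp_all
      have "\<exists>a b. lf L a b \<and> K k = open_arc a b" for k
      proof -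
        have "K k \<in> L" using K(1) FL(1) by blast
        then obtain c d where "lf L c d" "K k = open_arc c d" by (rule lam_arcE[OF L])
        then show ?thesis by blast
      qed
      then obtain a b where ab: "\<And>k. lf L (a k) (b k)" "\<And>k. K k = open_arc (a k) (b k)" by metis
      define D where "D k = open_arc (b k) (a k)" for k
      have xD: "x \<in> D k" for k
      proof -
        have "x \<notin> open_arc (a k) (b k)" using ab(2)[of k] K(1) xF by blast
        then show ?thesis unfolding D_def
          using arc_cases[OF lfD(1,2)[OF ab(1)[of k]] x(1) lfD(3)[OF ab(1)[of k]]] ends[OF ab(1)[of k]] by blast
      qed
      have "range D \<subseteq> L" using lfD(4)[OF lf_sym[OF L ab(1)]] by (auto simp: D_def)
      moreover have "decseq D"
      proof (rule antimonoI)
        fix m n :: nat assume "m \<le> n"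
        then have "open_arc (a m) (b m) \<subseteq> open_arc (a n) (b n)" using incseqD[OF K(2)] ab(2) by metis
        then show "D n \<subseteq> D m" unfolding D_def using lf_subset_dual[OF ab(1) ab(1)] by blast
      qed
      moreover have "(\<Inter>k. D k) = {x}"
      proof
        show "(\<Inter>k. D k) \<subseteq> {x}"
        proof
          fix y assume y: "y \<in> (\<Inter>k. D k)"
          then have "y \<in> S1" using arc_sub_S1(1)[of y "b 0" "a 0"] by (auto simp: D_def)
          moreover have "y \<notin> K k" for k using y ab(2)[of k] arc_not_dual by (auto simp: D_def)
          then have "y \<notin> \<Union>F" using K(3) by blast
          ultimately show "y \<in> {x}" using all by blast
        qed
      qed (use xD in blast)
      ultimately have "rainbow_point L x" unfolding rainbow_point_def by (intro exI[where x = D]) simp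
      then show False using x(3) by blast
    qed
    then obtain y where y: "y \<in> S1" "y \<noteq> x" "y \<notin> \<Union>F" by blast
    have "\<Union>F \<in> L" using FL(2) by (intro lam_union[OF L FL(1) _ ch x(1) y(1) y(2)[symmetric] xF y(3)]) auto
    then show ?thesis using xF unfolding F_def[symmetric] by (simp add: JJ_def)
  qed
  have JL: "JJ \<subseteq> L" by (auto simp: JJ_def)
  have side: "open_arc u v \<in> JJ \<or> open_arc v u \<in> JJ" if "lf L u v" for u v
    using lfD(4)[OF that] lfD(4)[OF lf_sym[OF L that]] arc_not_dual unfolding JJ_def by blast
  have cov: "\<not> open_arc v u \<subseteq> open_arc a b"
    if "lf L u v" "lf L a b" "open_arc u v \<in> JJ" "open_arc a b \<in> JJ" for u v a b
  proof -
    have "x \<notin> open_arc u v" "x \<notin> open_arc a b" using that(3,4) by (auto simp: JJ_def)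
    then show ?thesis using arc_cases[OF lfD(1,2)[OF that(1)] x(1) lfD(3)[OF that(1)]] ends[OF that(1)] by blast
  qed
  define G where "G = maximal_elements JJ"
  have g: "gap L G" unfolding G_def by (rule maximal_gap(1)[OF L JL side cov un])
  have xv: "x \<in> vertices G" using x(1) unfolding vertices_def G_def maximal_elements_def JJ_def by blast
  have "\<not> ideal_polygon L G"
  proof
    assume "ideal_polygon L G"
    then obtain y where "lf L x y" using polygon_next[OF L _ xv] by blast
    then show False using ends by blast
  qed
  then obtain p where p: "crown_with_pivot L G p" using quite_fullD(2)[OF Q g] unfolding crown_def by blast
  then obtain t where "crown_seq L G p t" using crownE[OF L] by blast
  note t = crown_seqD(3,5)[OF this]
  have "x = p" using xv t(2) ends[OF t(1)] by blast
  then show ?thesis using p by blast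
qed

section \<open>Interplay of the two systems: pivots and rainbow points\<close>

lemma veering_sym:
  assumes "veering_pair L1 L2"
  shows "veering_pair L2 L1"
proof -
  have s: "interleaving_pair L1 L2 G H \<Longrightarrow> interleaving_pair L2 L1 H G" for G H
    unfolding interleaving_pair_def interleave_def by blast
  have "\<exists>H. interleaving_pair L2 L1 G H" if "nonleaf_gap L2 G" for G
    using assms that s unfolding veering_pair_def by blast
  moreover have "\<exists>H. interleaving_pair L2 L1 H G" if "nonleaf_gap L1 G" for G
    using assms that s unfolding veering_pair_def by blast
  ultimately show ?thesis using assms unfolding veering_pair_def by blast
qed

lemma veeringD:
  assumes "veering_pair L1 L2"
  shows "quite_full L1" "quite_full L2" "lamination_system L1" "lamination_system L2"
    "loose L1" "loose L2" "endpoints L1 \<inter> endpoints L2 = {}"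
    "nonleaf_gap L1 G \<Longrightarrow> \<exists>H. interleaving_pair L1 L2 G H"
  using assms unfolding veering_pair_def quite_full_def by blast+

lemma crown_nonleaf:
  assumes L: "lamination_system L" and C: "crown_with_pivot L G p"
  shows "nonleaf_gap L G"
proof -
  have "gap L G" using C unfolding crown_with_pivot_def by blast
  moreover have "G \<notin> leaves L"
  proof
    assume "G \<in> leaves L"
    then obtain u v where u: "lf L u v" "G = {open_arc u v, open_arc v u}" by (rule leavesE[OF L])
    then have "finite (vertices G)" using leaf_gap(2)[OF L u(1)] by simp
    then show False using crown_infinite[OF L C] by blast
  qed
  ultimately show ?thesis unfolding nonleaf_gap_def by blast
qed

text \<open>The partner \<open>H\<close> has a vertex in each of the infinitely many elements of
  \<open>G\<close>, and these vertices accumulate at \<open>p\<close>. So \<open>H\<close> is no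
  polygon but a crown, and the accumulation point must be its pivot.\<close>

lemma crown_partner:
  assumes V: "veering_pair L1 L2" and C: "crown_with_pivot L1 G p"
  shows "\<exists>H. crown_with_pivot L2 H p \<and> interleaving_pair L1 L2 G H"
proof -
  note L1 = veeringD(3)[OF V] and L2 = veeringD(4)[OF V]
  obtain H where H: "interleaving_pair L1 L2 G H" using veeringD(8)[OF V crown_nonleaf[OF L1 C]] by blast
  have gH: "gap L2 H" and sing: "\<And>I. I \<in> G \<Longrightarrow> is_singleton (I \<inter> vertices H)"
    using H unfolding interleaving_pair_def interleave_def by blast+
  obtain t where "crown_seq L1 G p t" using crownE[OF L1 C] .
  note t = crown_seqD(2-8)[OF this]
  have "\<exists>z. z \<in> open_arc (t k) (t (k + 1)) \<and> z \<in> vertices H" for k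
  proof -
    have "open_arc (t k) (t (k + 1)) \<in> G" unfolding t(3) by (rule rangeI)
    from sing[OF this] obtain z where "open_arc (t k) (t (k + 1)) \<inter> vertices H = {z}" by (rule is_singletonE)
    then show ?thesis by blast
  qed
  then have "\<forall>k. \<exists>z. z \<in> open_arc (t k) (t (k + 1)) \<and> z \<in> vertices H" by (rule allI)
  from choice[OF this] obtain s where "\<forall>k. s k \<in> open_arc (t k) (t (k + 1)) \<and> s k \<in> vertices H" by (rule exE)
  then have s: "\<And>k. s k \<in> open_arc (t k) (t (k + 1))" "\<And>k. s k \<in> vertices H" by simp_all
  have near: "\<exists>k. s k \<in> open_arc c p" if c: "c \<in> S1" "c \<noteq> p" for c
  proof -
    obtain k where k: "t k \<in> open_arc c p" using t(7)[OF c] by blast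
    have "t k \<in> open_arc p (t (k + 1))" using t(6)[of k "k + 1"] by simp
    then have "t (k + 1) \<in> open_arc (t k) p" using arc_rotate by blast
    then have "s k \<in> open_arc (t k) p" using s(1) arc_left_trans by blast
    then show ?thesis using arc_right_trans[OF k] by blast
  qed
  have inf: "infinite (vertices H)"
  proof
    assume fin: "finite (vertices H)"
    then have "closed (vertices H - {p})" by (intro finite_imp_closed) auto
    moreover have "vertices H - {p} \<subseteq> S1" using vertices_S1 by blast
    moreover have "vertices H - {p} \<noteq> {}"
    proof -
      have "open_arc (t 0) (t (0 + 1)) \<in> G" unfolding t(3) by (rule rangeI)
      moreover have "p \<in> vertices G" unfolding t(4) by (rule insertI1)
      ultimately have "p \<notin> open_arc (t 0) (t (0 + 1))" unfolding vertices_def by blast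
      then have "p \<noteq> s 0" using s(1)[of 0] by metis
      then show ?thesis using s(2)[of 0] by blast
    qed
    ultimately obtain c where c: "c \<in> vertices H - {p}" "open_arc c p \<inter> (vertices H - {p}) = {}"
      using closed_prev[of "vertices H - {p}" p] t(1) by blast
    obtain k where "s k \<in> open_arc c p" using near[of c] c(1) vertices_S1[of H] by blast
    then show False using c(2) s(2)[of k] arc_ends(2)[of p c] by blast
  qed
  then have "\<not> ideal_polygon L2 H" unfolding ideal_polygon_def by blast
  then obtain q where q: "crown_with_pivot L2 H q" using quite_fullD(2)[OF veeringD(2)[OF V] gH] unfolding crown_def by blast
  obtain r where "crown_seq L2 H q r" using crownE[OF L2 q] .
  note r = crown_seqD(3-5)[OF this]
  have "p = q"
  proof (rule ccontr)
    assume "p \<noteq> q"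
    have "\<exists>k. p = r k \<or> p \<in> open_arc (r k) (r (k + 1))"
    proof (cases "p \<in> vertices H")
      case True then show ?thesis unfolding r(3) using \<open>p \<noteq> q\<close> by blast
    next
      case False
      then have "p \<in> \<Union>H" using t(1) unfolding vertices_def by blast
      then show ?thesis unfolding r(2) by blast
    qed
    then obtain k where k: "p = r k \<or> p \<in> open_arc (r k) (r (k + 1))" by blast
    \<comment> \<open>If \<open>p\<close> is not the pivot of \<open>H\<close>, some element of
      \<open>H\<close> contains an arc ending at \<open>p\<close>. No vertex of \<open>H\<close>
      lies in it, against the accumulation at \<open>p\<close> from this side.\<close>
    have "\<exists>c d. open_arc c p \<subseteq> open_arc c d \<and> open_arc c d \<in> H \<and> lf L2 c d \<and> c \<noteq> p"
    proof (cases "p = r k")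
      case True
      have l: "lf L2 (r (k - 1)) (r k)" using r(1)[of "k - 1"] by simp
      have "open_arc (r (k - 1)) (r (k - 1 + 1)) \<in> H" unfolding r(2) by (rule rangeI)
      then have "open_arc (r (k - 1)) (r k) \<in> H" by simp
      then show ?thesis using True l lfD(3)[OF l] by blast
    next
      case False
      then have "p \<in> open_arc (r k) (r (k + 1))" using k by blast
      then have "open_arc (r k) p \<subseteq> open_arc (r k) (r (k + 1))" using arc_left_trans by blast
      moreover have "open_arc (r k) (r (k + 1)) \<in> H" unfolding r(2) by (rule rangeI)
      moreover have "r k \<noteq> p" using False by blast
      ultimately show ?thesis using r(1)[of k] by blast
    qed
    then obtain c d where c: "open_arc c p \<subseteq> open_arc c d" "open_arc c d \<in> H" "lf L2 c d" "c \<noteq> p" by blast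
    obtain k where "s k \<in> open_arc c p" using near[of c] lfD(1)[OF c(3)] c(4) by blast
    then show False using c(1,2) s(2)[of k] unfolding vertices_def by blast
  qed
  then show ?thesis using q H by blast
qed

text \<open>Otherwise \<open>x\<close> would be a pivot for \<open>L1\<close>, hence also for
  \<open>L2\<close>, and pivots are not endpoints.\<close>

lemma endpoint_rainbow:
  assumes V: "veering_pair L1 L2" and x: "x \<in> endpoints L2"
  shows "rainbow_point L1 x"
proof (rule ccontr)
  assume n: "\<not> rainbow_point L1 x"
  have "x \<in> S1" using x endpoints_iff[OF veeringD(4)[OF V]] lfD(1) by blast
  moreover have "x \<notin> endpoints L1" using x veeringD(7)[OF V] by blast
  ultimately obtain G where "crown_with_pivot L1 G x" using point_trichotomy[OF veeringD(1)[OF V] _ _ n] by blast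
  then obtain H where "crown_with_pivot L2 H x" using crown_partner[OF V] by blast
  then show False using pivot_not_endpoint[OF veeringD(4)[OF V]] x by blast
qed

lemma not_rainbow_pivot:
  assumes V: "veering_pair L1 L2" and x: "x \<in> S1" "\<not> rainbow_point L1 x" "\<not> rainbow_point L2 x"
  shows "\<exists>G H. crown_with_pivot L1 G x \<and> crown_with_pivot L2 H x \<and> interleaving_pair L1 L2 G H"
proof -
  have "x \<notin> endpoints L1" using endpoint_rainbow[OF veering_sym[OF V]] x(3) by blast
  then obtain G where "crown_with_pivot L1 G x" using point_trichotomy[OF veeringD(1)[OF V] x(1) _ x(2)] by blast
  then show ?thesis using crown_partner[OF V] by blast
qed

section \<open>Leaves sharing an endpoint\<close>

text \<open>The leaves at \<open>w\<close> that are closest to \<open>a\<close> on its two sides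
  bound a common gap: \<open>(w, e1)\<close> and \<open>(e2, w)\<close> are the largest intervals at
  \<open>w\<close> that omit \<open>a\<close>. As \<open>a\<close> is no endpoint, it differs from
  \<open>e1\<close> and \<open>e2\<close>, and the three distinct vertices \<open>w\<close>,
  \<open>e1\<close>, \<open>e2\<close> make the gap non-leaf.\<close>

lemma fan_gap:
  assumes L: "lamination_system L" and d: "lf L w d1" "lf L w d2"
    and a: "a \<in> S1" "a \<notin> endpoints L" "d1 \<in> open_arc w a" "d2 \<in> open_arc a w"
  obtains H e1 e2 where "nonleaf_gap L H" "open_arc w e1 \<in> H" "open_arc e2 w \<in> H" "lf L w e1" "lf L w e2"
    "e1 \<in> open_arc w a" "e2 = d2 \<or> e2 \<in> open_arc a d2" "e2 \<in> open_arc a w"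
proof -
  have w: "w \<in> S1" by (rule lfD[OF d(1)])
  have nend: "a \<noteq> u \<and> a \<noteq> v" if "lf L u v" for u v
    using that lf_sym[OF L that] a(2) endpoints_iff[OF L] by blast
  have aw: "a \<noteq> w" using nend[OF d(1)] by blast
  define FU where "FU = {open_arc w e |e. lf L w e \<and> a \<notin> open_arc w e}"
  define FV where "FV = {open_arc e w |e. lf L e w \<and> a \<notin> open_arc e w}"
  have d1U: "open_arc w d1 \<in> FU"
  proof -
    have "a \<notin> open_arc w d1" using a(3) arc_left_trans[of a w d1 a] arc_ends by blast
    then show ?thesis unfolding FU_def using d(1) by blast
  qed
  have d2V: "open_arc d2 w \<in> FV"
  proof -
    have "a \<notin> open_arc d2 w" using a(4) arc_right_trans[of d2 a w a] arc_ends by blast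
    then show ?thesis unfolding FV_def using lf_sym[OF L d(2)] by blast
  qed
  have FUL: "FU \<subseteq> L" "w \<notin> \<Union>FU" "a \<notin> \<Union>FU" unfolding FU_def using lfD(4) arc_ends by blast+
  have FVL: "FV \<subseteq> L" "w \<notin> \<Union>FV" "a \<notin> \<Union>FV" unfolding FV_def using lfD(4) arc_ends by blast+
  have chU: "J \<subseteq> K \<or> K \<subseteq> J" if JK: "J \<in> FU" "K \<in> FU" for J K
  proof -
    obtain e f where ef: "J = open_arc w e" "K = open_arc w f" "lf L w e" "lf L w f" using JK unfolding FU_def by blast
    have "e = f \<or> e \<in> open_arc w f \<or> f \<in> open_arc w e"
      using arc_linear[of e f w] lfD[OF ef(3)] lfD[OF ef(4)] by blast
    then show ?thesis unfolding ef using arc_left_trans by blast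
  qed
  have chV: "J \<subseteq> K \<or> K \<subseteq> J" if JK: "J \<in> FV" "K \<in> FV" for J K
  proof -
    obtain e f where ef: "J = open_arc e w" "K = open_arc f w" "lf L e w" "lf L f w" using JK unfolding FV_def by blast
    have "e = f \<or> e \<in> open_arc w f \<or> f \<in> open_arc w e"
      using arc_linear[of e f w] lfD[OF ef(3)] lfD[OF ef(4)] by blast
    then have "e = f \<or> f \<in> open_arc e w \<or> e \<in> open_arc f w" using arc_rotate by blast
    then show ?thesis unfolding ef using arc_right_trans by blast
  qed
  have "\<Union>FU \<in> L" using d1U chU by (intro lam_union[OF L FUL(1) _ _ w a(1) aw[symmetric] FUL(2,3)]) auto
  then obtain c e1 where e1: "lf L c e1" "\<Union>FU = open_arc c e1" by (rule lam_arcE[OF L])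
  have "c = w" using d1U e1(2) FUL(2) lfD[OF d(1)] by (intro arc_left_eq[of w d1 c e1]) auto
  then have U: "lf L w e1" "\<Union>FU = open_arc w e1" using e1 by auto
  have "\<Union>FV \<in> L" using d2V chV by (intro lam_union[OF L FVL(1) _ _ w a(1) aw[symmetric] FVL(2,3)]) auto
  then obtain e2 c' where e2: "lf L e2 c'" "\<Union>FV = open_arc e2 c'" by (rule lam_arcE[OF L])
  have "c' = w" using d2V e2(2) FVL(2) lfD[OF d(2)] by (intro arc_right_eq[of d2 w e2 c']) auto
  then have V: "lf L e2 w" "\<Union>FV = open_arc e2 w" using e2 by auto
  have eS: "e1 \<in> S1" "e2 \<in> S1" using lfD[OF U(1)] lfD[OF V(1)] by blast+
  have e1a: "e1 \<in> open_arc w a"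
    using arc_linear[of e1 a w] eS a(1) w aw nend[OF U(1)] lfD[OF U(1)] U(2) FUL(3) by blast
  have e2a: "e2 \<in> open_arc a w"
    using arc_linear[of e2 a w] eS a(1) w aw nend[OF V(1)] lfD[OF V(1)] V(2) FVL(3) arc_rotate by blast
  have e2d: "e2 = d2 \<or> e2 \<in> open_arc a d2"
  proof -
    have "d2 \<notin> open_arc a e2"
    proof
      assume "d2 \<in> open_arc a e2"
      moreover have "e2 \<notin> open_arc d2 w" using d2V V(2) arc_ends by blast
      ultimately show False using a(4) e2a arc_sub_S1 eS w
        by (simp only: arc_cyc[OF lfD(2)[OF d(2)] w eS(2)] arc_cyc[OF a(1) eS(2) lfD(2)[OF d(2)]]
           arc_cyc[OF a(1) w eS(2)] arc_cyc[OF a(1) w lfD(2)[OF d(2)]] cyc_def) argo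
    qed
    then show ?thesis using arc_linear[of e2 d2 a] eS lfD(2)[OF d(2)] a(1) nend[OF d(2)] nend[OF V(1)] by blast
  qed
  have wa: "w \<notin> open_arc e1 e2" "e1 \<noteq> e2" "open_arc w e1 \<inter> open_arc e1 e2 = {}" "open_arc w e1 \<inter> open_arc e2 w = {}"
    "open_arc e2 w \<inter> open_arc e1 e2 = {}" "e1 \<notin> open_arc e2 w" "e2 \<notin> open_arc w e1"
  proof -
    have c: "cyc (Arg2pi w) (Arg2pi e1) (Arg2pi a)" "cyc (Arg2pi a) (Arg2pi e2) (Arg2pi w)"
      using e1a e2a arc_memD by blast+
    show "w \<notin> open_arc e1 e2" "e1 \<notin> open_arc e2 w" "e2 \<notin> open_arc w e1"
      using c w eS by (simp_all only: arc_cyc cyc_def) argo+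
    show "e1 \<noteq> e2" using c by (auto simp: cyc_def)
    have "False" if "cyc (Arg2pi w) z (Arg2pi e1)" "cyc (Arg2pi e1) z (Arg2pi e2)" for z
      using that c unfolding cyc_def by argo
    then show "open_arc w e1 \<inter> open_arc e1 e2 = {}" using arc_memD by blast
    have "False" if "cyc (Arg2pi w) z (Arg2pi e1)" "cyc (Arg2pi e2) z (Arg2pi w)" for z
      using that c unfolding cyc_def by argo
    then show "open_arc w e1 \<inter> open_arc e2 w = {}" using arc_memD by blast
    have "False" if "cyc (Arg2pi e2) z (Arg2pi w)" "cyc (Arg2pi e1) z (Arg2pi e2)" for z
      using that c unfolding cyc_def by argo
    then show "open_arc e2 w \<inter> open_arc e1 e2 = {}" using arc_memD by blast
  qed
  have triple: "open_arc e1 w \<inter> open_arc w e2 \<subseteq> open_arc e1 e2"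
  proof
    fix z assume z: "z \<in> open_arc e1 w \<inter> open_arc w e2"
    have c: "cyc (Arg2pi w) (Arg2pi e1) (Arg2pi a)" "cyc (Arg2pi a) (Arg2pi e2) (Arg2pi w)"
      using e1a e2a arc_memD by blast+
    have "z \<in> S1" using z arc_sub_S1 by blast
    moreover have "cyc (Arg2pi e1) (Arg2pi z) (Arg2pi w)" "cyc (Arg2pi w) (Arg2pi z) (Arg2pi e2)"
      using z arc_memD by blast+
    ultimately show "z \<in> open_arc e1 e2" using c eS by (simp only: arc_cyc cyc_def) argo
  qed
  \<comment> \<open>The three arcs cut out by \<open>w\<close>, \<open>e1\<close>,
    \<open>e2\<close>. Every leaf has a side in one of them; in particular a leaf ending at
    \<open>w\<close> has a side in \<open>FU\<close> or \<open>FV\<close>, hence inside one of the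
    two extreme intervals.\<close>
  define P where "P J \<longleftrightarrow> J \<subseteq> open_arc w e1 \<or> J \<subseteq> open_arc e2 w \<or> J \<subseteq> open_arc e1 e2" for J
  define JJ where "JJ = {J \<in> L. P J}"
  have avoid: "w \<notin> J \<and> e1 \<notin> J \<and> e2 \<notin> J" if PJ: "P J" for J
  proof -
    have "w \<notin> A \<and> e1 \<notin> A \<and> e2 \<notin> A" if "A \<in> {open_arc w e1, open_arc e2 w, open_arc e1 e2}" for A
      using that wa(1,6,7) arc_ends[of w e1] arc_ends[of e2 w] arc_ends[of e1 e2] by (elim insertE) simp_all
    moreover have "\<exists>A\<in>{open_arc w e1, open_arc e2 w, open_arc e1 e2}. J \<subseteq> A"
      using PJ unfolding P_def by simp
    ultimately show ?thesis by blast
  qed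
  have sideP: "P (open_arc x y) \<or> P (open_arc y x)" if xy: "lf L x y" "open_arc x y \<subseteq> open_arc e1 w" for x y
  proof -
    consider "open_arc x y \<subseteq> open_arc e2 w" | "open_arc y x \<subseteq> open_arc e2 w" | "open_arc x y \<subseteq> open_arc w e2"
      | "open_arc y x \<subseteq> open_arc w e2"
      using lf_cases[OF L xy(1) V(1)] by blast
    then show ?thesis
    proof cases
      case 3 then show ?thesis using xy(2) triple unfolding P_def by blast
    next
      case 4
      then have sub: "open_arc e2 w \<subseteq> open_arc x y" using lf_subset_dual[OF lf_sym[OF L xy(1)] lf_sym[OF L V(1)]] by blast
      have "w \<notin> open_arc x y" using xy(2) arc_ends by blast
      then have yw: "y = w" using arc_right_eq[OF sub _ w eS(2)] lfD(3)[OF V(1)] by blast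
      show ?thesis
      proof (cases "a \<in> open_arc x w")
        case True
        then have "open_arc w x \<in> FU" using lf_sym[OF L xy(1)] arc_not_dual unfolding FU_def yw by blast
        then show ?thesis using U(2) unfolding P_def yw by blast
      next
        case False
        then have "open_arc x w \<in> FV" using xy(1) unfolding FV_def yw by blast
        then show ?thesis using V(2) unfolding P_def yw by blast
      qed
    qed (auto simp: P_def)
  qed
  have side: "open_arc x y \<in> JJ \<or> open_arc y x \<in> JJ" if xy: "lf L x y" for x y
  proof -
    have "P (open_arc x y) \<or> P (open_arc y x)"
      using lf_cases[OF L xy U(1)] sideP[OF xy] sideP[OF lf_sym[OF L xy]] unfolding P_def by blast
    then show ?thesis using lfD(4)[OF xy] lfD(4)[OF lf_sym[OF L xy]] unfolding JJ_def by blast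
  qed
  have cov: "\<not> open_arc v u \<subseteq> open_arc x y"
    if uv: "lf L u v" "lf L x y" "open_arc u v \<in> JJ" "open_arc x y \<in> JJ" for u v x y
  proof
    assume s: "open_arc v u \<subseteq> open_arc x y"
    have av: "w \<notin> open_arc x y" "e1 \<notin> open_arc x y" "e2 \<notin> open_arc x y"
      using avoid uv(4) unfolding JJ_def by blast+
    note sd = arc_subset_dual[OF lfD(1-3)[OF uv(1)]]
    have "P (open_arc u v)" using uv(3) unfolding JJ_def by blast
    then consider "open_arc u v \<subseteq> open_arc w e1" | "open_arc u v \<subseteq> open_arc e2 w" | "open_arc u v \<subseteq> open_arc e1 e2"
      unfolding P_def by blast
    then show False
    proof cases
      case 1
      then have "open_arc e1 w \<subseteq> open_arc v u" using sd[OF lfD(1-3)[OF U(1)]] by blast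
      moreover have "e2 \<in> open_arc e1 w" using wa(7) arc_linear[of e1 e2 w] eS w wa(2) lfD(3)[OF U(1)] lfD(3)[OF V(1)] arc_rotate by blast
      ultimately show False using s av by blast
    next
      case 2
      then have "open_arc w e2 \<subseteq> open_arc v u" using sd[OF lfD(1-3)[OF V(1)]] by blast
      moreover have "e1 \<in> open_arc w e2" using wa(7) arc_linear[of e1 e2 w] eS w wa(2) lfD(3)[OF U(1)] lfD(3)[OF V(1)] by blast
      ultimately show False using s av by blast
    next
      case 3
      then have "open_arc e2 e1 \<subseteq> open_arc v u" using sd[OF eS wa(2)] by blast
      moreover have "w \<in> open_arc e2 e1" using wa(1) arc_cases[OF eS w wa(2)] lfD(3)[OF U(1)] lfD(3)[OF V(1)] by blast
      ultimately show False using s av by blast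
    qed
  qed
  have UJ: "open_arc w e1 \<in> JJ" and VJ: "open_arc e2 w \<in> JJ"
    using lfD(4)[OF U(1)] lfD(4)[OF V(1)] unfolding JJ_def P_def by blast+
  have ne: "\<exists>p. p \<in> I" if I: "I \<in> JJ" for I
  proof -
    have IL: "I \<in> L" using I unfolding JJ_def by blast
    obtain u v where u: "lf L u v" "I = open_arc u v" using IL by (rule lam_arcE[OF L])
    then show ?thesis using arc_nonempty lfD(1-3)[OF u(1)] by blast
  qed
  have maxU: "J \<subseteq> open_arc w e1" if "J \<in> JJ" "I \<subseteq> J" "I \<subseteq> open_arc w e1" "I \<in> JJ" for I J
    using that ne[OF that(4)] wa(3,4) unfolding JJ_def P_def by blast
  have maxV: "J \<subseteq> open_arc e2 w" if "J \<in> JJ" "I \<subseteq> J" "I \<subseteq> open_arc e2 w" "I \<in> JJ" for I J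
    using that ne[OF that(4)] wa(4,5) unfolding JJ_def P_def by blast
  have maxW: "J \<subseteq> open_arc e1 e2" if "J \<in> JJ" "I \<subseteq> J" "I \<subseteq> open_arc e1 e2" "I \<in> JJ" for I J
    using that ne[OF that(4)] wa(3,5) unfolding JJ_def P_def by blast
  have un: "\<Union>{J \<in> JJ. I \<subseteq> J} \<in> JJ" if I: "I \<in> JJ" for I
  proof -
    have "P I" using I unfolding JJ_def by blast
    then consider "I \<subseteq> open_arc w e1" | "I \<subseteq> open_arc e2 w" | "I \<subseteq> open_arc e1 e2" unfolding P_def by blast
    then show ?thesis
    proof cases
      case 1
      then have "\<Union>{J \<in> JJ. I \<subseteq> J} = open_arc w e1" using maxU I UJ by (intro subset_antisym) blast+
      then show ?thesis using UJ by simp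
    next
      case 2
      then have "\<Union>{J \<in> JJ. I \<subseteq> J} = open_arc e2 w" using maxV I VJ by (intro subset_antisym) blast+
      then show ?thesis using VJ by simp
    next
      case 3
      have sub: "\<Union>{J \<in> JJ. I \<subseteq> J} \<subseteq> open_arc e1 e2" using maxW 3 I by blast
      obtain p where p: "p \<in> I" using ne[OF I] by blast
      have "\<Union>{J \<in> JJ. I \<subseteq> J} \<in> L"
      proof (rule lam_union_pt(1)[OF L])
        show "{J \<in> JJ. I \<subseteq> J} \<subseteq> L" unfolding JJ_def by blast
        show "{J \<in> JJ. I \<subseteq> J} \<noteq> {}" using I by blast
        show "p \<in> J" if "J \<in> {J \<in> JJ. I \<subseteq> J}" for J using that p by blast
        show "e1 \<notin> \<Union>{J \<in> JJ. I \<subseteq> J}" "e2 \<notin> \<Union>{J \<in> JJ. I \<subseteq> J}" using sub arc_ends by blast+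
      qed (use eS wa(2) in auto)
      then show ?thesis using sub unfolding JJ_def P_def by blast
    qed
  qed
  have JL: "JJ \<subseteq> L" unfolding JJ_def by blast
  define H where "H = maximal_elements JJ"
  have gH: "gap L H" unfolding H_def by (rule maximal_gap(1)[OF L JL side cov un])
  have UH: "open_arc w e1 \<in> H" unfolding H_def maximal_elements_def using UJ maxU[OF _ _ subset_refl UJ] by blast
  have VH: "open_arc e2 w \<in> H" unfolding H_def maximal_elements_def using VJ maxV[OF _ _ subset_refl VJ] by blast
  have "H \<notin> leaves L"
  proof
    assume "H \<in> leaves L"
    then obtain u v where u: "lf L u v" "H = {open_arc u v, open_arc v u}" by (rule leavesE[OF L])
    have "vertices H = {u, v}" unfolding u(2) by (rule leaf_gap(2)[OF L u(1)])
    moreover have "w \<in> vertices H" "e1 \<in> vertices H" "e2 \<in> vertices H"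
      using gap_vertex[OF L gH UH lfD(1-3)[OF U(1)]] gap_vertex[OF L gH VH lfD(1-3)[OF V(1)]] by blast+
    ultimately show False using wa(2) lfD(3)[OF U(1)] lfD(3)[OF V(1)] by auto
  qed
  then have "nonleaf_gap L H" using gH unfolding nonleaf_gap_def by blast
  then show ?thesis using that UH VH U(1) lf_sym[OF L V(1)] e1a e2d e2a by blast
qed

text \<open>A leaf of \<open>L2\<close> close to \<open>y\<close> has endpoints on both sides of \<open>y\<close> which are not endpoints of \<open>L1\<close>;
  the two non-leaf gaps they produce share the vertex \<open>w\<close>, against looseness.\<close>

lemma no_three_leaves_sorted:
  assumes V: "veering_pair L1 L2" and l: "lf L1 w x" "lf L1 w y" "lf L1 w z" and o: "x \<in> open_arc w y" "y \<in> open_arc w z"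
  shows False
proof -
  note L = veeringD(3)[OF V] and L2 = veeringD(4)[OF V]
  have S: "w \<in> S1" "x \<in> S1" "y \<in> S1" "z \<in> S1" using lfD[OF l(1)] lfD[OF l(2)] lfD[OF l(3)] by blast+
  have "y \<in> endpoints L1" using lf_sym[OF L l(2)] endpoints_iff[OF L] by blast
  then have r: "rainbow_point L2 y" using endpoint_rainbow[OF veering_sym[OF V]] by blast
  have xy: "x \<noteq> y" "z \<noteq> y" using o arc_ends by blast+
  have "\<exists>a b. a \<in> S1 \<and> b \<in> S1 \<and> a \<noteq> b \<and> open_arc a b \<in> L2 \<and> y \<in> open_arc a b \<and> a \<in> open_arc x y \<and> b \<in> open_arc y z"
    by (rule rainbow_small[OF r lam_good[OF L2] S(2,4) xy S(3)])
  then obtain a b where ab: "lf L2 a b" "a \<in> open_arc x y" "b \<in> open_arc y z"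
    unfolding lf_def by blast
  have aS: "a \<in> S1" "b \<in> S1" using lfD[OF ab(1)] by blast+
  have ne: "a \<notin> endpoints L1" "b \<notin> endpoints L1"
    using ab(1) lf_sym[OF L2 ab(1)] endpoints_iff[OF L2] veeringD(7)[OF V] by blast+
  have "a \<in> open_arc w y" "b \<in> open_arc w z"
    using arc_right_trans[OF o(1)] arc_right_trans[OF o(2)] ab(2,3) by blast+
  then have o2: "x \<in> open_arc w a" "y \<in> open_arc a w" "y \<in> open_arc w b" "z \<in> open_arc b w"
    using arc_between_left[OF o(1) ab(2)] arc_between_left[OF o(2) ab(3)]
      arc_rotate[of y a w] arc_rotate[of w y a] arc_rotate[of z b w] arc_rotate[of w z b] by blast+
  obtain H e1 e2 where H: "nonleaf_gap L1 H" "open_arc e2 w \<in> H" "lf L1 w e2" "e2 = y \<or> e2 \<in> open_arc a y"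
    using fan_gap[OF L l(1,2) aS(1) ne(1) o2(1,2)] .
  obtain K f1 f2 where K: "nonleaf_gap L1 K" "open_arc f2 w \<in> K" "lf L1 w f2" "f2 = z \<or> f2 \<in> open_arc b z" "f2 \<in> open_arc b w"
    using fan_gap[OF L l(2,3) aS(2) ne(2) o2(3,4)] .
  have g: "gap L1 H" "gap L1 K" using H(1) K(1) unfolding nonleaf_gap_def by blast+
  note e2s = lf_sym[OF L H(3)] and f2s = lf_sym[OF L K(3)]
  have "w \<in> vertices H" "w \<in> vertices K"
    using gap_vertex[OF L g(1) H(2) lfD(1-3)[OF e2s]] gap_vertex[OF L g(2) K(2) lfD(1-3)[OF f2s]] by blast+
  then have HK: "H = K" using veeringD(5)[OF V] H(1) K(1) unfolding loose_def by blast
  have eS: "e2 \<in> S1" "f2 \<in> S1" using lfD[OF e2s] lfD[OF f2s] by blast+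
  have "b \<in> open_arc y w" using o2(3) arc_rotate by blast
  then have fy: "f2 \<in> open_arc y w" using arc_right_trans K(5) by blast
  \<comment> \<open>The two gaps coincide by looseness, yet \<open>(f2, w)\<close> is strictly
    smaller than \<open>(e2, w)\<close>: overlapping but different elements of one gap.\<close>
  have f2: "f2 \<in> open_arc e2 w"
    using H(4) fy arc_right_trans[OF arc_between[OF _ o2(2)]] by blast
  then have sub: "open_arc f2 w \<subseteq> open_arc e2 w" using arc_right_trans by blast
  obtain p where "p \<in> open_arc f2 w" using arc_nonempty lfD(1-3)[OF f2s] by blast
  then have "open_arc f2 w = open_arc e2 w" using gap_disjoint[OF g(1)] H(2) K(2) HK sub by blast
  then show False using f2 arc_ends by blast
qed

lemma at_most_two_leaves:
  assumes V: "veering_pair L1 L2" and l: "lf L1 w x" "lf L1 w y" "lf L1 w z"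
  shows "x = y \<or> y = z \<or> x = z"
proof (rule ccontr)
  assume n: "\<not> ?thesis"
  note s = no_three_leaves_sorted[OF V]
  have S: "w \<in> S1" "x \<in> S1" "y \<in> S1" "z \<in> S1" "x \<noteq> w" "y \<noteq> w" "z \<noteq> w" using lfD[OF l(1)] lfD[OF l(2)] lfD[OF l(3)] by blast+
  have "x \<in> open_arc w y \<or> y \<in> open_arc w x" "y \<in> open_arc w z \<or> z \<in> open_arc w y" "x \<in> open_arc w z \<or> z \<in> open_arc w x"
    using arc_linear n S by blast+
  then show False
    using s[OF l(1,2,3)] s[OF l(1,3,2)] s[OF l(2,1,3)] s[OF l(2,3,1)] s[OF l(3,1,2)] s[OF l(3,2,1)] by blast
qed

section \<open>Homeomorphisms of the circle\<close>

abbreviation oph :: "(complex \<Rightarrow> complex) \<Rightarrow> bool" where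
  "oph \<equiv> orientation_preserving_homeo"

lemma ophD:
  assumes "oph g"
  shows oph_S1: "x \<in> S1 \<Longrightarrow> g x \<in> S1" and oph_surj: "g ` S1 = S1" and oph_inj: "inj_on g S1"
    and oph_cont: "continuous_on S1 g"
    and oph_arc_mono: "y \<in> open_arc x z \<Longrightarrow> g y \<in> open_arc (g x) (g z)"
proof -
  obtain h where h: "homeomorphism S1 S1 g h" using assms unfolding orientation_preserving_homeo_def by blast
  show i: "g ` S1 = S1" using homeomorphism_image1[OF h] .
  then show "x \<in> S1 \<Longrightarrow> g x \<in> S1" by blast
  show "inj_on g S1" using homeomorphism_apply1[OF h] by (rule inj_on_inverseI)
  show "continuous_on S1 g" using homeomorphism_cont1[OF h] .
  show "y \<in> open_arc x z \<Longrightarrow> g y \<in> open_arc (g x) (g z)"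
    using assms unfolding orientation_preserving_homeo_def open_arc_def by blast
qed

lemma oph_eq: "oph g \<Longrightarrow> x \<in> S1 \<Longrightarrow> y \<in> S1 \<Longrightarrow> g x = g y \<longleftrightarrow> x = y"
  using oph_inj inj_on_eq_iff by metis

lemma oph_arc_iff:
  assumes g: "oph g" and S: "x \<in> S1" "y \<in> S1" "z \<in> S1"
  shows "g y \<in> open_arc (g x) (g z) \<longleftrightarrow> y \<in> open_arc x z"
proof
  assume a: "g y \<in> open_arc (g x) (g z)"
  have "x \<noteq> z" using a by auto
  moreover have "y \<noteq> x" "y \<noteq> z" using a arc_ends by blast+
  moreover have "y \<notin> open_arc z x" using oph_arc_mono[OF g, of y z x] a arc_not_dual by blast
  ultimately show "y \<in> open_arc x z" using arc_cases[OF S(1,3,2)] by blast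
qed (rule oph_arc_mono[OF g])

lemma oph_image_arc:
  assumes g: "oph g" and S: "u \<in> S1" "v \<in> S1"
  shows "g ` open_arc u v = open_arc (g u) (g v)"
proof
  show "g ` open_arc u v \<subseteq> open_arc (g u) (g v)" using oph_arc_mono[OF g] by blast
  show "open_arc (g u) (g v) \<subseteq> g ` open_arc u v"
  proof
    fix w assume w: "w \<in> open_arc (g u) (g v)"
    then have "w \<in> g ` S1" using arc_sub_S1 oph_surj[OF g] by blast
    then obtain z where z: "z \<in> S1" "w = g z" by blast
    then show "w \<in> g ` open_arc u v" using w oph_arc_iff[OF g S(1) z(1) S(2)] by blast
  qed
qed

lemma oph_inverse:
  assumes g: "oph g"
  obtains h where "oph h" "\<forall>x\<in>S1. h (g x) = x" "\<forall>x\<in>S1. g (h x) = x"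
proof -
  obtain h where h: "homeomorphism S1 S1 g h" using g unfolding orientation_preserving_homeo_def by blast
  have hg: "h (g x) = x" "g (h x) = x" if "x \<in> S1" for x
    using homeomorphism_apply1[OF h that] homeomorphism_apply2[OF h that] .
  have hS: "h x \<in> S1" if "x \<in> S1" for x using homeomorphism_image2[OF h] that by blast
  have "ccw (h u) (h z) (h v)" if c: "ccw u z v" for u z v
  proof -
    have S: "u \<in> S1" "z \<in> S1" "v \<in> S1" "z \<in> open_arc u v" using c unfolding ccw_def open_arc_def by blast+
    then have "g (h z) \<in> open_arc (g (h u)) (g (h v))" using hg by metis
    then have "h z \<in> open_arc (h u) (h v)" using oph_arc_iff[OF g hS hS hS] S by blast
    then show ?thesis unfolding open_arc_def by blast
  qed
  moreover have "\<exists>k. homeomorphism S1 S1 h k" using h homeomorphism_symD by blast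
  ultimately have "oph h" unfolding orientation_preserving_homeo_def by blast
  then show ?thesis using that hg by blast
qed

lemma oph_funpow:
  assumes g: "oph g"
  shows "oph (g ^^ n)"
proof (induction n)
  case 0
  have "homeomorphism S1 S1 (\<lambda>x. x) (\<lambda>x. x)" by (rule homeomorphism_ident)
  then show ?case unfolding orientation_preserving_homeo_def funpow_0 by (auto simp: id_def)
next
  case (Suc n)
  obtain h k where "homeomorphism S1 S1 (g ^^ n) h" "homeomorphism S1 S1 g k"
    using g Suc unfolding orientation_preserving_homeo_def by blast
  then have "homeomorphism S1 S1 (g \<circ> (g ^^ n)) (h \<circ> k)" by (rule homeomorphism_compose)
  moreover have "ccw ((g ^^ Suc n) u) ((g ^^ Suc n) z) ((g ^^ Suc n) v)" if "ccw u z v" for u z v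
    using that g Suc unfolding orientation_preserving_homeo_def by simp
  ultimately show ?case unfolding orientation_preserving_homeo_def by auto
qed

lemma preserves_funpow:
  assumes "preserves g A"
  shows "preserves (g ^^ n) A"
proof (induction n)
  case (Suc n)
  have "(\<lambda>I. (g ^^ Suc n) ` I) ` A = (\<lambda>I. g ` I) ` (\<lambda>I. (g ^^ n) ` I) ` A"
    by (simp add: image_image image_comp comp_def)
  then show ?case using assms Suc unfolding preserves_def by simp
qed (simp add: preserves_def)

lemma closed_Fix:
  assumes g: "oph g"
  shows "closed (Fix g)"
proof -
  have "continuous_on S1 (\<lambda>x. g x - x)" using oph_cont[OF g] by (intro continuous_intros)
  then have "closed {x \<in> S1. g x - x = 0}" by (rule continuous_closed_preimage_constant) simp
  then show ?thesis unfolding Fix_def by simp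
qed

lemma FixD: "x \<in> Fix g \<Longrightarrow> x \<in> S1" "x \<in> Fix g \<Longrightarrow> g x = x" "x \<in> S1 \<Longrightarrow> g x = x \<Longrightarrow> x \<in> Fix g" "Fix g \<subseteq> S1"
  unfolding Fix_def by auto

lemma oph_fixed_point:
  assumes g: "oph g" and uv: "u \<in> S1" "v \<in> S1" "u \<noteq> v" and sub: "open_arc (g u) (g v) \<subseteq> open_arc u v"
  shows "\<exists>x\<in>Fix g. x \<notin> open_arc v u"
proof -
  have "g u \<noteq> g v" using oph_eq[OF g] uv by blast
  from fixed_point_in_arc[OF oph_S1[OF g] oph_arc_mono[OF g] uv this sub]
  show ?thesis unfolding Fix_def by blast
qed

lemma oph_fixed_point_inverse:
  assumes g: "oph g" and uv: "u \<in> S1" "v \<in> S1" "u \<noteq> v" and sub: "open_arc u v \<subseteq> open_arc (g u) (g v)"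
  shows "\<exists>x\<in>Fix g. x \<notin> open_arc (g v) (g u)"
proof -
  obtain h where h: "oph h" "\<forall>x\<in>S1. h (g x) = x" "\<forall>x\<in>S1. g (h x) = x" using oph_inverse[OF g] .
  have "g u \<noteq> g v" using oph_eq[OF g] uv by blast
  then have "\<exists>x\<in>Fix h. x \<notin> open_arc (g v) (g u)"
    using oph_fixed_point[OF h(1), of "g u" "g v"] oph_S1[OF g] h(2) uv sub by metis
  then obtain x where x: "x \<in> Fix h" "x \<notin> open_arc (g v) (g u)" by blast
  have "x \<in> Fix g" using h(3) FixD(1,2)[OF x(1)] by (intro FixD(3)) force+
  then show ?thesis using x by blast
qed

text \<open>The backward moving \<open>z\<close> and the forward moving \<open>z'\<close> bound an
  arc that is mapped into or over itself, depending on their order. Either way a fixed point lies in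
  the closed arc between them or between their images, hence inside \<open>(u, v)\<close>.\<close>

lemma direction_constant:
  assumes g: "oph g" and uv: "u \<in> S1" "v \<in> S1" and F: "g u = u" "g v = v" "open_arc u v \<inter> Fix g = {}"
    and z: "z \<in> open_arc u v" "z' \<in> open_arc u v" "g z \<in> open_arc u z" "g z' \<in> open_arc z' v"
  shows False
proof -
  have S: "z \<in> S1" "z' \<in> S1" "g z \<in> S1" "g z' \<in> S1" using z arc_sub_S1 oph_S1[OF g] by blast+
  have gz': "g z' \<in> open_arc u v" "z' \<in> open_arc u (g z')"
    using arc_right_trans[OF z(2)] arc_between_left[OF z(2)] z(4) by blast+
  have nf: "w \<in> open_arc z z'" if "w \<in> Fix g" "z' \<in> open_arc u z" for w
    using arc_outside[OF that(2) z(1) FixD(1)[OF that(1)]] that(1) F(3) by blast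
  have nf': "w \<in> open_arc (g z') (g z)" if "w \<in> Fix g" "g z \<in> open_arc u (g z')" for w
    using arc_outside[OF that(2) gz'(1) FixD(1)[OF that(1)]] that(1) F(3) by blast
  have "z \<noteq> z'" using gz'(2) z(3) arc_asym by blast
  then consider "z' \<in> open_arc u z" | "z \<in> open_arc u z'"
    using arc_linear[OF S(1,2) uv(1)] z arc_ends by blast
  then show False
  proof cases
    case 1
    have m: "g z' \<in> open_arc u (g z)" using oph_arc_mono[OF g 1] F(1) by simp
    have ne: "g z' \<noteq> g z" using \<open>z \<noteq> z'\<close> oph_eq[OF g S(2,1)] by blast
    have "g z' \<in> open_arc z' z" by (rule arc_between[OF gz'(2) arc_left_trans[OF m z(3)]])
    moreover have "z' \<notin> open_arc (g z') (g z)" using arc_between_left[OF m] arc_asym[OF gz'(2)] by blast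
    moreover have "z \<notin> open_arc (g z') (g z)" using arc_right_trans[OF m] arc_asym[OF z(3)] by blast
    moreover note ne
    ultimately have "open_arc (g z') (g z) \<subseteq> open_arc z' z"
      using arc_subset_iff[OF S(4,3) _ S(2,1)] \<open>z \<noteq> z'\<close> by blast
    then obtain x where "x \<in> Fix g" "x \<notin> open_arc z z'"
      using oph_fixed_point[OF g S(2,1)] \<open>z \<noteq> z'\<close> by blast
    then show False using nf 1 by blast
  next
    case 2
    have m: "g z \<in> open_arc u (g z')" using oph_arc_mono[OF g 2] F(1) by simp
    have ne: "g z \<noteq> g z'" using \<open>z \<noteq> z'\<close> oph_eq[OF g S(1,2)] by blast
    have "z \<in> open_arc (g z) (g z')" by (rule arc_between[OF z(3) arc_left_trans[OF 2 gz'(2)]])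
    moreover have "g z \<notin> open_arc z z'" using arc_between_left[OF 2] arc_asym[OF z(3)] by blast
    moreover have "g z' \<notin> open_arc z z'" using arc_right_trans[OF 2] arc_asym[OF gz'(2)] by blast
    moreover note ne
    ultimately have "open_arc z z' \<subseteq> open_arc (g z) (g z')"
      using arc_subset_iff[OF S(1,2) _ S(3,4)] \<open>z \<noteq> z'\<close> by blast
    then obtain x where "x \<in> Fix g" "x \<notin> open_arc (g z') (g z)"
      using oph_fixed_point_inverse[OF g S(1,2)] \<open>z \<noteq> z'\<close> by blast
    then show False using nf' m by blast
  qed
qed

text \<open>Cutting the circle at \<open>p\<close> turns \<open>f\<close> into an increasing map of
  a line, on which the orbit of a moved point is strictly monotone.\<close>

lemma periodic_imp_fixed:
  assumes f: "oph f" and p: "p \<in> Fix f" and z: "z \<in> S1" "(f ^^ k) z = z" "0 < k"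
  shows "f z = z"
proof (rule ccontr)
  assume n: "f z \<noteq> z"
  have pS: "p \<in> S1" "f p = p" using FixD(1,2)[OF p] .
  have "z \<noteq> p" using n pS by auto
  have fz: "f z \<in> S1" "f z \<noteq> p" using oph_S1[OF f z(1)] oph_eq[OF f z(1) pS(1)] pS(2) \<open>z \<noteq> p\<close> by metis+
  obtain n where k: "k = Suc n" using z(3) by (cases k) auto
  from arc_linear[OF fz(1) z(1) pS(1) n fz(2) \<open>z \<noteq> p\<close>] show False
  proof
    assume a: "f z \<in> open_arc p z"
    have "(f ^^ Suc n) z \<in> open_arc p z" for n
    proof (induction n)
      case (Suc n)
      have "f ((f ^^ Suc n) z) \<in> open_arc p (f z)" using oph_arc_mono[OF f Suc] pS by simp
      then show ?case using arc_left_trans a by (metis funpow.simps(2) o_apply)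
    qed (use a in simp)
    then show False using z(2) k arc_ends by metis
  next
    assume "z \<in> open_arc p (f z)"
    then have a: "f z \<in> open_arc z p" using arc_rotate by blast
    have "(f ^^ Suc n) z \<in> open_arc z p" for n
    proof (induction n)
      case (Suc n)
      have "f ((f ^^ Suc n) z) \<in> open_arc (f z) p" using oph_arc_mono[OF f Suc] pS by simp
      then show ?case using arc_right_trans[OF a] by (metis funpow.simps(2) o_apply)
    qed (use a in simp)
    then show False using z(2) k arc_ends by metis
  qed
qed

section \<open>Automorphisms of lamination systems\<close>

lemma aut_lf:
  assumes "oph g" "preserves g L" "lf L u v"
  shows "lf L (g u) (g v)"
proof -
  note s = lfD[OF assms(3)]
  have "open_arc (g u) (g v) \<in> L"
    using s(4) assms(2) unfolding preserves_def oph_image_arc[OF assms(1) s(1,2), symmetric] by blast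
  then show ?thesis unfolding lf_def using oph_S1[OF assms(1)] s oph_eq[OF assms(1) s(1,2)] by blast
qed

lemma aut_lf_rev:
  assumes L: "lamination_system L" and g: "oph g" "preserves g L" and S: "u \<in> S1" "v \<in> S1" and l: "lf L (g u) (g v)"
  shows "lf L u v"
proof -
  have "open_arc (g u) (g v) \<in> (\<lambda>I. g ` I) ` L" using lfD(4)[OF l] by (simp only: g(2)[unfolded preserves_def])
  then obtain J where J: "J \<in> L" "g ` J = open_arc (g u) (g v)" by (metis imageE)
  obtain a b where ab: "lf L a b" "J = open_arc a b" using J(1) by (rule lam_arcE[OF L])
  have "open_arc (g a) (g b) = open_arc (g u) (g v)" using J(2) ab oph_image_arc[OF g(1) lfD(1,2)[OF ab(1)]] by simp
  then have "g a = g u \<and> g b = g v" by (rule lf_inj[OF aut_lf[OF g ab(1)] l])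
  then show ?thesis using ab(1) oph_eq[OF g(1) lfD(1)[OF ab(1)] S(1)] oph_eq[OF g(1) lfD(2)[OF ab(1)] S(2)] by simp
qed

lemma gap_image:
  assumes L: "lamination_system L" and g: "oph g" "preserves g L" and G: "gap L G"
  shows "gap L ((`) g ` G)" "vertices ((`) g ` G) = g ` vertices G"
proof -
  have GS: "I \<subseteq> S1" if I: "I \<in> G" for I
  proof -
    obtain u v where "I = open_arc u v" using gap_lfE[OF L G I] .
    then show ?thesis using arc_sub_S1 by blast
  qed
  have "g ` S1 - g ` \<Union>G = g ` (S1 - \<Union>G)"
    using GS by (intro inj_on_image_set_diff[symmetric, OF oph_inj[OF g(1)]]) auto
  then show "vertices ((`) g ` G) = g ` vertices G"
    unfolding vertices_def oph_surj[OF g(1)] by (simp add: image_Union)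
  show "gap L ((`) g ` G)" unfolding gap_def
  proof (intro conjI ballI)
    show "(`) g ` G \<subseteq> L" using G g(2) unfolding gap_def preserves_def by blast
    have "I = J \<or> g ` I \<inter> g ` J = {}" if IJ: "I \<in> G" "J \<in> G" for I J
    proof (cases "I = J")
      case False
      then have "I \<inter> J = {}" using gap_disjoint[OF G IJ] by blast
      then show ?thesis using inj_on_image_Int[OF oph_inj[OF g(1)] GS[OF IJ(1)] GS[OF IJ(2)]] by simp
    qed simp
    then show "disjoint ((`) g ` G)" unfolding disjoint_def by blast
    fix l assume "l \<in> leaves L"
    then obtain I where I: "I \<in> L" "l = leaf I" unfolding leaves_def by blast
    obtain u v where u: "lf L u v" "I = open_arc u v" using I(1) by (rule lam_arcE[OF L])
    have "u \<in> g ` S1" "v \<in> g ` S1" using lfD[OF u(1)] oph_surj[OF g(1)] by blast+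
    then obtain a b where ab: "a \<in> S1" "b \<in> S1" "u = g a" "v = g b" by blast
    then have "lf L a b" using aut_lf_rev[OF L g] u(1) by blast
    then obtain M where M: "M \<in> G" "open_arc a b \<subseteq> M \<or> open_arc b a \<subseteq> M" using gap_leaf_side[OF G] by blast
    then have "open_arc u v \<subseteq> g ` M \<or> open_arc v u \<subseteq> g ` M"
      using oph_image_arc[OF g(1) ab(1,2)] oph_image_arc[OF g(1) ab(2,1)] ab(3,4) by blast
    then show "\<exists>J\<in>(`) g ` G. lies_on l J" unfolding I(2) u(2) lies_on_def leaf_lf[OF u(1)] using M(1) by blast
  qed
qed

lemma nonleaf_gap_image:
  assumes L: "lamination_system L" and g: "oph g" "preserves g L" and G: "nonleaf_gap L G"
  shows "nonleaf_gap L ((`) g ` G)"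
proof -
  have gG: "gap L G" "G \<notin> leaves L" using G unfolding nonleaf_gap_def by blast+
  have "(`) g ` G \<notin> leaves L"
  proof
    assume "(`) g ` G \<in> leaves L"
    then obtain u v where u: "lf L u v" "(`) g ` G = {open_arc u v, open_arc v u}" by (rule leavesE[OF L])
    have "u \<in> g ` S1" "v \<in> g ` S1" using lfD[OF u(1)] oph_surj[OF g(1)] by blast+
    then obtain a b where ab: "a \<in> S1" "b \<in> S1" "u = g a" "v = g b" by blast
    have lab: "lf L a b" using aut_lf_rev[OF L g] u(1) ab by blast
    have "vertices G = {a, b}"
    proof -
      have "g ` vertices G = g ` {a, b}"
        using gap_image(2)[OF L g gG(1)] leaf_gap(2)[OF L u(1)] u(2) ab by simp
      then show ?thesis using inj_on_image_eq_iff[OF oph_inj[OF g(1)], of "vertices G" "{a, b}"] vertices_S1 ab(1,2) by blast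
    qed
    then have "G = {open_arc a b, open_arc b a}"
      by (intro gap_eqI[OF L gG(1) leaf_gap(1)[OF L lab]]) (simp add: leaf_gap(2)[OF L lab])
    then show False using leaves_lf[OF lab] gG(2) by simp
  qed
  then show ?thesis using gap_image(1)[OF L g gG(1)] unfolding nonleaf_gap_def by blast
qed

text \<open>The gap and its image share the vertex \<open>g x\<close>, so looseness identifies
  them.\<close>

lemma loose_gap_invariant:
  assumes L: "loose L" and g: "oph g" "preserves g L" and G: "nonleaf_gap L G" and x: "x \<in> vertices G" "g x \<in> vertices G"
  shows "preserves g G"
proof -
  have lam: "lamination_system L" using L unfolding loose_def quite_full_def by blast
  have "gap L G" using G unfolding nonleaf_gap_def by blast
  then have "g x \<in> vertices ((`) g ` G)" using gap_image(2)[OF lam g] x(1) by blast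
  then have "(`) g ` G = G" using L nonleaf_gap_image[OF lam g G] G x(2) unfolding loose_def by blast
  then show ?thesis unfolding preserves_def by simp
qed

text \<open>Consecutive elements share a tip, so the index of the image of one element determines
  the index for its neighbours.\<close>

lemma preserves_crown_translation:
  assumes g: "oph g" and t: "crown_seq L G p t" and G: "preserves g G"
  obtains m where "\<And>k. g (t k) = t (k + m)"
proof -
  note t' = crown_seqD[OF t]
  note inj = crown_seq_inj[OF t]
  have step: "\<exists>j. g (t k) = t j \<and> g (t (k + 1)) = t (j + 1)" for k
  proof -
    have "open_arc (t k) (t (k + 1)) \<in> G" unfolding t'(4) by (rule rangeI)
    then have "g ` open_arc (t k) (t (k + 1)) \<in> G" using G unfolding preserves_def by blast
    then obtain j where j: "g ` open_arc (t k) (t (k + 1)) = open_arc (t j) (t (j + 1))" unfolding t'(4) by blast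
    note s = lfD[OF t'(3)[of k]] and sj = lfD[OF t'(3)[of j]]
    have "g (t k) \<noteq> g (t (k + 1))" using oph_eq[OF g s(1,2)] s(3) by blast
    then have "g (t k) = t j \<and> g (t (k + 1)) = t (j + 1)"
      using arc_inj[OF oph_S1[OF g s(1)] oph_S1[OF g s(2)] _ sj(1-3)] j oph_image_arc[OF g s(1,2)] by metis
    then show ?thesis by blast
  qed
  obtain m where m: "g (t 0) = t m" using step[of 0] by blast
  have "g (t k) = t (k + m)" for k
  proof (induction k rule: int_induct[of _ 0])
    case base then show ?case using m by simp
  next
    case (step1 i)
    obtain j where j: "g (t i) = t j" "g (t (i + 1)) = t (j + 1)" using step by blast
    then have "j = i + m" using inj step1 by metis
    then show ?case using j by (simp add: algebra_simps)
  next
    case (step2 i)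
    obtain j where j: "g (t (i - 1)) = t j" "g (t (i - 1 + 1)) = t (j + 1)" using step by blast
    then have "j + 1 = i + m" using inj step2 by (metis diff_add_cancel)
    then have "j = i - 1 + m" by simp
    then show ?case using j(1) by simp
  qed
  then show ?thesis by (rule that)
qed

text \<open>On the tips \<open>g\<close> is a shift by some \<open>m\<close>. For
  \<open>m = 0\<close> all tips are fixed; otherwise every tip is moved and every element is
  displaced off itself, so that only the pivot can be fixed.\<close>

lemma fixed_pivot_cases:
  assumes g: "oph g" and t: "crown_seq L G p t" and G: "preserves g G" and p: "g p = p"
  shows "(\<forall>k. t k \<in> Fix g) \<or> Fix g = {p}"
proof -
  note t' = crown_seqD[OF t]
  note inj = crown_seq_inj[OF t]
  obtain m where m: "\<And>k. g (t k) = t (k + m)" using preserves_crown_translation[OF g t G] by blast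
  show ?thesis
  proof (cases "m = 0")
    case True
    then have "t k \<in> Fix g" for k using m[of k] lfD(1)[OF t'(3)[of k]] by (intro FixD(3)) auto
    then show ?thesis by blast
  next
    case False
    have "z = p" if z: "z \<in> Fix g" for z
    proof (rule ccontr)
      assume "z \<noteq> p"
      have zS: "z \<in> S1" "g z = z" using z FixD by blast+
      show False
      proof (cases "z \<in> vertices G")
        case True
        then obtain k where "z = t k" using t'(5) \<open>z \<noteq> p\<close> by blast
        then show False using m[of k] zS inj[of "k + m" k] False by simp
      next
        case nv: False
        then have "z \<in> \<Union>G" using zS unfolding vertices_def by blast
        then obtain k where k: "z \<in> open_arc (t k) (t (k + 1))" unfolding t'(4) by blast
        have "z \<in> open_arc (t (k + m)) (t (k + m + 1))"
          using oph_arc_mono[OF g k] zS m[of k] m[of "k + 1"] by (simp add: algebra_simps)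
        moreover have "open_arc (t k) (t (k + 1)) \<in> G" "open_arc (t (k + m)) (t (k + m + 1)) \<in> G"
          unfolding t'(4) by (rule rangeI)+
        ultimately have "open_arc (t k) (t (k + 1)) = open_arc (t (k + m)) (t (k + m + 1))"
          using gap_disjoint[OF t'(1)] k by blast
        then have "t k = t (k + m)" using lf_inj[OF t'(3) t'(3)] by blast
        then show False using inj[of k "k + m"] False by simp
      qed
    qed
    moreover have "p \<in> Fix g" using p t'(2) by (intro FixD(3))
    ultimately show ?thesis by blast
  qed
qed

lemma preserves_crown_pivot:
  assumes g: "oph g" and t: "crown_seq L G p t" and G: "preserves g G"
  shows "g p = p"
proof -
  note t' = crown_seqD[OF t]
  obtain m where m: "\<And>k. g (t k) = t (k + m)" using preserves_crown_translation[OF g t G] by blast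
  have "p \<in> g ` S1" using t'(2) oph_surj[OF g] by blast
  then obtain q where q: "q \<in> S1" "p = g q" by blast
  have "q \<in> vertices G"
  proof (rule ccontr)
    assume "q \<notin> vertices G"
    then obtain I where "I \<in> G" "q \<in> I" using q unfolding vertices_def by blast
    then have "p \<in> g ` I" "g ` I \<in> G" using G q unfolding preserves_def by blast+
    moreover have "p \<in> vertices G" unfolding t'(5) by blast
    ultimately show False unfolding vertices_def by blast
  qed
  moreover have "q \<noteq> t k" for k using m[of k] q t'(6) by (metis rangeI)
  ultimately have "q = p" unfolding t'(5) by blast
  then show ?thesis using q by simp
qed

section \<open>Local structure of the fixed point set\<close>

text \<open>\<open>rainbow_small\<close> controls each endpoint on its own side only. Once
  \<open>c\<close> and \<open>d\<close> are ordered so that \<open>p\<close> lies between them, this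
  gives an interval that omits both.\<close>

lemma rainbow_avoid:
  assumes L: "lamination_system L" and r: "rainbow_point L p" and S: "p \<in> S1" "c \<in> S1" "d \<in> S1" "c \<noteq> p" "d \<noteq> p"
  obtains a b where "lf L a b" "p \<in> open_arc a b" "c \<in> open_arc b a" "d \<in> open_arc b a"
proof -
  have main: "\<exists>a b. lf L a b \<and> p \<in> open_arc a b \<and> x \<in> open_arc b a \<and> y \<in> open_arc b a"
    if xy: "x \<in> S1" "y \<in> S1" "x \<noteq> p" "y \<noteq> p" "x = y \<or> p \<in> open_arc x y" for x y
  proof -
    obtain a b where ab: "a \<in> S1" "b \<in> S1" "a \<noteq> b" "open_arc a b \<in> L" "p \<in> open_arc a b" "a \<in> open_arc x p" "b \<in> open_arc p y"
      using rainbow_small[OF r lam_good[OF L] xy(1,2,3,4) S(1)] by blast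
    have px: "p \<in> open_arc x b" "p \<in> open_arc a y"
      using xy(5) ab(6,7) arc_between_left[of p x y b] arc_between[of a x p y] arc_rotate[of p x b] arc_rotate[of p a y]
        arc_rotate[of y p a] by blast+
    have "a \<in> open_arc x b" by (rule arc_left_trans[OF ab(6) px(1)])
    moreover have "b \<in> open_arc a y" by (rule arc_right_trans[OF px(2)]) (simp add: ab(7))
    ultimately have "x \<in> open_arc b a" "y \<in> open_arc b a"
      using arc_rotate[of a x b] arc_rotate[of b a x] arc_rotate[of b a y] arc_rotate[of x b a] by blast+
    then show ?thesis using ab unfolding lf_def by blast
  qed
  have "c = d \<or> p \<in> open_arc c d \<or> p \<in> open_arc d c" using arc_cases[OF S(2,3,1)] S(4,5) by blast
  then show ?thesis using main[of c d] main[of d c] S that by blast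
qed

lemma invariant_union:
  assumes pr: "preserves f L" and P: "\<And>J. J \<in> L \<Longrightarrow> P (f ` J) \<longleftrightarrow> P J"
  shows "f ` \<Union>{J \<in> L. P J} = \<Union>{J \<in> L. P J}"
proof -
  have e: "(\<lambda>J. f ` J) ` L = L" using pr unfolding preserves_def .
  have "(\<lambda>J. f ` J) ` {J \<in> L. P J} = {J \<in> L. P J}"
  proof (intro subset_antisym subsetI)
    fix K assume "K \<in> (\<lambda>J. f ` J) ` {J \<in> L. P J}"
    then obtain J where J: "J \<in> L" "P J" "K = f ` J" by blast
    moreover have "f ` J \<in> L" using imageI[OF J(1), of "\<lambda>J. f ` J"] unfolding e .
    ultimately show "K \<in> {J \<in> L. P J}" using P by simp
  next
    fix K assume K: "K \<in> {J \<in> L. P J}"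
    then have "K \<in> (\<lambda>J. f ` J) ` L" unfolding e by simp
    then obtain J where "J \<in> L" "K = f ` J" by blast
    then show "K \<in> (\<lambda>J. f ` J) ` {J \<in> L. P J}" using P K by blast
  qed
  then show ?thesis unfolding image_Union by simp
qed

lemma invariant_arc:
  assumes f: "oph f" and l: "lf L u v" and e: "f ` open_arc u v = open_arc u v"
  shows "u \<in> Fix f" "v \<in> Fix f"
proof -
  note s = lfD(1-3)[OF l]
  have "f u \<noteq> f v" using oph_eq[OF f s(1,2)] s(3) by blast
  then have "f u = u \<and> f v = v"
    using e s oph_image_arc[OF f s(1,2)] oph_S1[OF f] by (intro arc_inj) simp_all
  then show "u \<in> Fix f" "v \<in> Fix f" using s by (auto intro: FixD(3))
qed

text \<open>Results inside are mostly stated for \<open>L1\<close>; as the assumptions are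
  symmetric, \<open>flip\<close> transfers them to \<open>L2\<close>. The map \<open>f\<close> is
  later also a power of the given automorphism.\<close>

locale fixed_aut =
  fixes L1 L2 :: "complex set set" and f :: "complex \<Rightarrow> complex"
  assumes V: "veering_pair L1 L2" and f: "oph f" and f1: "preserves f L1" and f2: "preserves f L2"
    and nt: "nontrivial f" and ne: "Fix f \<noteq> {}"
begin

lemma flip: "fixed_aut L2 L1 f"
  by (intro fixed_aut.intro veering_sym[OF V] f f1 f2 nt ne)

lemmas lam1 = veeringD(3)[OF V]

lemma pivot_cases:
  assumes C: "crown_with_pivot L1 G u" and u: "u \<in> Fix f"
  shows "preserves f G" "Fix f = {u} \<or> (\<exists>t. crown_seq L1 G u t \<and> (\<forall>k. t k \<in> Fix f))"
proof -
  obtain t where t: "crown_seq L1 G u t" using crownE[OF lam1 C] .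
  have fu: "f u = u" by (rule FixD(2)[OF u])
  have "u \<in> vertices G" unfolding crown_seqD(5)[OF t] by blast
  then show p: "preserves f G"
    using loose_gap_invariant[OF veeringD(5)[OF V] f f1 crown_nonleaf[OF lam1 C]] fu by metis
  show "Fix f = {u} \<or> (\<exists>t. crown_seq L1 G u t \<and> (\<forall>k. t k \<in> Fix f))"
    using fixed_pivot_cases[OF f t p fu] t by blast
qed

text \<open>Keep a point \<open>z\<close> and its preimage outside a small interval around
  \<open>u\<close>. Then the interval and its image both contain \<open>u\<close> and omit
  \<open>z\<close>, so they are nested. The complementary arc is mapped into or over itself, which
  yields a fixed point outside the smaller interval, hence different from \<open>u\<close>.\<close>

lemma single_not_rainbow:
  assumes F: "Fix f = {u}"
  shows "\<not> rainbow_point L1 u"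
proof
  assume r: "rainbow_point L1 u"
  have u: "u \<in> S1" "f u = u" using F FixD(1,2)[of u f] by blast+
  obtain z where z: "z \<in> S1" "z \<noteq> u" using S1_other_point[OF u(1)] by blast
  have "z \<in> f ` S1" using z(1) oph_surj[OF f] by blast
  then obtain z' where z': "z' \<in> S1" "z = f z'" by blast
  have "z' \<noteq> u" using z' z u by auto
  obtain a b where ab: "lf L1 a b" "u \<in> open_arc a b" "z \<in> open_arc b a" "z' \<in> open_arc b a"
    by (rule rainbow_avoid[OF lam1 r u(1) z(1) z'(1) z(2) \<open>z' \<noteq> u\<close>])
  have lf': "lf L1 (f a) (f b)" by (rule aut_lf[OF f f1 ab(1)])
  have u': "u \<in> open_arc (f a) (f b)" using oph_arc_mono[OF f ab(2)] u(2) by simp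
  have z'': "z \<notin> open_arc (f a) (f b)" using oph_arc_mono[OF f ab(4)] z'(2) arc_not_dual by blast
  note s = lfD(1-3)[OF ab(1)] lfD(1-3)[OF lf_sym[OF lam1 ab(1)]]
  consider "open_arc a b \<subseteq> open_arc (f a) (f b)" | "open_arc (f a) (f b) \<subseteq> open_arc a b"
    using lf_nested[OF lam1 ab(1) lf'] u' ab(2,3) z'' by blast
  then show False
  proof cases
    case 1
    then have "open_arc (f b) (f a) \<subseteq> open_arc b a" using lf_subset_dual[OF ab(1) lf'] by blast
    then obtain x where "x \<in> Fix f" "x \<notin> open_arc a b" using oph_fixed_point[OF f s(4-6)] by blast
    then have "x = u" using F by simp
    then show False using ab(2) \<open>x \<notin> open_arc a b\<close> by blast
  next
    case 2
    then have "open_arc b a \<subseteq> open_arc (f b) (f a)" using lf_subset_dual[OF lf' ab(1)] by blast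
    then obtain x where "x \<in> Fix f" "x \<notin> open_arc (f a) (f b)" using oph_fixed_point_inverse[OF f s(4-6)] by blast
    then have "x = u" using F by simp
    then show False using u' \<open>x \<notin> open_arc (f a) (f b)\<close> by blast
  qed
qed

lemma single_fixed_point:
  assumes F: "Fix f = {u}"
  shows "\<exists>G H. crown_with_pivot L1 G u \<and> crown_with_pivot L2 H u \<and> interleaving_pair L1 L2 G H \<and>
    preserves f G \<and> preserves f H"
proof -
  have u: "u \<in> Fix f" "u \<in> S1" using F FixD(1)[of u f] by blast+
  obtain G H where "crown_with_pivot L1 G u" "crown_with_pivot L2 H u" "interleaving_pair L1 L2 G H"
    using not_rainbow_pivot[OF V u(2) single_not_rainbow[OF F] fixed_aut.single_not_rainbow[OF flip F]] by blast
  then show ?thesis using pivot_cases(1)[OF _ u(1)] fixed_aut.pivot_cases(1)[OF flip _ u(1)] by blast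
qed

definition adj :: "complex \<Rightarrow> complex \<Rightarrow> bool" where
  "adj u v \<longleftrightarrow> u \<in> Fix f \<and> v \<in> Fix f \<and> u \<noteq> v \<and> open_arc u v \<inter> Fix f = {}"

lemma adjD:
  assumes "adj u v"
  shows "u \<in> Fix f" "v \<in> Fix f" "u \<noteq> v" "open_arc u v \<inter> Fix f = {}"
    "u \<in> S1" "v \<in> S1" "f u = u" "f v = v"
proof -
  show F: "u \<in> Fix f" "v \<in> Fix f" "u \<noteq> v" "open_arc u v \<inter> Fix f = {}"
    using assms unfolding adj_def by blast+
  show "u \<in> S1" "v \<in> S1" "f u = u" "f v = v" using FixD(1,2)[OF F(1)] FixD(1,2)[OF F(2)] by simp_all
qed

lemma adj_unique_right:
  assumes "adj u q" "adj u q'"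
  shows "q = q'"
  using arc_linear[OF adjD(6)[OF assms(1)] adjD(6)[OF assms(2)] adjD(5)[OF assms(1)]]
    adjD(2-4)[OF assms(1)] adjD(2-4)[OF assms(2)] by blast

lemma adj_unique_left:
  assumes "adj p u" "adj p' u"
  shows "p = p'"
  using arc_linear[OF adjD(5)[OF assms(1)] adjD(5)[OF assms(2)] adjD(6)[OF assms(1)]] arc_rotate[of p u p'] arc_rotate[of p' u p]
    adjD(1,3,4)[OF assms(1)] adjD(1,3,4)[OF assms(2)] by blast

text \<open>One side without nearby fixed points is enough. In the presence of a second fixed point
  a pivot is never free, since fixed tips accumulate at it from both sides.\<close>

definition free :: "complex \<Rightarrow> bool" where
  "free u \<longleftrightarrow> u \<in> Fix f \<and> (\<exists>z\<in>S1. z \<noteq> u \<and> (open_arc u z \<inter> Fix f = {} \<or> open_arc z u \<inter> Fix f = {}))"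

lemma adj_free: "adj u v \<Longrightarrow> free u" "adj u v \<Longrightarrow> free v"
  unfolding free_def using adjD by metis+

end

locale multi_fixed_aut = fixed_aut +
  assumes two: "\<exists>x\<in>Fix f. \<exists>y\<in>Fix f. x \<noteq> y"
begin

lemma flip_multi: "multi_fixed_aut L2 L1 f"
  using flip two unfolding multi_fixed_aut_def multi_fixed_aut_axioms_def by blast

lemma other: obtains v where "v \<in> Fix f" "v \<noteq> u"
  using two by metis

lemma not_single: "Fix f \<noteq> {u}"
  using two by (metis singletonD)

lemma adj_next:
  assumes u: "u \<in> Fix f" "z \<in> S1" "z \<noteq> u" "open_arc u z \<inter> Fix f = {}"
  shows "\<exists>q. adj u q \<and> (z = q \<or> z \<in> open_arc u q)"
proof (cases "z \<in> Fix f")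
  case True then show ?thesis using u unfolding adj_def by blast
next
  case False
  obtain q where q: "q \<in> Fix f" "open_arc z q \<inter> Fix f = {}" using closed_next[OF closed_Fix[OF f] FixD(4) ne u(2)] by blast
  have S: "u \<in> S1" "q \<in> S1" using u q FixD by blast+
  have "q \<noteq> u"
  proof
    assume e: "q = u"
    obtain y where "y \<in> Fix f" "y \<noteq> u" by (rule other)
    then show False using arc_cases[OF S(1) u(2) FixD(1)[of y f]] u False q(2) e by blast
  qed
  have "q \<noteq> z" using q False by blast
  then have z: "z \<in> open_arc u q" using arc_linear[OF u(2) S(2,1)] u q \<open>q \<noteq> u\<close> by blast
  have "w \<notin> Fix f" if w: "w \<in> open_arc u q" for w
  proof
    assume wF: "w \<in> Fix f"
    have "w \<in> open_arc u z \<or> w = z \<or> w \<in> open_arc z q"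
    proof -
      have "cyc (Arg2pi u) (Arg2pi z) (Arg2pi q)" "cyc (Arg2pi u) (Arg2pi w) (Arg2pi q)" using z w arc_memD by blast+
      then show ?thesis using S u(2) FixD(1)[OF wF] by (simp only: arc_cyc S1_eq_iff cyc_def) argo
    qed
    then show False using wF u(4) q(2) False by blast
  qed
  then show ?thesis using z u(1) q(1) \<open>q \<noteq> u\<close> unfolding adj_def by blast
qed

lemma adj_prev:
  assumes u: "u \<in> Fix f" "z \<in> S1" "z \<noteq> u" "open_arc z u \<inter> Fix f = {}"
  shows "\<exists>q. adj q u \<and> (z = q \<or> z \<in> open_arc q u)"
proof (cases "z \<in> Fix f")
  case True then show ?thesis using u unfolding adj_def by blast
next
  case False
  obtain q where q: "q \<in> Fix f" "open_arc q z \<inter> Fix f = {}" using closed_prev[OF closed_Fix[OF f] FixD(4) ne u(2) False] by blast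
  have S: "u \<in> S1" "q \<in> S1" using u q FixD by blast+
  have "q \<noteq> u"
  proof
    assume e: "q = u"
    obtain y where "y \<in> Fix f" "y \<noteq> u" by (rule other)
    then show False using arc_cases[OF S(1) u(2) FixD(1)[of y f]] u False q(2) e by blast
  qed
  have "q \<noteq> z" using q False by blast
  then have z: "z \<in> open_arc q u" using arc_linear[OF u(2) S(2,1)] u q \<open>q \<noteq> u\<close> arc_rotate by blast
  have "w \<notin> Fix f" if w: "w \<in> open_arc q u" for w
  proof
    assume wF: "w \<in> Fix f"
    have "w \<in> open_arc q z \<or> w = z \<or> w \<in> open_arc z u"
    proof -
      have "cyc (Arg2pi q) (Arg2pi z) (Arg2pi u)" "cyc (Arg2pi q) (Arg2pi w) (Arg2pi u)" using z w arc_memD by blast+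
      then show ?thesis using S u(2) FixD(1)[OF wF] by (simp only: arc_cyc S1_eq_iff cyc_def) argo
    qed
    then show False using wF u(4) q(2) False by blast
  qed
  then show ?thesis using z u(1) q(1) \<open>q \<noteq> u\<close> unfolding adj_def by blast
qed

lemma adj_exists:
  assumes z: "z \<in> S1" "z \<notin> Fix f"
  obtains u v where "adj u v" "z \<in> open_arc u v"
proof -
  obtain u where u: "u \<in> Fix f" "open_arc u z \<inter> Fix f = {}" using closed_prev[OF closed_Fix[OF f] FixD(4) ne z] by blast
  have "z \<noteq> u" using u z by blast
  then obtain v where "adj u v" "z = v \<or> z \<in> open_arc u v" using adj_next[OF u(1) z(1) _ u(2)] by blast
  then show ?thesis using that adjD(2) z(2) by blast
qed

lemma free_rainbow:
  assumes "free u"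
  shows "rainbow_point L1 u \<or> rainbow_point L2 u"
proof (rule ccontr)
  assume n: "\<not> ?thesis"
  obtain z where z: "u \<in> Fix f" "z \<in> S1" "z \<noteq> u" "open_arc u z \<inter> Fix f = {} \<or> open_arc z u \<inter> Fix f = {}"
    using assms unfolding free_def by blast
  obtain G where G: "crown_with_pivot L1 G u" using not_rainbow_pivot[OF V FixD(1)[OF z(1)]] n by blast
  obtain t where t: "crown_seq L1 G u t" "\<And>k. t k \<in> Fix f" using pivot_cases(2)[OF G z(1)] not_single by blast
  show False using crown_seqD(8)[OF t(1) z(2,3)] crown_seqD(9)[OF t(1) z(2,3)] t(2) z(4) by blast
qed

text \<open>The witness is the union of all intervals around \<open>u\<close> that avoid \<open>y\<close> and \<open>v\<close>, which is invariant.\<close>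

lemma fixed_leaf_around:
  assumes u: "u \<in> Fix f" "rainbow_point L1 u" and yv: "y \<in> Fix f" "v \<in> Fix f" "y \<noteq> v" "y \<noteq> u" "v \<noteq> u"
  obtains a b where "lf L1 a b" "u \<in> open_arc a b" "y \<notin> open_arc a b" "v \<notin> open_arc a b" "a \<in> Fix f" "b \<in> Fix f"
proof -
  define P where "P J \<longleftrightarrow> u \<in> J \<and> y \<notin> J \<and> v \<notin> J" for J
  have S: "u \<in> S1" "y \<in> S1" "v \<in> S1" using u yv FixD(1) by blast+
  have inv: "P (f ` J) \<longleftrightarrow> P J" if J: "J \<in> L1" for J
  proof -
    obtain a b where "lf L1 a b" "J = open_arc a b" using J by (rule lam_arcE[OF lam1])
    then have JS: "J \<subseteq> S1" using arc_sub_S1 by blast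
    have "x \<in> f ` J \<longleftrightarrow> x \<in> J" if x: "x \<in> Fix f" for x
      using inj_on_image_mem_iff[OF oph_inj[OF f] FixD(1)[OF x] JS] FixD(2)[OF x] by simp
    then show ?thesis unfolding P_def using u(1) yv(1,2) by simp
  qed
  obtain a b where ab: "lf L1 a b" "u \<in> open_arc a b" "y \<in> open_arc b a" "v \<in> open_arc b a"
    by (rule rainbow_avoid[OF lam1 u(2) S yv(4,5)])
  have abP: "open_arc a b \<in> {J \<in> L1. P J}" using ab lfD(4)[OF ab(1)] arc_not_dual unfolding P_def by blast
  have U: "\<Union>{J \<in> L1. P J} \<in> L1"
  proof (rule lam_union_pt(1)[OF lam1 _ _ _ S(2,3) yv(3)])
    show "{J \<in> L1. P J} \<noteq> {}" using abP by blast
    show "u \<in> J" if "J \<in> {J \<in> L1. P J}" for J using that unfolding P_def by blast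
    show "y \<notin> \<Union>{J \<in> L1. P J}" "v \<notin> \<Union>{J \<in> L1. P J}" unfolding P_def by blast+
  qed blast
  obtain c d where cd: "lf L1 c d" "\<Union>{J \<in> L1. P J} = open_arc c d" using U by (rule lam_arcE[OF lam1])
  have "f ` open_arc c d = open_arc c d" using invariant_union[of f L1 P, OF f1 inv] cd(2) by simp
  then have "c \<in> Fix f" "d \<in> Fix f" using invariant_arc[OF f cd(1)] by blast+
  moreover have "u \<in> open_arc c d" using abP ab(2) cd(2) by blast
  moreover have "y \<notin> open_arc c d" "v \<notin> open_arc c d" using cd(2)[symmetric] unfolding P_def by blast+
  ultimately show ?thesis using that cd(1) by blast
qed

text \<open>A small leaf \<open>(a, b)\<close> around \<open>u\<close> is chosen with one endpoint
  on the side without fixed points. A further fixed point \<open>y\<close> in it would give, by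
  \<open>fixed_leaf_around\<close>, a leaf around \<open>u\<close> inside \<open>(a, b)\<close> with
  fixed endpoints, one of them on that empty side.\<close>

lemma isolated_fixed:
  assumes u: "free u" "rainbow_point L1 u"
  shows "\<exists>a b. u \<in> open_arc a b \<and> open_arc a b \<inter> Fix f = {u}"
proof -
  obtain z where z: "u \<in> Fix f" "z \<in> S1" "z \<noteq> u" "open_arc u z \<inter> Fix f = {} \<or> open_arc z u \<inter> Fix f = {}"
    using u(1) unfolding free_def by blast
  obtain v where v: "v \<in> Fix f" "v \<noteq> u" by (rule other)
  have S: "u \<in> S1" "v \<in> S1" using z v FixD(1) by blast+
  have "\<exists>a b. lf L1 a b \<and> u \<in> open_arc a b \<and> v \<in> open_arc b a \<and> (a \<in> open_arc z u \<and> open_arc z u \<inter> Fix f = {} \<or>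
      b \<in> open_arc u z \<and> open_arc u z \<inter> Fix f = {})"
    using z(4)
  proof
    assume e: "open_arc u z \<inter> Fix f = {}"
    obtain a b where ab: "a \<in> S1" "b \<in> S1" "a \<noteq> b" "open_arc a b \<in> L1" "u \<in> open_arc a b" "a \<in> open_arc v u" "b \<in> open_arc u z"
      using rainbow_small[OF u(2) lam_good[OF lam1] S(2) z(2) v(2) z(3) S(1)] by blast
    have "v \<notin> open_arc u z" using e v by blast
    moreover have "cyc (Arg2pi v) (Arg2pi a) (Arg2pi u)" "cyc (Arg2pi u) (Arg2pi b) (Arg2pi z)" "cyc (Arg2pi a) (Arg2pi u) (Arg2pi b)"
      using ab arc_memD by blast+
    ultimately have "v \<in> open_arc b a" using ab(1,2) S z(2) v(2) by (simp only: arc_cyc cyc_def S1_eq_iff) argo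
    then show ?thesis using ab e unfolding lf_def by blast
  next
    assume e: "open_arc z u \<inter> Fix f = {}"
    obtain a b where ab: "a \<in> S1" "b \<in> S1" "a \<noteq> b" "open_arc a b \<in> L1" "u \<in> open_arc a b" "a \<in> open_arc z u" "b \<in> open_arc u v"
      using rainbow_small[OF u(2) lam_good[OF lam1] z(2) S(2) z(3) v(2) S(1)] by blast
    have "v \<notin> open_arc z u" using e v by blast
    moreover have "cyc (Arg2pi z) (Arg2pi a) (Arg2pi u)" "cyc (Arg2pi u) (Arg2pi b) (Arg2pi v)" "cyc (Arg2pi a) (Arg2pi u) (Arg2pi b)"
      using ab arc_memD by blast+
    ultimately have "v \<in> open_arc b a" using ab(1,2) S z(2) v(2) by (simp only: arc_cyc cyc_def S1_eq_iff) argo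
    then show ?thesis using ab e unfolding lf_def by blast
  qed
  then obtain a b where ab: "lf L1 a b" "u \<in> open_arc a b" "v \<in> open_arc b a"
    "a \<in> open_arc z u \<and> open_arc z u \<inter> Fix f = {} \<or> b \<in> open_arc u z \<and> open_arc u z \<inter> Fix f = {}" by blast
  have "y = u" if y: "y \<in> open_arc a b" "y \<in> Fix f" for y
  proof (rule ccontr)
    assume "y \<noteq> u"
    have "y \<noteq> v" using y(1) ab(3) arc_not_dual by blast
    obtain c d where cd: "lf L1 c d" "u \<in> open_arc c d" "y \<notin> open_arc c d" "v \<notin> open_arc c d" "c \<in> Fix f" "d \<in> Fix f"
      by (rule fixed_leaf_around[OF z(1) u(2) y(2) v(1) \<open>y \<noteq> v\<close> \<open>y \<noteq> u\<close> v(2)])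
    have "open_arc c d \<subseteq> open_arc a b"
      using lf_nested[OF lam1 ab(1) cd(1)] ab(2,3) cd(2-4) y(1) by blast
    then have "a \<notin> open_arc c d" "b \<notin> open_arc c d" using arc_ends by blast+
    then have "c = a \<or> c \<in> open_arc a u" "d = b \<or> d \<in> open_arc u b"
      using arc_avoid_left[OF cd(2)] arc_avoid_right[OF cd(2)] lfD(1,2)[OF ab(1)] by blast+
    then have "a \<in> open_arc z u \<Longrightarrow> c \<in> open_arc z u" "b \<in> open_arc u z \<Longrightarrow> d \<in> open_arc u z"
      using arc_right_trans arc_left_trans_eq by blast+
    then show False using ab(4) cd(5,6) by blast
  qed
  then show ?thesis using ab(2) z(1) by blast
qed

lemma free_isolated:
  assumes u: "free u"
  shows "\<exists>a b. u \<in> open_arc a b \<and> open_arc a b \<inter> Fix f = {u}"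
proof (cases "rainbow_point L1 u")
  case True
  then show ?thesis by (rule isolated_fixed[OF u])
next
  case False
  then have r: "rainbow_point L2 u" using free_rainbow[OF u] by blast
  have "fixed_aut.free f u" using u .
  then show ?thesis by (rule multi_fixed_aut.isolated_fixed[OF flip_multi _ r])
qed

lemma free_neighbours:
  assumes u: "free u"
  obtains p q where "adj p u" "adj u q"
proof -
  obtain a b where ab: "u \<in> open_arc a b" "open_arc a b \<inter> Fix f = {u}" using free_isolated[OF u] by blast
  have uF: "u \<in> Fix f" using ab(2) by blast
  have S: "a \<in> S1" "b \<in> S1" "a \<noteq> u" "b \<noteq> u" using ab(1) arc_sub_S1 arc_ends by blast+
  have "open_arc u b \<subseteq> open_arc a b" using arc_right_trans[OF ab(1)] by blast
  then have "open_arc u b \<inter> Fix f \<subseteq> {u}" unfolding ab(2)[symmetric] by blast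
  then have "open_arc u b \<inter> Fix f = {}" using arc_ends(1)[of u b] by blast
  then obtain q where "adj u q" using adj_next[OF uF S(2,4)] by blast
  moreover have "open_arc a u \<subseteq> open_arc a b" using arc_left_trans[OF _ ab(1)] by blast
  then have "open_arc a u \<inter> Fix f \<subseteq> {u}" unfolding ab(2)[symmetric] by blast
  then have "open_arc a u \<inter> Fix f = {}" using arc_ends(2)[of u a] by blast
  then obtain p where "adj p u" using adj_prev[OF uF S(1,3)] by blast
  ultimately show ?thesis using that by blast
qed

end

section \<open>Attracting and repelling fixed points, and leaves across them\<close>

context multi_fixed_aut
begin

text \<open>One witness on each side suffices, since by \<open>direction_constant\<close> all points
  of a complementary arc of \<open>Fix f\<close> move the same way.\<close>

definition att :: "complex \<Rightarrow> bool" where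
  "att u \<longleftrightarrow> (\<exists>p q a b. adj p u \<and> adj u q \<and> a \<in> open_arc p u \<and> b \<in> open_arc u q \<and>
     f a \<in> open_arc a u \<and> f b \<in> open_arc u b)"

definition rep :: "complex \<Rightarrow> bool" where
  "rep u \<longleftrightarrow> (\<exists>p q a b. adj p u \<and> adj u q \<and> a \<in> open_arc p u \<and> b \<in> open_arc u q \<and>
     a \<in> open_arc (f a) u \<and> b \<in> open_arc u (f b))"

lemma adj_arc:
  assumes pq: "adj p u" "adj u q" and ab: "a \<in> open_arc p u" "b \<in> open_arc u q"
  shows "u \<in> open_arc a b" "p \<in> open_arc b a" "q \<in> open_arc b a" "a \<noteq> b"
    "w \<in> open_arc a b \<Longrightarrow> w \<in> open_arc p u \<or> w = u \<or> w \<in> open_arc u q"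
proof -
  have S: "a \<in> S1" "b \<in> S1" "u \<in> S1" "p \<in> S1" "q \<in> S1" using ab arc_sub_S1 by blast+
  have n: "q \<notin> open_arc p u" "p \<notin> open_arc u q" using adjD(1,4)[OF pq(1)] adjD(2,4)[OF pq(2)] by blast+
  have d: "p \<noteq> u" "u \<noteq> q" "a \<noteq> q" "b \<noteq> p" "a \<noteq> u" using adjD(3) pq n ab arc_ends by blast+
  have "q \<notin> open_arc a u" using arc_right_trans[OF ab(1)] n(1) by blast
  then have uq: "u \<in> open_arc a q" using arc_linear[OF S(3,5,1)] d by blast
  show u: "u \<in> open_arc a b" by (rule arc_between_left[OF uq ab(2)])
  then show "a \<noteq> b" by auto
  show "q \<in> open_arc b a" using arc_right_trans[OF uq] ab(2) arc_rotate by blast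
  have "b \<notin> open_arc p u" using arc_rotate[of b p u] arc_rotate[of u b p] arc_left_trans[OF _ ab(2)] n(2) by blast
  then have "u \<in> open_arc p b" using arc_linear[OF S(3,2,4)] d ab(2) arc_ends by blast
  then show "p \<in> open_arc b a" using arc_left_trans[OF ab(1)] arc_rotate by blast
  show "w \<in> open_arc p u \<or> w = u \<or> w \<in> open_arc u q" if w: "w \<in> open_arc a b"
    using arc_split[OF u w] arc_right_trans[OF ab(1)] arc_left_trans[OF _ ab(2)] by blast
qed

lemma adj_across:
  assumes pq: "adj p u" "adj u q" "p \<noteq> q"
  shows "open_arc p q \<inter> Fix f = {u}"
proof -
  have S: "u \<in> S1" "p \<in> S1" "q \<in> S1" using adjD(6)[OF pq(1)] adjD(5)[OF pq(1)] adjD(6)[OF pq(2)] .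
  have n: "q \<notin> open_arc p u" "p \<notin> open_arc u q" using adjD(1,4)[OF pq(1)] adjD(2,4)[OF pq(2)] by blast+
  have d: "p \<noteq> u" "u \<noteq> q" using adjD(3) pq by blast+
  have u: "u \<in> open_arc p q" using arc_linear[OF S(1,3,2)] n d pq(3) by blast
  moreover have "w = u" if w: "w \<in> open_arc p q" "w \<in> Fix f" for w
    using arc_split[OF u w(1)] w(2) adjD(4)[OF pq(1)] adjD(4)[OF pq(2)] by blast
  ultimately show ?thesis using adjD(1)[OF pq(2)] by blast
qed

lemma adj_image:
  assumes "adj u v" "z \<in> open_arc u v"
  shows "f z \<in> open_arc u v" "f z \<noteq> z"
proof -
  show "f z \<in> open_arc u v" using oph_arc_mono[OF f assms(2)] adjD(7,8)[OF assms(1)] by simp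
  show "f z \<noteq> z" using adjD(4)[OF assms(1)] assms(2) FixD(3)[of z f] arc_sub_S1(1)[OF assms(2)] by blast
qed

lemma rainbow_dynamics:
  assumes u: "free u" "rainbow_point L1 u"
  shows "att u \<or> rep u"
proof -
  obtain p q where pq: "adj p u" "adj u q" by (rule free_neighbours[OF u(1)])
  have S: "u \<in> S1" "p \<in> S1" "q \<in> S1" using adjD(6)[OF pq(1)] adjD(5)[OF pq(1)] adjD(6)[OF pq(2)] .
  obtain a b where ab': "a \<in> S1" "b \<in> S1" "a \<noteq> b" "open_arc a b \<in> L1" "u \<in> open_arc a b" "a \<in> open_arc p u" "b \<in> open_arc u q"
    using rainbow_small[OF u(2) lam_good[OF lam1] S(2,3) adjD(3)[OF pq(1)] adjD(3)[OF pq(2), symmetric] S(1)] by blast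
  then have ab: "lf L1 a b" "a \<in> open_arc p u" "b \<in> open_arc u q" unfolding lf_def by blast+
  note fa = adj_image[OF pq(1) ab(2)] and fb = adj_image[OF pq(2) ab(3)]
  note lf' = aut_lf[OF f f1 ab(1)]
  note o = adj_arc[OF pq ab(2,3)] and o' = adj_arc[OF pq fa(1) fb(1)]
  \<comment> \<open>Both intervals contain \<open>u\<close> and omit \<open>p\<close>, so they are
    neither disjoint nor covering.\<close>
  consider "open_arc a b \<subseteq> open_arc (f a) (f b)" | "open_arc (f a) (f b) \<subseteq> open_arc a b"
    using lf_nested[OF lam1 ab(1) lf'] o(1,2) o'(1,2) arc_not_dual[OF o'(2)] by blast
  then show ?thesis
  proof cases
    case 1
    then have "f a \<notin> open_arc a b" "f b \<notin> open_arc a b" using arc_ends by blast+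
    then have "a \<in> open_arc (f a) u" "b \<in> open_arc u (f b)"
      using arc_avoid_left[OF o(1), of "f a"] arc_avoid_right[OF o(1), of "f b"] fa(2) fb(2) lfD(1,2)[OF lf'] by force+
    then show ?thesis using pq ab(2,3) unfolding rep_def by blast
  next
    case 2
    then have "a \<notin> open_arc (f a) (f b)" "b \<notin> open_arc (f a) (f b)" using arc_ends by blast+
    then have "f a \<in> open_arc a u" "f b \<in> open_arc u b"
      using arc_avoid_left[OF o'(1), of a] arc_avoid_right[OF o'(1), of b] fa(2) fb(2) lfD(1,2)[OF ab(1)] by blast+
    then show ?thesis using pq ab(2,3) unfolding att_def by blast
  qed
qed

lemma att_or_rep:
  assumes u: "free u"
  shows "att u \<or> rep u"
proof (cases "rainbow_point L1 u")
  case True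
  then show ?thesis by (rule rainbow_dynamics[OF u])
next
  case False
  then have r: "rainbow_point L2 u" using free_rainbow[OF u] by blast
  show ?thesis by (rule multi_fixed_aut.rainbow_dynamics[OF flip_multi u r])
qed

text \<open>If both ends attracted, or both repelled, their witnesses in the common arc would move
  in opposite directions, contrary to \<open>direction_constant\<close>.\<close>

lemma adj_opposite:
  assumes uq: "adj u q"
  shows "\<not> (att u \<and> att q)" "\<not> (rep u \<and> rep q)"
proof -
  note dc = direction_constant[OF f adjD(5-8)[OF uq] adjD(4)[OF uq]]
  show "\<not> (att u \<and> att q)"
  proof
    assume "att u \<and> att q"
    then obtain q' b p' a where b: "adj u q'" "b \<in> open_arc u q'" "f b \<in> open_arc u b"
      and a: "adj p' q" "a \<in> open_arc p' q" "f a \<in> open_arc a q" unfolding att_def by blast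
    have "q' = q" "p' = u" using adj_unique_right[OF b(1) uq] adj_unique_left[OF a(1) uq] .
    then show False using dc[of b a] a b by blast
  qed
  show "\<not> (rep u \<and> rep q)"
  proof
    assume "rep u \<and> rep q"
    then obtain q' b p' a where b: "adj u q'" "b \<in> open_arc u q'" "b \<in> open_arc u (f b)"
      and a: "adj p' q" "a \<in> open_arc p' q" "a \<in> open_arc (f a) q" unfolding rep_def by blast
    have e: "q' = q" "p' = u" using adj_unique_right[OF b(1) uq] adj_unique_left[OF a(1) uq] .
    have S: "u \<in> S1" "q \<in> S1" "a \<in> S1" "b \<in> S1" using adjD(5,6)[OF uq] a(2) b(2) arc_sub_S1 by blast+
    have m: "f a \<in> open_arc u q" "f b \<in> open_arc u q" using adj_image[OF uq] a(2) b(2) e by blast+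
    have c: "cyc (Arg2pi u) (Arg2pi (f a)) (Arg2pi q)" "cyc (Arg2pi u) (Arg2pi (f b)) (Arg2pi q)"
      "cyc (Arg2pi u) (Arg2pi b) (Arg2pi (f b))" "cyc (Arg2pi (f a)) (Arg2pi a) (Arg2pi q)"
      using m a(3) b(3) arc_memD by blast+
    have "f b \<in> open_arc b q" "f a \<in> open_arc u a"
      using c S oph_S1[OF f S(3)] oph_S1[OF f S(4)] by (simp_all only: arc_cyc cyc_def) argo+
    then show False using dc[of a b] a b e by blast
  qed
qed

lemma att_attracting:
  assumes "att u"
  shows "attracting f u"
proof -
  obtain p q a b where h: "adj p u" "adj u q" "a \<in> open_arc p u" "b \<in> open_arc u q" "f a \<in> open_arc a u" "f b \<in> open_arc u b"
    using assms unfolding att_def by blast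
  note o = adj_arc[OF h(1-4)]
  have S: "a \<in> S1" "b \<in> S1" using h(3,4) arc_sub_S1 by blast+
  have fab: "f a \<noteq> f b" using oph_eq[OF f S] o(4) by blast
  have fS: "f a \<in> S1" "f b \<in> S1" using oph_S1[OF f] S by blast+
  have uF: "u \<in> Fix f" by (rule adjD(1)[OF h(2)])
  have I: "open_arc a b \<inter> Fix f = {u}" using o(1,5) adjD(4)[OF h(1)] adjD(4)[OF h(2)] uF by blast
  have au: "open_arc a u \<subseteq> open_arc a b" "open_arc u b \<subseteq> open_arc a b"
    using arc_left_trans[OF _ o(1)] arc_right_trans[OF o(1)] by blast+
  have cl: "f ` closure (open_arc a b) = closure (open_arc (f a) (f b))"
    unfolding closure_arc[OF S o(4)] closure_arc[OF fS fab] using oph_image_arc[OF f S] by simp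
  have fo: "f a \<in> open_arc a b" "f b \<in> open_arc a b" "f b \<in> open_arc (f a) b"
    using arc_left_trans[OF h(5) o(1)] arc_right_trans[OF o(1)] arc_right_trans[OF arc_between[OF h(5) o(1)]] h(6) by blast+
  have faI: "f a \<in> open_arc a (f b)" by (rule arc_between_left[OF fo(1,3)])
  \<comment> \<open>Witness for the strictness of the inclusion: a point between \<open>a\<close>
    and \<open>f a\<close> is left out of the closed image.\<close>
  obtain w where w: "w \<in> open_arc a (f a)" using arc_nonempty[OF S(1) fS(1)] h(5) arc_ends(1) by metis
  have sub: "open_arc (f a) (f b) \<subseteq> open_arc a b"
    using arc_left_trans[OF arc_right_trans[OF faI] fo(2)] by blast
  have "w \<in> open_arc a b" "w \<notin> closure (open_arc (f a) (f b))"
  proof -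
    show "w \<in> open_arc a b" by (rule arc_left_trans[OF w fo(1)])
    have "w \<in> open_arc a (f b)" by (rule arc_left_trans[OF w faI])
    moreover have "w \<in> open_arc (f b) (f a)"
      using arc_between[OF w faI] arc_rotate[of "f a" w "f b"] arc_rotate[of "f b" "f a" w] by blast
    ultimately have "w \<notin> open_arc (f a) (f b)" "w \<noteq> f a" "w \<noteq> f b"
      using arc_not_dual w arc_ends by blast+
    then show "w \<notin> closure (open_arc (f a) (f b))" unfolding closure_arc[OF fS fab] by blast
  qed
  moreover have "closure (open_arc (f a) (f b)) \<subseteq> open_arc a b"
    unfolding closure_arc[OF fS fab] using sub h(5,6) au by blast
  ultimately have "f ` closure (open_arc a b) \<subset> open_arc a b" unfolding cl by blast
  then show ?thesis unfolding attracting_def using I uF good_interval_arc[OF S o(4)] by blast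
qed

lemma rep_repelling:
  assumes "rep u"
  shows "repelling f u"
proof -
  obtain p q a b where h: "adj p u" "adj u q" "a \<in> open_arc p u" "b \<in> open_arc u q" "a \<in> open_arc (f a) u" "b \<in> open_arc u (f b)"
    using assms unfolding rep_def by blast
  note o = adj_arc[OF h(1-4)]
  have S: "a \<in> S1" "b \<in> S1" using h(3,4) arc_sub_S1 by blast+
  have fab: "f a \<noteq> f b" using oph_eq[OF f S] o(4) by blast
  have fS: "f a \<in> S1" "f b \<in> S1" using oph_S1[OF f] S by blast+
  have uF: "u \<in> Fix f" by (rule adjD(1)[OF h(2)])
  have I: "open_arc a b \<inter> Fix f = {u}" using o(1,5) adjD(4)[OF h(1)] adjD(4)[OF h(2)] uF by blast
  have cl: "f ` closure (open_arc a b) = closure (open_arc (f a) (f b))"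
    unfolding closure_arc[OF S o(4)] closure_arc[OF fS fab] using oph_image_arc[OF f S] by simp
  have m: "f a \<in> open_arc p u" "f b \<in> open_arc u q" using adj_image(1)[OF h(1,3)] adj_image(1)[OF h(2,4)] .
  have c: "cyc (Arg2pi (f a)) (Arg2pi a) (Arg2pi u)" "cyc (Arg2pi u) (Arg2pi b) (Arg2pi (f b))" 
    "cyc (Arg2pi (f a)) (Arg2pi u) (Arg2pi (f b))"
    using h(5,6) adj_arc(1)[OF h(1,2) m] arc_memD by blast+
  have sub: "open_arc a b \<subseteq> open_arc (f a) (f b)"
  proof
    fix z assume z: "z \<in> open_arc a b"
    then have "z \<in> S1" "cyc (Arg2pi a) (Arg2pi z) (Arg2pi b)" using arc_sub_S1 arc_memD by blast+
    then show "z \<in> open_arc (f a) (f b)" using c fS by (simp only: arc_cyc cyc_def) argo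
  qed
  then have "f a \<notin> open_arc a b" using arc_ends by blast
  then have "open_arc a b \<subset> f ` closure (open_arc a b)"
    unfolding cl closure_arc[OF fS fab] using sub by blast
  then show ?thesis unfolding repelling_def using I uF good_interval_arc[OF S o(4)] by blast
qed

text \<open>The invariant union of the leaves around \<open>u\<close> inside \<open>(p, q)\<close> has fixed endpoints, hence fills \<open>(p, q)\<close>.\<close>

lemma leaf_across:
  assumes pq: "adj p u" "adj u q" "p \<noteq> q" and r: "rainbow_point L1 u"
  shows "lf L1 p q" "\<not> isolated_interval L1 (open_arc p q)"
proof -
  have S: "u \<in> S1" "p \<in> S1" "q \<in> S1" using adjD(6)[OF pq(1)] adjD(5)[OF pq(1)] adjD(6)[OF pq(2)] .
  define P where "P J \<longleftrightarrow> (\<exists>a b. J = open_arc a b \<and> lf L1 a b \<and> a \<in> open_arc p u \<and> b \<in> open_arc u q)" for J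
  define FF where "FF = {J \<in> L1. P J}"
  have inv: "P (f ` J) \<longleftrightarrow> P J" if J: "J \<in> L1" for J
  proof -
    obtain c d where cd: "lf L1 c d" "J = open_arc c d" using J by (rule lam_arcE[OF lam1])
    note s = lfD(1-3)[OF cd(1)] and l' = aut_lf[OF f f1 cd(1)]
    have im: "f ` J = open_arc (f c) (f d)" unfolding cd(2) by (rule oph_image_arc[OF f s(1,2)])
    have i: "f c \<in> open_arc p u \<longleftrightarrow> c \<in> open_arc p u" "f d \<in> open_arc u q \<longleftrightarrow> d \<in> open_arc u q"
      using oph_arc_iff[OF f S(2) s(1) S(1)] oph_arc_iff[OF f S(1) s(2) S(3)] adjD(7,8)[OF pq(1)] adjD(8)[OF pq(2)] by simp_all
    show ?thesis
    proof
      assume "P (f ` J)"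
      then obtain a b where ab: "open_arc (f c) (f d) = open_arc a b" "lf L1 a b" "a \<in> open_arc p u" "b \<in> open_arc u q"
        unfolding P_def im by blast
      have "f c = a \<and> f d = b" by (rule lf_inj[OF l' ab(2,1)])
      then show "P J" unfolding P_def cd(2) using ab(3,4) i cd(1) by blast
    next
      assume "P J"
      then obtain a b where ab: "open_arc c d = open_arc a b" "lf L1 a b" "a \<in> open_arc p u" "b \<in> open_arc u q"
        unfolding P_def cd(2) by blast
      have "c = a \<and> d = b" by (rule lf_inj[OF cd(1) ab(2,1)])
      then show "P (f ` J)" unfolding P_def im using ab(3,4) i l' by blast
    qed
  qed
  obtain a b where "a \<in> S1" "b \<in> S1" "a \<noteq> b" "open_arc a b \<in> L1" "u \<in> open_arc a b" "a \<in> open_arc p u" "b \<in> open_arc u q"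
    using rainbow_small[OF r lam_good[OF lam1] S(2,3) adjD(3)[OF pq(1)] adjD(3)[OF pq(2), symmetric] S(1)] by blast
  then have "open_arc a b \<in> FF" unfolding FF_def P_def lf_def by blast
  then have ne: "FF \<noteq> {}" by blast
  have FL: "FF \<subseteq> L1" unfolding FF_def by blast
  have mem: "u \<in> J \<and> p \<notin> J \<and> q \<notin> J" if "J \<in> FF" for J
    using that adj_arc(1-3)[OF pq(1,2)] arc_not_dual unfolding FF_def P_def by blast
  then have av: "p \<notin> \<Union>FF" "q \<notin> \<Union>FF" by blast+
  have U: "\<Union>FF \<in> L1" and ch: "\<And>J K. J \<in> FF \<Longrightarrow> K \<in> FF \<Longrightarrow> J \<subseteq> K \<or> K \<subseteq> J"
    using lam_union_pt[OF lam1 FL ne _ S(2,3) pq(3) av, of u] mem by blast+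
  obtain c d where cd: "lf L1 c d" "\<Union>FF = open_arc c d" using U by (rule lam_arcE[OF lam1])
  have "f ` open_arc c d = open_arc c d" using invariant_union[of f L1 P, OF f1 inv] cd(2) unfolding FF_def by simp
  then have F: "c \<in> Fix f" "d \<in> Fix f" using invariant_arc[OF f cd(1)] by blast+
  have ucd: "u \<in> open_arc c d" using ne mem cd(2) by blast
  \<comment> \<open>A fixed endpoint of the union cannot lie in the arc \<open>(p, u)\<close>, which
    has no fixed points; so it has to be \<open>p\<close>.\<close>
  have "c = p" using arc_avoid_left[OF ucd S(2)] av(1) cd(2) F(1) adjD(4)[OF pq(1)] by blast
  moreover have "d = q" using arc_avoid_right[OF ucd S(3)] av(2) cd(2) F(2) adjD(4)[OF pq(2)] by blast
  ultimately have l: "lf L1 p q" and Upq: "\<Union>FF = open_arc p q" using cd by simp_all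
  show "lf L1 p q" by (rule l)
  have o: "openin (top_of_set S1) J" if J: "J \<in> FF" for J
  proof -
    have JL: "J \<in> L1" using J FL by blast
    obtain x y where "lf L1 x y" "J = open_arc x y" using JL by (rule lam_arcE[OF lam1])
    then show ?thesis using arc_openin lfD(1-3) by metis
  qed
  from chain_seq[OF ne o ch] obtain I :: "nat \<Rightarrow> complex set"
    where II: "range I \<subseteq> FF \<and> incseq I \<and> (\<Union>k. I k) = \<Union>FF" by (rule exE)
  then have I: "I k \<in> FF" "incseq I" "(\<Union>k. I k) = open_arc p q" for k using Upq by auto
  \<comment> \<open>The endpoints of each \<open>I k\<close> lie strictly between neighbouring fixed
    points, so these leaves differ from that of \<open>(p, q)\<close> while increasing to it. This
    is the convergence that refutes isolation.\<close>
  have lk: "leaf (I k) \<in> leaves L1 \<and> leaf (I k) \<noteq> leaf (open_arc p q) \<and> lies_on (leaf (I k)) (open_arc p q)" for k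
  proof -
    obtain a b where ab: "I k = open_arc a b" "lf L1 a b" "a \<in> open_arc p u" "b \<in> open_arc u q"
      using I(1)[of k] unfolding FF_def P_def by blast
    have sub: "I k \<subseteq> open_arc p q" using I(3) by blast
    have "a \<notin> Fix f" using ab(3) adjD(4)[OF pq(1)] by blast
    then have "a \<noteq> p" "a \<noteq> q" using adjD(1)[OF pq(1)] adjD(2)[OF pq(2)] by blast+
    then have "open_arc a b \<noteq> open_arc p q" "open_arc a b \<noteq> open_arc q p"
      using lf_inj[OF ab(2) l] lf_inj[OF ab(2) lf_sym[OF lam1 l]] by blast+
    then have "leaf (I k) \<noteq> leaf (open_arc p q)" unfolding ab(1) leaf_lf[OF ab(2)] leaf_lf[OF l] by blast
    moreover have "leaf (I k) \<in> leaves L1" unfolding leaves_def ab(1) by (rule imageI[OF lfD(4)[OF ab(2)]])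
    ultimately show ?thesis using sub unfolding lies_on_def ab(1) leaf_lf[OF ab(2)] by blast
  qed
  have "open_arc p q \<subseteq> liminf I"
  proof
    fix x assume "x \<in> open_arc p q"
    then obtain n where n: "x \<in> I n" using I(3) by blast
    then have "x \<in> I m" if "m \<ge> n" for m using incseqD[OF I(2) that] by blast
    then show "x \<in> liminf I" unfolding liminf_SUP_INF by auto
  qed
  moreover have "liminf I \<subseteq> limsup I" by (rule Liminf_le_Limsup) simp
  moreover have "limsup I \<subseteq> closure (open_arc p q)"
  proof -
    have "limsup I \<subseteq> (\<Union>k. I k)" unfolding limsup_INF_SUP by auto
    then show ?thesis unfolding I(3) using closure_subset by blast
  qed
  moreover have "I k \<in> L1" for k using I(1) FL by blast
  ultimately have "leaves_converge L1 (\<lambda>k. leaf (I k)) (open_arc p q)"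
    unfolding leaves_converge_def by (intro exI[where x = I]) simp
  then have "\<exists>l. (\<forall>k. l k \<in> leaves L1 \<and> l k \<noteq> leaf (open_arc p q) \<and> lies_on (l k) (open_arc p q)) \<and>
      leaves_converge L1 l (open_arc p q)"
    using lk by (intro exI[where x = "\<lambda>k. leaf (I k)"]) simp
  then show "\<not> isolated_interval L1 (open_arc p q)" unfolding isolated_interval_def by simp
qed

end

section \<open>At least three fixed points\<close>

locale many_fixed_aut = multi_fixed_aut +
  assumes three: "\<exists>x\<in>Fix f. \<exists>y\<in>Fix f. \<exists>z\<in>Fix f. x \<noteq> y \<and> y \<noteq> z \<and> x \<noteq> z"
begin

lemma flip_many: "many_fixed_aut L2 L1 f"
  by (intro many_fixed_aut.intro flip_multi many_fixed_aut_axioms.intro three)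

text \<open>With equal neighbours, the two empty arcs and their ends would exhaust the circle and
  leave only two fixed points. The third one makes \<open>open_arc p q\<close> a genuine
  arc.\<close>

lemma adj_ends_neq:
  assumes "adj p u" "adj u q"
  shows "p \<noteq> q"
proof
  assume e: "p = q"
  have "w = u \<or> w = p" if w: "w \<in> Fix f" for w
    using arc_cases[OF adjD(5,6)[OF assms(1)] FixD(1)[OF w] adjD(3)[OF assms(1)]] w
      adjD(4)[OF assms(1)] adjD(4)[OF assms(2)] unfolding e by blast
  then show False using three by metis
qed

text \<open>Only meaningful at fixed points with a neighbour on the respective side (\<open>free\<close> suffices).\<close>

definition nx :: "complex \<Rightarrow> complex" where "nx u = (THE q. adj u q)"
definition pr :: "complex \<Rightarrow> complex" where "pr u = (THE p. adj p u)"

lemma nx_eq: "adj u q \<Longrightarrow> nx u = q"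
  unfolding nx_def using adj_unique_right by (intro the_equality) blast+

lemma pr_eq: "adj p u \<Longrightarrow> pr u = p"
  unfolding pr_def using adj_unique_left by (intro the_equality) blast+

lemma nx_adj: "free u \<Longrightarrow> adj u (nx u)"
  using nx_eq free_neighbours by metis

lemma pr_adj: "free u \<Longrightarrow> adj (pr u) u"
  using pr_eq free_neighbours by metis

lemma pr_nx: "free u \<Longrightarrow> pr (nx u) = u"
  using pr_eq nx_adj by blast

lemma nx_pr: "free u \<Longrightarrow> nx (pr u) = u"
  using nx_eq pr_adj by blast

lemma free_nx: "free u \<Longrightarrow> free (nx u)" and free_pr: "free u \<Longrightarrow> free (pr u)"
  using adj_free nx_adj pr_adj by blast+

lemma free_Fix: "free u \<Longrightarrow> u \<in> Fix f"
  unfolding free_def by blast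

lemma pr_nx_arc:
  assumes u: "free u"
  shows "open_arc (pr u) (nx u) \<inter> Fix f = {u}"
  using adj_across[OF pr_adj[OF u] nx_adj[OF u] adj_ends_neq[OF pr_adj[OF u] nx_adj[OF u]]] .

lemma pr_nx_mem: "free u \<Longrightarrow> u \<in> open_arc (pr u) (nx u)"
  using pr_nx_arc[of u] by auto

lemma pr_nx_only: "free u \<Longrightarrow> z \<in> open_arc (pr u) (nx u) \<Longrightarrow> z \<in> Fix f \<Longrightarrow> z = u"
  using pr_nx_arc[of u] by auto

lemma rainbow_leaf_across:
  assumes u: "free u" "rainbow_point L1 u"
  shows "lf L1 (pr u) (nx u)" "\<not> isolated_interval L1 (open_arc (pr u) (nx u))"
  using leaf_across[OF pr_adj[OF u(1)] nx_adj[OF u(1)] adj_ends_neq[OF pr_adj[OF u(1)] nx_adj[OF u(1)]] u(2)] .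

text \<open>The leaf across \<open>u\<close> ends at \<open>nx u\<close>, which is then a rainbow
  point of \<open>L2\<close>; the leaf of \<open>L2\<close> across \<open>nx u\<close> in turn ends
  at \<open>u\<close>. This converse of \<open>endpoint_rainbow\<close> produces the alternation of
  the two systems.\<close>

lemma endpoint_iff_rainbow:
  assumes u: "free u"
  shows "u \<in> endpoints L2 \<longleftrightarrow> rainbow_point L1 u"
proof
  assume r: "rainbow_point L1 u"
  have "nx u \<in> endpoints L1"
    using lf_sym[OF lam1 rainbow_leaf_across(1)[OF u r]] endpoints_iff[OF lam1] by blast
  then have "rainbow_point L2 (nx u)" using endpoint_rainbow[OF veering_sym[OF V]] by blast
  then have "lf L2 (pr (nx u)) (nx (nx u))" by (rule many_fixed_aut.rainbow_leaf_across(1)[OF flip_many free_nx[OF u]])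
  then show "u \<in> endpoints L2" using endpoints_iff[OF veeringD(4)[OF V]] pr_nx[OF u] by auto
qed (rule endpoint_rainbow[OF V])

lemma free_endpoint:
  assumes u: "free u"
  shows "u \<in> endpoints L1 \<or> u \<in> endpoints L2"
  using free_rainbow[OF u] endpoint_iff_rainbow[OF u] many_fixed_aut.endpoint_iff_rainbow[OF flip_many u] by blast

lemma disjoint_endpoints: "u \<in> endpoints L1 \<Longrightarrow> u \<notin> endpoints L2"
  using veeringD(7)[OF V] by blast

lemma leaf_at_free:
  assumes u: "free u" "u \<in> endpoints L2"
  shows "lf L1 (pr u) (nx u)" "\<not> isolated_interval L1 (open_arc (pr u) (nx u))"
    "nx u \<in> endpoints L1" "pr u \<in> endpoints L1"
proof -
  have r: "rainbow_point L1 u" using endpoint_rainbow[OF V u(2)] .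
  show l: "lf L1 (pr u) (nx u)" by (rule rainbow_leaf_across(1)[OF u(1) r])
  show "\<not> isolated_interval L1 (open_arc (pr u) (nx u))" by (rule rainbow_leaf_across(2)[OF u(1) r])
  show "nx u \<in> endpoints L1" "pr u \<in> endpoints L1"
    using l lf_sym[OF lam1 l] endpoints_iff[OF lam1] by blast+
qed

lemma neighbour_endpoints:
  assumes u: "free u" "u \<in> endpoints L1"
  shows "nx u \<in> endpoints L2" "pr u \<in> endpoints L2"
  using many_fixed_aut.leaf_at_free(3,4)[OF flip_many u] .

text \<open>The leaves across the two neighbours of \<open>u\<close> both end at \<open>u\<close>.
  If they differ, \<open>at_most_two_leaves\<close> shows that no others do.\<close>

lemma leaves_at_free:
  assumes u: "free u" "u \<in> endpoints L1"
  shows "lf L1 u (nx (nx u))" "lf L1 u (pr (pr u))"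
proof -
  have "lf L1 (pr (nx u)) (nx (nx u))" by (rule leaf_at_free(1)[OF free_nx[OF u(1)] neighbour_endpoints(1)[OF u]])
  then show "lf L1 u (nx (nx u))" using pr_nx[OF u(1)] by simp
  have "lf L1 (pr (pr u)) (nx (pr u))" by (rule leaf_at_free(1)[OF free_pr[OF u(1)] neighbour_endpoints(2)[OF u]])
  then show "lf L1 u (pr (pr u))" using nx_pr[OF u(1)] lf_sym[OF lam1] by simp
qed

end

text \<open>\<open>X\<close> is closed under both neighbours but need not be a single orbit of
  \<open>nx\<close>. This leaves room to define it by the dynamics at its points, which settles the
  type of all tips at once.\<close>

locale fixed_chain = many_fixed_aut +
  fixes X :: "complex set"
  assumes X: "X \<noteq> {}" "\<And>u. u \<in> X \<Longrightarrow> free u" "\<And>u. u \<in> X \<Longrightarrow> nx u \<in> X" "\<And>u. u \<in> X \<Longrightarrow> pr u \<in> X"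
begin

lemma flip_chain: "fixed_chain L2 L1 f X"
  by (intro fixed_chain.intro flip_many fixed_chain_axioms.intro X)

definition cover :: "complex set" where "cover = (\<Union>u\<in>X. open_arc (pr u) (nx u))"

text \<open>Arcs across every second fixed point only: those centred at endpoints of
  \<open>L2\<close> are intervals of \<open>L1\<close>, with ends among the endpoints of
  \<open>L1\<close>.\<close>

definition chain_arcs :: "complex set set" where
  "chain_arcs = {open_arc (pr u) (nx u) |u. u \<in> X \<and> u \<in> endpoints L2}"

lemma chain_subset_Fix: "X \<subseteq> Fix f"
  using X(2) free_Fix by blast

lemma chain_subset_cover: "X \<subseteq> cover"
  using pr_nx_mem[OF X(2)] unfolding cover_def by blast

lemma Fix_cover: "z \<in> Fix f \<Longrightarrow> z \<in> cover \<Longrightarrow> z \<in> X"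
  using pr_nx_only[OF X(2)] unfolding cover_def by blast

lemma cover_sub: "u \<in> X \<Longrightarrow> open_arc (pr u) (nx u) \<subseteq> cover"
  unfolding cover_def by blast

lemma chain_arcsI: "u \<in> X \<Longrightarrow> u \<in> endpoints L2 \<Longrightarrow> open_arc (pr u) (nx u) \<in> chain_arcs"
  unfolding chain_arcs_def by blast

lemma chain_arcsE:
  assumes "I \<in> chain_arcs"
  obtains u where "u \<in> X" "u \<in> endpoints L2" "I = open_arc (pr u) (nx u)" "lf L1 (pr u) (nx u)"
    "\<not> isolated_interval L1 I" "u \<in> I" "\<forall>z\<in>I. z \<in> Fix f \<longrightarrow> z = u" "pr u \<in> X" "nx u \<in> X"
proof -
  obtain u where u: "u \<in> X" "u \<in> endpoints L2" "I = open_arc (pr u) (nx u)" using assms unfolding chain_arcs_def by blast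
  note fr = X(2)[OF u(1)]
  show ?thesis
    by (rule that[OF u leaf_at_free(1)[OF fr u(2)] _ _ _ X(4,3)[OF u(1)]])
      (use leaf_at_free(2)[OF fr u(2)] pr_nx_mem[OF fr] pr_nx_only[OF fr] u(3) in blast)+
qed

text \<open>An arc centred at an endpoint of \<open>L1\<close> is cut at its centre; each half lies
  in the arc of \<open>chain_arcs\<close> centred at the neighbour on that side.\<close>

lemma cover_cases:
  assumes z: "z \<in> cover"
  shows "z \<in> \<Union>chain_arcs \<or> z \<in> X \<and> z \<in> endpoints L1"
proof -
  obtain u where u: "u \<in> X" "z \<in> open_arc (pr u) (nx u)" using z unfolding cover_def by blast
  note fr = X(2)[OF u(1)]
  show ?thesis
  proof (cases "u \<in> endpoints L2")
    case True
    then show ?thesis using chain_arcsI u by blast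
  next
    case False
    then have u1: "u \<in> endpoints L1" using free_endpoint[OF fr] by blast
    have S: "u \<in> S1" using chain_subset_Fix u(1) FixD(1) by blast
    have "z = u \<or> z \<in> open_arc (pr u) u \<or> z \<in> open_arc u (nx u)" using arc_split[OF pr_nx_mem[OF fr] u(2)] by blast
    then show ?thesis
    proof (elim disjE)
      assume "z \<in> open_arc (pr u) u"
      moreover have "open_arc (pr (pr u)) u \<in> chain_arcs"
        using chain_arcsI[OF X(4)[OF u(1)] neighbour_endpoints(2)[OF fr u1]] nx_pr[OF fr] by simp
      moreover have "pr u \<in> open_arc (pr (pr u)) u" using pr_nx_mem[OF X(2)[OF X(4)[OF u(1)]]] nx_pr[OF fr] by simp
      ultimately show ?thesis using arc_right_trans by blast
    next
      assume "z \<in> open_arc u (nx u)"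
      moreover have "open_arc u (nx (nx u)) \<in> chain_arcs"
        using chain_arcsI[OF X(3)[OF u(1)] neighbour_endpoints(1)[OF fr u1]] pr_nx[OF fr] by simp
      moreover have "nx u \<in> open_arc u (nx (nx u))" using pr_nx_mem[OF X(2)[OF X(3)[OF u(1)]]] pr_nx[OF fr] by simp
      ultimately show ?thesis using arc_left_trans by blast
    qed (use u u1 in blast)
  qed
qed

lemma chain_arcs_avoid:
  assumes "z \<in> X" "z \<in> endpoints L1"
  shows "z \<notin> \<Union>chain_arcs"
proof
  assume "z \<in> \<Union>chain_arcs"
  then obtain I where I: "I \<in> chain_arcs" "z \<in> I" by blast
  obtain u where u: "u \<in> endpoints L2" "\<forall>z\<in>I. z \<in> Fix f \<longrightarrow> z = u" using I(1) by (rule chain_arcsE)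
  have "z = u" using u(2) I(2) assms(1) chain_subset_Fix by blast
  then show False using u(1) assms(2) disjoint_endpoints by blast
qed

lemma chain_arcs_leaf_inside:
  assumes I: "I \<in> chain_arcs" "x \<in> I" and l: "lf L1 x y"
  shows "open_arc x y \<subseteq> I \<or> open_arc y x \<subseteq> I"
proof -
  obtain u where u: "I = open_arc (pr u) (nx u)" "lf L1 (pr u) (nx u)" using I(1) by (rule chain_arcsE)
  have x: "x \<in> open_arc (pr u) (nx u)" using I(2) u(1) by blast
  have n: "y \<notin> open_arc (nx u) (pr u)" using lf_unlinked[OF lam1 u(2) l x] by blast
  have m: "x \<notin> open_arc (nx u) (pr u)" using x arc_not_dual by blast
  have "x \<noteq> nx u" "x \<noteq> pr u" using x arc_ends by blast+
  then have "\<not> open_arc x y \<subseteq> open_arc (nx u) (pr u)" "\<not> open_arc y x \<subseteq> open_arc (nx u) (pr u)"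
    using lf_subset_iff[OF l lf_sym[OF lam1 u(2)]] lf_subset_iff[OF lf_sym[OF lam1 l] lf_sym[OF lam1 u(2)]] n m by blast+
  then show ?thesis using lf_cases[OF lam1 l u(2)] u(1) by blast
qed

text \<open>A leaf with an endpoint inside an arc of the family has a side inside that arc, by
  unlinkedness. A leaf with both endpoints outside joins points of \<open>X\<close>; as at most two
  leaves end at such a point, it joins second neighbours and so bounds an arc of the family.\<close>

lemma chain_arcs_gap:
  assumes all: "S1 \<subseteq> cover"
  shows "gap L1 chain_arcs" "vertices chain_arcs = X \<inter> endpoints L1"
proof -
  show "vertices chain_arcs = X \<inter> endpoints L1"
    using cover_cases all chain_arcs_avoid chain_subset_Fix FixD(4)[of f] unfolding vertices_def by blast
  show "gap L1 chain_arcs"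
    unfolding gap_def
  proof (intro conjI ballI)
    show "chain_arcs \<subseteq> L1" by (auto elim!: chain_arcsE dest: lfD(4))
    have sub: "I \<subseteq> J" if IJ: "I \<in> chain_arcs" "J \<in> chain_arcs" "z \<in> I" "z \<in> J" for I J z
    proof -
      obtain u where u: "u \<in> endpoints L2" "I = open_arc (pr u) (nx u)" "lf L1 (pr u) (nx u)" "pr u \<in> X" "u \<in> I" "u \<in> X"
        using IJ(1) by (rule chain_arcsE)
      obtain v where v: "v \<in> endpoints L2" "J = open_arc (pr v) (nx v)" "lf L1 (pr v) (nx v)" "pr v \<in> X" "v \<in> J" "v \<in> X"
        using IJ(2) by (rule chain_arcsE)
      have "pr u \<in> endpoints L1" "pr v \<in> endpoints L1"
        using u(3) v(3) endpoints_iff[OF lam1] by blast+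
      then have n: "pr u \<notin> J" "pr v \<notin> I"
        using chain_arcs_avoid[OF u(4)] chain_arcs_avoid[OF v(4)] IJ by blast+
      have z: "z \<in> open_arc (pr u) (nx u)" "z \<in> open_arc (pr v) (nx v)" using IJ u v by blast+
      have "pr u = pr v"
        using arc_avoid_left[OF z(1), of "pr v"] arc_avoid_left[OF z(2), of "pr u"] n lfD(1)[OF u(3)] lfD(1)[OF v(3)]
          u(2) v(2) arc_left_trans z by blast
      then have "u = v" using nx_pr[OF X(2)[OF u(6)]] nx_pr[OF X(2)[OF v(6)]] by metis
      then show ?thesis using u v by blast
    qed
    show "disjoint chain_arcs" unfolding disjoint_def using sub by blast
    fix l assume "l \<in> leaves L1"
    then obtain I where I: "I \<in> L1" "l = leaf I" unfolding leaves_def by blast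
    obtain x y where x: "lf L1 x y" "I = open_arc x y" using I(1) by (rule lam_arcE[OF lam1])
    have "\<exists>M\<in>chain_arcs. open_arc x y \<subseteq> M \<or> open_arc y x \<subseteq> M"
    proof (cases "x \<in> \<Union>chain_arcs \<or> y \<in> \<Union>chain_arcs")
      case True
      then show ?thesis using chain_arcs_leaf_inside[OF _ _ x(1)] chain_arcs_leaf_inside[OF _ _ lf_sym[OF lam1 x(1)]] by blast
    next
      case False
      have xy: "x \<in> X" "x \<in> endpoints L1" "y \<in> X" "y \<in> endpoints L1"
        using False cover_cases[of x] cover_cases[of y] all lfD(1,2)[OF x(1)] by blast+
      note fr = X(2)[OF xy(1)]
      have "y = nx (nx x) \<or> y = pr (pr x)"
      proof (cases "nx (nx x) = pr (pr x)")
        case False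
        then show ?thesis using at_most_two_leaves[OF V x(1) leaves_at_free[OF fr xy(2)]] by blast
      next
        \<comment> \<open>The two known leaves at \<open>x\<close> coincide here, and counting
          leaves says nothing. But then there are only four fixed points, and the endpoint class of
          \<open>y\<close> leaves the one opposite to \<open>x\<close>.\<close>
        case True
        have A: "open_arc x (nx (nx x)) \<inter> Fix f = {nx x}"
          using pr_nx_arc[OF free_nx[OF fr]] pr_nx[OF fr] by simp
        have B: "open_arc (nx (nx x)) x \<inter> Fix f = {pr x}"
          using pr_nx_arc[OF free_pr[OF fr]] nx_pr[OF fr] True by simp
        have "y \<noteq> nx x" "y \<noteq> pr x" using neighbour_endpoints[OF fr xy(2)] xy(4) disjoint_endpoints by blast+
        moreover have "y \<in> Fix f" using xy(3) chain_subset_Fix by blast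
        ultimately have "y \<notin> open_arc x (nx (nx x))" "y \<notin> open_arc (nx (nx x)) x" using A B by (metis IntI singletonD)+
        then show ?thesis
          using arc_cases[OF lfD(1,2)[OF leaves_at_free(1)[OF fr xy(2)]] lfD(2)[OF x(1)] lfD(3)[OF leaves_at_free(1)[OF fr xy(2)]]]
            lfD(3)[OF x(1)] by blast
      qed
      then show ?thesis
      proof
        assume "y = nx (nx x)"
        then have "open_arc x y \<in> chain_arcs" using chain_arcsI[OF X(3)[OF xy(1)] neighbour_endpoints(1)[OF fr xy(2)]] pr_nx[OF fr] by simp
        then show ?thesis by blast
      next
        assume "y = pr (pr x)"
        then have "open_arc y x \<in> chain_arcs" using chain_arcsI[OF X(4)[OF xy(1)] neighbour_endpoints(2)[OF fr xy(2)]] nx_pr[OF fr] by simp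
        then show ?thesis by blast
      qed
    qed
    then show "\<exists>M\<in>chain_arcs. lies_on l M" unfolding I(2) x(2) lies_on_def leaf_lf[OF x(1)] by blast
  qed
qed

lemma nx_before:
  assumes w: "w \<in> S1" "w \<notin> cover" and u: "u \<in> X" "c \<in> open_arc (pr u) (nx u)"
  shows "nx u \<in> open_arc c w"
proof -
  have "w \<notin> open_arc (pr u) (nx u)" using w(2) cover_sub[OF u(1)] by blast
  moreover have "nx u \<noteq> w" using chain_subset_cover X(3)[OF u(1)] w(2) by blast
  ultimately show ?thesis using arc_avoid_right[OF u(2) w(1)] by blast
qed

text \<open>A leaf around \<open>w\<close> would have an endpoint \<open>a\<close> in the covered
  arc before \<open>w\<close>. If \<open>a\<close> is inside an arc of the family, the leaf is
  linked with that arc. If \<open>a\<close> belongs to \<open>X\<close>, the leaves to its two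
  second neighbours end before \<open>w\<close>, and the given one is a third leaf at
  \<open>a\<close>.\<close>

lemma boundary_not_rainbow:
  assumes w: "w \<in> S1" "w \<notin> cover" and u0: "u0 \<in> X" "open_arc u0 w \<subseteq> cover"
  shows "\<not> rainbow_point L1 w"
proof
  assume r: "rainbow_point L1 w"
  have S: "u0 \<in> S1" "nx u0 \<in> S1" using u0(1) X(3) chain_subset_Fix FixD(1) by blast+
  have ne: "u0 \<noteq> w" "nx u0 \<noteq> w" using u0(1) X(3) chain_subset_cover w(2) by blast+
  have nx0: "nx u0 \<in> open_arc u0 w" using nx_before[OF w u0(1) pr_nx_mem[OF X(2)[OF u0(1)]]] .
  \<comment> \<open>Bounding \<open>a\<close> by \<open>nx u0\<close> instead of \<open>u0\<close>
    leaves room for two steps backwards from \<open>a\<close> without passing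
    \<open>u0\<close>.\<close>
  obtain a b where ab: "lf L1 a b" "w \<in> open_arc a b" "a \<in> open_arc (nx u0) w" "b \<in> open_arc w u0"
    using rainbow_small[OF r lam_good[OF lam1] S(2,1) ne(2,1) w(1)] unfolding lf_def by blast
  have aS: "a \<in> S1" "b \<in> S1" using lfD[OF ab(1)] by blast+
  have a0: "a \<in> open_arc u0 w" using arc_right_trans[OF nx0] ab(3) by blast
  have aO: "a \<in> cover" using a0 u0(2) by blast
  have aE: "a \<in> endpoints L1" using ab(1) endpoints_iff[OF lam1] by blast
  have ane: "a \<noteq> u0" "a \<noteq> nx u0" "b \<noteq> u0" using a0 ab(3,4) arc_ends by blast+
  from cover_cases[OF aO] show False
  proof
    assume "a \<in> \<Union>chain_arcs"
    then obtain I where I: "I \<in> chain_arcs" "a \<in> I" by blast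
    obtain u where u: "u \<in> X" "I = open_arc (pr u) (nx u)" "lf L1 (pr u) (nx u)" "\<forall>z\<in>I. z \<in> Fix f \<longrightarrow> z = u" using I(1) by (rule chain_arcsE)
    have aI: "a \<in> open_arc (pr u) (nx u)" using I(2) u(2) by blast
    have wI: "w \<notin> open_arc (pr u) (nx u)" using w(2) cover_sub[OF u(1)] by blast
    have "u \<noteq> u0"
    proof
      assume "u = u0"
      then have "cyc (Arg2pi (pr u0)) (Arg2pi a) (Arg2pi (nx u0))" "cyc (Arg2pi (nx u0)) (Arg2pi a) (Arg2pi w)"
        "\<not> cyc (Arg2pi (pr u0)) (Arg2pi w) (Arg2pi (nx u0))"
        using aI wI ab(3) arc_memD arc_cyc[OF lfD(1,2)[OF u(3)] w(1)] by blast+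
      then show False unfolding cyc_def by argo
    qed
    then have "u0 \<notin> open_arc (pr u) (nx u)" using u(2,4) u0(1) chain_subset_Fix by blast
    then have p: "pr u = u0 \<or> pr u \<in> open_arc u0 a" using arc_avoid_left[OF aI S(1)] by blast
    have n: "nx u \<in> open_arc a w" by (rule nx_before[OF w u(1) aI])
    have "nx u \<in> open_arc a b" by (rule arc_left_trans[OF n ab(2)])
    moreover have "u0 \<in> open_arc b w" using ab(4) arc_rotate by blast
    then have "u0 \<in> open_arc b a" using arc_between_left a0 by blast
    then have "pr u \<in> open_arc b a" using p arc_right_trans by blast
    ultimately show False using lf_unlinked[OF lam1 ab(1) lf_sym[OF lam1 u(3)]] by blast
  next
    assume aX: "a \<in> X \<and> a \<in> endpoints L1"
    then have fa: "free a" using X(2) by blast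
    have F: "u0 \<in> Fix f" using u0(1) chain_subset_Fix by blast
    have sub: "\<And>u. u \<in> X \<Longrightarrow> u \<noteq> u0 \<Longrightarrow> pr u = u0 \<or> pr u \<in> open_arc u0 u"
    proof -
      fix u assume u: "u \<in> X" "u \<noteq> u0"
      have "u \<in> open_arc (pr u) (nx u)" "u0 \<notin> open_arc (pr u) (nx u)"
        using pr_nx_mem[OF X(2)[OF u(1)]] pr_nx_only[OF X(2)[OF u(1)]] F u(2) by blast+
      then show "pr u = u0 \<or> pr u \<in> open_arc u0 u" using arc_avoid_left S(1) by blast
    qed
    have "pr a \<noteq> u0" using nx_pr[OF fa] ane(2) by metis
    then have p1: "pr a \<in> open_arc u0 a" using sub[of a] aX ane by blast
    have "pr a \<in> X" using X(4) aX by blast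
    then have p2: "pr (pr a) = u0 \<or> pr (pr a) \<in> open_arc u0 a"
      using sub[of "pr a"] \<open>pr a \<noteq> u0\<close> p1 arc_left_trans by blast
    have nw: "nx u \<in> open_arc u w" if "u \<in> X" for u
      using nx_before[OF w that pr_nx_mem[OF X(2)[OF that]]] .
    have "nx (nx a) \<in> open_arc (nx a) w" "nx a \<in> open_arc a w" using nw aX X(3) by blast+
    then have n2: "nx (nx a) \<in> open_arc a w" using arc_right_trans by blast
    have "b \<notin> open_arc u0 w" using ab(4) arc_not_dual by blast
    moreover have "open_arc a w \<subseteq> open_arc u0 w" "open_arc u0 a \<subseteq> open_arc u0 w"
      using arc_right_trans[OF a0] arc_left_trans[OF _ a0] by blast+
    ultimately have "b \<noteq> nx (nx a)" "b \<noteq> pr (pr a)" using n2 p2 ane(3) by blast+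
    moreover have "nx (nx a) \<noteq> pr (pr a)"
    proof
      assume "nx (nx a) = pr (pr a)"
      then have "Arg2pi (nx (nx a)) = Arg2pi u0 \<or> cyc (Arg2pi u0) (Arg2pi (nx (nx a))) (Arg2pi a)"
        "cyc (Arg2pi a) (Arg2pi (nx (nx a))) (Arg2pi w)" "cyc (Arg2pi u0) (Arg2pi a) (Arg2pi w)"
        using p2 n2 a0 arc_memD by auto
      then show False unfolding cyc_def by argo
    qed
    ultimately show False using at_most_two_leaves[OF V ab(1) leaves_at_free[OF fa]] aX by blast
  qed
qed

text \<open>The cover is open, so there is a first uncovered point \<open>w\<close> after
  \<open>u0\<close>. Were it not fixed, the last fixed point before it would be covered, and the
  right end of the covering arc would be a later fixed point still before \<open>w\<close>.\<close>

lemma boundary_point: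
  assumes "\<not> S1 \<subseteq> cover"
  obtains u0 w where "w \<in> Fix f" "w \<notin> cover" "u0 \<in> X" "open_arc u0 w \<subseteq> cover"
proof -
  obtain u0 where u0: "u0 \<in> X" using X(1) by blast
  then have uS: "u0 \<in> S1" "u0 \<in> cover" using chain_subset_Fix FixD(1) chain_subset_cover by blast+
  have "openin (top_of_set S1) cover" unfolding cover_def
  proof (intro openin_Union ballI)
    fix T assume "T \<in> (\<lambda>u. open_arc (pr u) (nx u)) ` X"
    then obtain u where u: "u \<in> X" "T = open_arc (pr u) (nx u)" by blast
    note a = pr_adj[OF X(2)[OF u(1)]] nx_adj[OF X(2)[OF u(1)]]
    show "openin (top_of_set S1) T" unfolding u(2)
      using adjD(5)[OF a(1)] adjD(6)[OF a(2)] adj_ends_neq[OF a] by (rule arc_openin)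
  qed
  then have "closedin (top_of_set S1) (S1 - cover)" by (simp add: openin_closedin_eq)
  then have cl: "closed (S1 - cover)" using closedin_closed_trans[of S1 "S1 - cover"] by auto
  obtain w where w: "w \<in> S1 - cover" "open_arc u0 w \<inter> (S1 - cover) = {}"
    using closed_next[OF cl _ _ uS(1)] assms by blast
  then have wS: "w \<in> S1" "w \<notin> cover" "open_arc u0 w \<subseteq> cover" using arc_sub_S1(1) by blast+
  have "w \<in> Fix f"
  proof (rule ccontr)
    assume n: "w \<notin> Fix f"
    obtain p where p: "p \<in> Fix f" "open_arc p w \<inter> Fix f = {}"
      using closed_prev[OF closed_Fix[OF f] FixD(4) ne wS(1) n] by blast
    have "u0 \<in> Fix f" using u0 chain_subset_Fix by blast
    then have "u0 \<notin> open_arc p w" using p(2) by blast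
    moreover have "p \<noteq> w" "u0 \<noteq> w" using p n \<open>u0 \<in> Fix f\<close> by blast+
    ultimately have "p = u0 \<or> p \<in> open_arc u0 w"
      using arc_linear[of p u0 w] FixD(1)[OF p(1)] uS(1) wS(1) arc_rotate by blast
    then have "p \<in> cover" using uS(2) wS(3) by blast
    then obtain u where u: "u \<in> X" "p \<in> open_arc (pr u) (nx u)" unfolding cover_def by blast
    have "nx u \<in> open_arc p w" by (rule nx_before[OF wS(1,2) u])
    moreover have "nx u \<in> Fix f" using X(3)[OF u(1)] chain_subset_Fix by blast
    ultimately show False using p(2) by blast
  qed
  then show ?thesis using that wS u0 by blast
qed

text \<open>Tips accumulate at \<open>w\<close> through the covered side, so one of them is in
  \<open>X\<close>. At a tip in \<open>X\<close> the two crown leaves must be the two leaves to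
  second neighbours. This carries membership from tip to tip and identifies the elements of the
  crown with arcs of the chain.\<close>

lemma crown_structure:
  assumes w: "w \<in> Fix f" "w \<notin> cover" "u0 \<in> X" "open_arc u0 w \<subseteq> cover"
    and C: "crown_with_pivot L1 C w"
  shows "C \<subseteq> chain_arcs" "vertices C = (X \<inter> endpoints L1) \<union> {w}" "Fix f = X \<union> {w}"
proof -
  have wS: "w \<in> S1" using FixD(1)[OF w(1)] .
  obtain t where t: "crown_seq L1 C w t" "\<And>k. t k \<in> Fix f" using pivot_cases(2)[OF C w(1)] not_single by blast
  note t' = crown_seqD[OF t(1)]
  have tE: "t k \<in> endpoints L1" for k using t'(3) endpoints_iff[OF lam1] by blast
  have w0: "u0 \<noteq> w" using w(2,3) chain_subset_cover by blast
  have u0S: "u0 \<in> S1" using w(3) chain_subset_Fix FixD(1) by blast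
  obtain k0 where "t k0 \<in> open_arc u0 w" using t'(8)[OF u0S w0] by blast
  then have k0: "t k0 \<in> X" using Fix_cover[OF t(2)] w(4) by blast
  have tm: "t k \<in> open_arc w (t (k + 1))" for k using t'(7)[of k "k + 1"] by simp
  have step: "t (k + 1) = nx (nx (t k)) \<and> t (k - 1) = pr (pr (t k))" if k: "t k \<in> X" for k
  proof -
    note fr = X(2)[OF k]
    have O: "open_arc (t k) (nx (nx (t k))) \<subseteq> cover" "open_arc (pr (pr (t k))) (t k) \<subseteq> cover"
      using cover_sub[OF X(3)[OF k]] cover_sub[OF X(4)[OF k]] pr_nx[OF fr] nx_pr[OF fr] by simp_all
    have l: "lf L1 (t k) (t (k + 1))" "lf L1 (t k) (t (k - 1))"
      using t'(3)[of k] lf_sym[OF lam1 t'(3)[of "k - 1"]] by simp_all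
    have a: "t (k - 1) \<in> open_arc w (t k)" "t k \<in> open_arc w (t (k + 1))" "t (k - 1) \<in> open_arc w (t (k + 1))"
      using tm[of "k - 1"] tm[of k] t'(7)[of "k - 1" "k + 1"] by simp_all
    have d: "t (k + 1) \<noteq> t (k - 1)" using a(3) arc_ends by metis
    have wa: "w \<in> open_arc (t k) (t (k - 1))" "w \<in> open_arc (t (k + 1)) (t k)"
      using a arc_rotate by blast+
    \<comment> \<open>The opposite matching of the two pairs of leaves would put the uncovered
      \<open>w\<close> inside a covered arc.\<close>
    have "nx (nx (t k)) \<noteq> t (k - 1)"
    proof
      assume "nx (nx (t k)) = t (k - 1)"
      then show False using O(1) wa(1) w(2) by auto
    qed
    moreover have "pr (pr (t k)) \<noteq> t (k + 1)"
    proof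
      assume "pr (pr (t k)) = t (k + 1)"
      then show False using O(2) wa(2) w(2) by auto
    qed
    ultimately show ?thesis
      using at_most_two_leaves[OF V l leaves_at_free(1)[OF fr tE]] at_most_two_leaves[OF V l leaves_at_free(2)[OF fr tE]] d by metis
  qed
  have tX: "t k \<in> X" for k
  proof (induction k rule: int_induct[of _ k0])
    case base then show ?case by (rule k0)
  next
    case (step1 i) then show ?case using step[OF step1(2)] X(3) by metis
  next
    case (step2 i) then show ?case using step[OF step2(2)] X(4) by metis
  qed
  have tn: "t (k + 1) = nx (nx (t k))" for k using step[OF tX] by blast
  have arcs: "open_arc (t k) (t (k + 1)) = open_arc (pr (nx (t k))) (nx (nx (t k)))" for k
    using tn pr_nx[OF X(2)[OF tX]] by simp
  have e2: "nx (t k) \<in> endpoints L2" "nx (t k) \<in> X" for k using neighbour_endpoints(1)[OF X(2)[OF tX] tE] X(3)[OF tX] .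
  show CG: "C \<subseteq> chain_arcs" unfolding t'(4) using arcs chain_arcsI[OF e2(2,1)] by auto
  show FX: "Fix f = X \<union> {w}"
  proof
    show "X \<union> {w} \<subseteq> Fix f" using chain_subset_Fix w(1) by blast
    show "Fix f \<subseteq> X \<union> {w}"
    proof
      fix z assume z: "z \<in> Fix f"
      show "z \<in> X \<union> {w}"
      proof (cases "z \<in> vertices C")
        case True
        then show ?thesis using tX unfolding t'(5) by blast
      next
        case False
        then obtain I where I: "I \<in> C" "z \<in> I" using FixD(1)[OF z] unfolding vertices_def by blast
        then have "I \<in> chain_arcs" using CG by blast
        then obtain u where "u \<in> X" "\<forall>z\<in>I. z \<in> Fix f \<longrightarrow> z = u" by (rule chain_arcsE)
        then show ?thesis using z I(2) by blast
      qed
    qed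
  qed
  show "vertices C = (X \<inter> endpoints L1) \<union> {w}"
  proof
    show "vertices C \<subseteq> (X \<inter> endpoints L1) \<union> {w}" unfolding t'(5) using tX tE by blast
    have "z \<in> vertices C" if "z \<in> X" "z \<in> endpoints L1" for z
      using chain_arcs_avoid[OF that] CG that(1) chain_subset_Fix FixD(1) unfolding vertices_def by blast
    moreover have "w \<in> vertices C" unfolding t'(5) by blast
    ultimately show "(X \<inter> endpoints L1) \<union> {w} \<subseteq> vertices C" by blast
  qed
qed

text \<open>\<open>W\<close> treats uniformly a chain that closes up and a chain that accumulates at
  a pivot.\<close>

lemma chain_gaps:
  obtains G H W where "gap L1 G" "gap L2 H" "G \<subseteq> chain_arcs" "H \<subseteq> fixed_chain.chain_arcs L1 f X"
    "vertices G = (X \<inter> endpoints L1) \<union> W" "vertices H = (X \<inter> endpoints L2) \<union> W" "Fix f = X \<union> W"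
    "W = {} \<or> (\<exists>w. W = {w} \<and> crown_with_pivot L1 G w \<and> crown_with_pivot L2 H w)"
proof (cases "S1 \<subseteq> cover")
  case True
  have O2: "S1 \<subseteq> fixed_chain.cover f X" using True .
  have "Fix f = X \<union> {}" using Fix_cover True FixD(4)[of f] chain_subset_Fix by blast
  then show ?thesis
    using that[of chain_arcs "fixed_chain.chain_arcs L1 f X" "{}"] chain_arcs_gap[OF True] fixed_chain.chain_arcs_gap[OF flip_chain O2] by simp
next
  case False
  obtain u0 w where w: "w \<in> Fix f" "w \<notin> cover" "u0 \<in> X" "open_arc u0 w \<subseteq> cover" by (rule boundary_point[OF False])
  note wS = FixD(1)[OF w(1)]
  obtain C D where CD: "crown_with_pivot L1 C w" "crown_with_pivot L2 D w"
    using not_rainbow_pivot[OF V wS boundary_not_rainbow[OF wS w(2-4)] fixed_chain.boundary_not_rainbow[OF flip_chain wS w(2-4)]] by blast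
  note c = crown_structure[OF w CD(1)] and d = fixed_chain.crown_structure[OF flip_chain w CD(2)]
  have g: "gap L1 C" "gap L2 D" using CD unfolding crown_with_pivot_def by blast+
  show ?thesis
    by (rule that[OF g c(1) d(1) c(2) d(2) c(3)]) (use CD in blast)
qed

end

text \<open>Every neighbourhood of the pivot contains tips of the crown. Hence \<open>tips\<close>
  leaves the pivot out, and attraction or repulsion has to be checked at points of the chain
  only.\<close>

lemma pivot_not_isolated:
  assumes L: "lamination_system L" and C: "crown_with_pivot L G p"
  shows "\<not> p isolated_in vertices G"
proof
  assume "p isolated_in vertices G"
  then obtain T where T: "open T" "T \<inter> vertices G = {p}" unfolding isolated_in_def by blast
  obtain t where t: "crown_seq L G p t" using crownE[OF L C] .
  note t' = crown_seqD[OF t]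
  have tv: "t k \<in> vertices G" "t k \<noteq> p" for k using t'(5,6) by auto
  have only: "z = p" if "z \<in> T" "z \<in> vertices G" for z using that T(2) by (metis IntI singletonD)
  have pT: "p \<in> T" using T(2) by (metis IntD1 singletonI)
  have cl: "closed (S1 - T)" using T(1) by (intro closed_Diff) auto
  have "t 0 \<in> S1 - T" using only[of "t 0"] tv[of 0] lfD(1)[OF t'(3)[of 0]] by blast
  then obtain c where c: "c \<in> S1 - T" "open_arc c p \<inter> (S1 - T) = {}"
    using closed_prev[OF cl _ _ t'(2)] pT by blast
  obtain k where k: "t k \<in> open_arc c p" using t'(8)[of c] c(1) pT by blast
  then have "t k \<in> T" using c(2) arc_sub_S1(1) by blast
  then show False using only tv by blast
qed

section \<open>Preserved interleaving pairs from chains\<close>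

context fixed_chain
begin

lemma chain_arcs_fixed:
  assumes "I \<in> chain_arcs"
  shows "f ` I = I"
proof -
  obtain u where u: "I = open_arc (pr u) (nx u)" "pr u \<in> X" "nx u \<in> X" using assms by (rule chain_arcsE)
  have F: "pr u \<in> Fix f" "nx u \<in> Fix f" using u(2,3) chain_subset_Fix by blast+
  show ?thesis unfolding u(1) oph_image_arc[OF f FixD(1)[OF F(1)] FixD(1)[OF F(2)]] FixD(2)[OF F(1)] FixD(2)[OF F(2)] ..
qed

lemma chain_arcs_preserved:
  assumes "G \<subseteq> chain_arcs"
  shows "preserves f G"
proof -
  have "(\<lambda>I. f ` I) ` G = (\<lambda>I. I) ` G" using chain_arcs_fixed assms by (intro image_cong) auto
  then show ?thesis unfolding preserves_def by simp
qed

lemma chain_arcs_interleave: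
  assumes "G \<subseteq> chain_arcs" "vertices H = (X \<inter> endpoints L2) \<union> W" "W \<subseteq> Fix f" "I \<in> G"
  shows "is_singleton (I \<inter> vertices H)"
proof -
  have "I \<in> chain_arcs" using assms(1,4) by blast
  then obtain u where u: "u \<in> X" "u \<in> endpoints L2" "u \<in> I" "\<forall>z\<in>I. z \<in> Fix f \<longrightarrow> z = u" by (rule chain_arcsE)
  have "I \<inter> vertices H = {u}" unfolding assms(2) using u assms(3) chain_subset_Fix by blast
  then show ?thesis by (simp add: is_singleton_def)
qed

lemma chain_arcs_real:
  assumes "gap L1 G" "G \<subseteq> chain_arcs"
  shows "real_gap L1 G"
  unfolding real_gap_def using assms chain_arcsE by blast

text \<open>The two inclusions for \<open>W\<close> describe it without the chain, as the set of
  fixed points that are endpoints of neither system. This makes the vertex sets visibly invariant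
  under automorphisms that commute with \<open>f\<close>.\<close>

lemma chain_pair:
  obtains G H W where "preserved_interleaving_pair L1 L2 f G H" "real_gap L1 G" "real_gap L2 H"
    "vertices G \<union> vertices H = Fix f" "tips G \<subseteq> X \<inter> endpoints L1" "tips H \<subseteq> X \<inter> endpoints L2"
    "vertices G = (Fix f \<inter> endpoints L1) \<union> W" "vertices H = (Fix f \<inter> endpoints L2) \<union> W"
    "W \<subseteq> Fix f - endpoints L1 - endpoints L2" "Fix f - endpoints L1 - endpoints L2 \<subseteq> W" "W = {} \<or> (\<exists>w. W = {w})"
proof -
  obtain G H W where g: "gap L1 G" "gap L2 H" "G \<subseteq> chain_arcs" "H \<subseteq> fixed_chain.chain_arcs L1 f X"
    "vertices G = (X \<inter> endpoints L1) \<union> W" "vertices H = (X \<inter> endpoints L2) \<union> W" "Fix f = X \<union> W"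
    "W = {} \<or> (\<exists>w. W = {w} \<and> crown_with_pivot L1 G w \<and> crown_with_pivot L2 H w)"
    by (rule chain_gaps)
  have lam2: "lamination_system L2" by (rule veeringD(4)[OF V])
  have WF: "W \<subseteq> Fix f" using g(7) by blast
  have XE: "X \<subseteq> endpoints L1 \<union> endpoints L2" using free_endpoint X(2) by blast
  have We: "z \<notin> endpoints L1 \<and> z \<notin> endpoints L2 \<and> \<not> z isolated_in vertices G \<and> \<not> z isolated_in vertices H" if z: "z \<in> W" for z
  proof -
    obtain w where w: "W = {w}" "crown_with_pivot L1 G w" "crown_with_pivot L2 H w" using g(8) z by blast
    have "z = w" using z w(1) by simp
    then show ?thesis using pivot_not_endpoint[OF lam1 w(2)] pivot_not_endpoint[OF lam2 w(3)]
        pivot_not_isolated[OF lam1 w(2)] pivot_not_isolated[OF lam2 w(3)] by simp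
  qed
  have i: "interleave G H" unfolding interleave_def
    using chain_arcs_interleave[OF g(3,6) WF] fixed_chain.chain_arcs_interleave[OF flip_chain g(4,5) WF] by blast
  have "preserved_interleaving_pair L1 L2 f G H"
    unfolding preserved_interleaving_pair_def interleaving_pair_def
    using g(1,2) i chain_arcs_preserved[OF g(3)] fixed_chain.chain_arcs_preserved[OF flip_chain g(4)] by blast
  moreover have "real_gap L1 G" "real_gap L2 H" using chain_arcs_real[OF g(1,3)] fixed_chain.chain_arcs_real[OF flip_chain g(2,4)] .
  moreover have "vertices G \<union> vertices H = Fix f" unfolding g(5-7) using XE by blast
  moreover have "tips G \<subseteq> X \<inter> endpoints L1" "tips H \<subseteq> X \<inter> endpoints L2"
  proof -
    have "z \<in> vertices G" if "z isolated_in vertices G" for z G using that unfolding isolated_in_def by blast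
    then show "tips G \<subseteq> X \<inter> endpoints L1" "tips H \<subseteq> X \<inter> endpoints L2"
      unfolding tips_def using We g(5,6) by blast+
  qed
  moreover have "vertices G = (Fix f \<inter> endpoints L1) \<union> W" "vertices H = (Fix f \<inter> endpoints L2) \<union> W"
    unfolding g(5-7) using We by blast+
  moreover have "W \<subseteq> Fix f - endpoints L1 - endpoints L2" using WF We by blast
  moreover have "Fix f - endpoints L1 - endpoints L2 \<subseteq> W" using XE g(7) by blast
  moreover have "W = {} \<or> (\<exists>w. W = {w})" using g(8) by blast
  ultimately show ?thesis by (rule that)
qed

end

section \<open>Choosing the chain by its dynamical type\<close>

context many_fixed_aut
begin

text \<open>Passing to a neighbour exchanges the two endpoint classes and, by \<open>AB\<close>, the
  two properties. The pairing of class and property is therefore constant along neighbours.\<close>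

lemma chain_of_type:
  fixes A :: "complex \<Rightarrow> bool" and B :: "complex \<Rightarrow> bool"
  defines "Y \<equiv> {u. free u \<and> (u \<in> endpoints L1 \<and> A u \<or> u \<in> endpoints L2 \<and> B u)}"
  assumes AB: "\<And>u q. adj u q \<Longrightarrow> (A u \<longrightarrow> B q) \<and> (B u \<longrightarrow> A q) \<and> (A q \<longrightarrow> B u) \<and> (B q \<longrightarrow> A u)"
    and ne: "Y \<noteq> {}"
  shows "fixed_chain L1 L2 f Y"
proof (intro fixed_chain.intro fixed_chain_axioms.intro)
  show "many_fixed_aut L1 L2 f" by unfold_locales
  fix u assume u: "u \<in> Y"
  show fr: "free u" using u unfolding Y_def by blast
  note n = neighbour_endpoints[OF fr] leaf_at_free(3,4)[OF fr]
  show "nx u \<in> Y" using u n(1,3) AB[OF nx_adj[OF fr]] free_nx[OF fr] disjoint_endpoints unfolding Y_def by blast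
  show "pr u \<in> Y" using u n(2,4) AB[OF pr_adj[OF fr]] free_pr[OF fr] disjoint_endpoints unfolding Y_def by blast
qed (use ne in blast)

lemma att_rep_alternate:
  assumes "adj u q"
  shows "(att u \<longrightarrow> rep q) \<and> (rep u \<longrightarrow> att q) \<and> (att q \<longrightarrow> rep u) \<and> (rep q \<longrightarrow> att u)"
  using adj_opposite[OF assms] att_or_rep[OF adj_free(1)[OF assms]] att_or_rep[OF adj_free(2)[OF assms]] by blast

text \<open>A free point pairs its endpoint class with attraction or repulsion in one of two ways,
  recorded by \<open>Y1\<close> and \<open>Y2\<close>. Either set is a chain as soon as it is
  nonempty, and all tips of one of its gaps then have the same type.\<close>

lemma many_fixed_points:
  obtains G H W where "preserved_interleaving_pair L1 L2 f G H" "real_gap L1 G" "real_gap L2 H"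
    "vertices G \<union> vertices H = Fix f"
    "attracting_gap f G \<and> repelling_gap f H \<or> attracting_gap f H \<and> repelling_gap f G"
    "vertices G = (Fix f \<inter> endpoints L1) \<union> W" "vertices H = (Fix f \<inter> endpoints L2) \<union> W"
    "W \<subseteq> Fix f - endpoints L1 - endpoints L2" "Fix f - endpoints L1 - endpoints L2 \<subseteq> W" "W = {} \<or> (\<exists>w. W = {w})"
proof -
  define Y1 where "Y1 = {u. free u \<and> (u \<in> endpoints L1 \<and> att u \<or> u \<in> endpoints L2 \<and> rep u)}"
  define Y2 where "Y2 = {u. free u \<and> (u \<in> endpoints L1 \<and> rep u \<or> u \<in> endpoints L2 \<and> att u)}"
  obtain z where z: "z \<in> S1" "z \<notin> Fix f" using nt unfolding nontrivial_def Fix_def by blast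
  then obtain u v where "adj u v" by (rule adj_exists)
  then have "free u" by (rule adj_free)
  then have "Y1 \<noteq> {} \<or> Y2 \<noteq> {}" unfolding Y1_def Y2_def using free_endpoint att_or_rep by blast
  then show ?thesis
  proof
    assume n: "Y1 \<noteq> {}"
    have c: "fixed_chain L1 L2 f Y1" unfolding Y1_def
      by (rule chain_of_type[OF att_rep_alternate n[unfolded Y1_def]])
    obtain G H W where g: "preserved_interleaving_pair L1 L2 f G H" "real_gap L1 G" "real_gap L2 H"
      "vertices G \<union> vertices H = Fix f" "tips G \<subseteq> Y1 \<inter> endpoints L1" "tips H \<subseteq> Y1 \<inter> endpoints L2"
      "vertices G = (Fix f \<inter> endpoints L1) \<union> W" "vertices H = (Fix f \<inter> endpoints L2) \<union> W"
      "W \<subseteq> Fix f - endpoints L1 - endpoints L2" "Fix f - endpoints L1 - endpoints L2 \<subseteq> W" "W = {} \<or> (\<exists>w. W = {w})"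
      by (rule fixed_chain.chain_pair[OF c])
    have "attracting_gap f G" "repelling_gap f H"
      unfolding attracting_gap_def repelling_gap_def
      using g(5,6) att_attracting rep_repelling disjoint_endpoints unfolding Y1_def by blast+
    then show ?thesis using that[OF g(1-4) _ g(7-11)] by blast
  next
    assume n: "Y2 \<noteq> {}"
    have c: "fixed_chain L1 L2 f Y2" unfolding Y2_def
    proof (rule chain_of_type[OF _ n[unfolded Y2_def]])
      fix u q assume "adj u q"
      then show "(rep u \<longrightarrow> att q) \<and> (att u \<longrightarrow> rep q) \<and> (rep q \<longrightarrow> att u) \<and> (att q \<longrightarrow> rep u)"
        using att_rep_alternate by blast
    qed
    obtain G H W where g: "preserved_interleaving_pair L1 L2 f G H" "real_gap L1 G" "real_gap L2 H"
      "vertices G \<union> vertices H = Fix f" "tips G \<subseteq> Y2 \<inter> endpoints L1" "tips H \<subseteq> Y2 \<inter> endpoints L2"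
      "vertices G = (Fix f \<inter> endpoints L1) \<union> W" "vertices H = (Fix f \<inter> endpoints L2) \<union> W"
      "W \<subseteq> Fix f - endpoints L1 - endpoints L2" "Fix f - endpoints L1 - endpoints L2 \<subseteq> W" "W = {} \<or> (\<exists>w. W = {w})"
      by (rule fixed_chain.chain_pair[OF c])
    have "attracting_gap f H" "repelling_gap f G"
      unfolding attracting_gap_def repelling_gap_def
      using g(5,6) att_attracting rep_repelling disjoint_endpoints unfolding Y2_def by blast+
    then show ?thesis using that[OF g(1-4) _ g(7-11)] by blast
  qed
qed

end

section \<open>Exactly two fixed points\<close>

context multi_fixed_aut
begin

text \<open>A moved \<open>b\<close> would give leaves from \<open>w\<close> to \<open>b\<close>,
  \<open>f b\<close> and \<open>f (f b)\<close>. These are distinct, as a map with a fixed point has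
  no periodic points but fixed ones, and three leaves cannot end at \<open>w\<close>.\<close>

lemma two_fixed_leaf:
  assumes F: "Fix f = {w, q}" and l: "lf L1 w b"
  shows "b = q"
proof (rule ccontr)
  assume "b \<noteq> q"
  note s = lfD(1-3)[OF l]
  have w: "w \<in> Fix f" using F by simp
  have fw: "f w = w" by (rule FixD(2)[OF w])
  have "b \<notin> Fix f" using F s(3) \<open>b \<noteq> q\<close> by simp
  then have n: "f b \<noteq> b" using FixD(3)[OF s(2), of f] by blast
  then have n2: "f (f b) \<noteq> f b" using oph_eq[OF f oph_S1[OF f s(2)] s(2)] by simp
  have "f (f b) \<noteq> b" using periodic_imp_fixed[OF f w s(2), of 2] n by (auto simp: numeral_2_eq_2)
  moreover have "lf L1 w (f b)" using aut_lf[OF f f1 l] fw by simp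
  moreover from this have "lf L1 w (f (f b))" using aut_lf[OF f f1, of w "f b"] fw by simp
  ultimately show False using at_most_two_leaves[OF V l, of "f b" "f (f b)"] n n2 by metis
qed

text \<open>The leaf joining \<open>w\<close> and \<open>q\<close> would be the only one at either
  point. Selecting sides that are inside \<open>(q, w)\<close> or strictly inside
  \<open>(w, q)\<close> yields a gap with element \<open>(q, w)\<close>. Its next element starts at
  \<open>w\<close>, so it is \<open>(w, q)\<close>, which was not selected.\<close>

lemma two_fixed_not_endpoint:
  assumes F: "Fix f = {w, q}" and wq: "w \<noteq> q"
  shows "w \<notin> endpoints L1"
proof
  assume "w \<in> endpoints L1"
  then obtain b where b: "lf L1 w b" using endpoints_iff[OF lam1] by blast
  then have l: "lf L1 w q" using two_fixed_leaf[OF F b] by simp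
  note ls = lf_sym[OF lam1 l]
  have F': "Fix f = {q, w}" using F by blast
  have S: "w \<in> S1" "q \<in> S1" using lfD[OF l] by blast+
  have fx: "f w = w" "f q = q" using F FixD(2)[of _ f] by blast+
  have noF: "z \<notin> Fix f" if "z \<in> open_arc w q" for z using that F arc_ends(1)[of w q] arc_ends(2)[of q w] by auto
  then have dc: False if "z \<in> open_arc w q" "z' \<in> open_arc w q" "f z \<in> open_arc w z" "f z' \<in> open_arc z' q" for z z'
    using direction_constant[OF f S fx _ that] by blast
  define JJ where "JJ = {J \<in> L1. J \<subseteq> open_arc q w \<or> J \<subset> open_arc w q}"
  have dj: "open_arc q w \<inter> open_arc w q = {}" using arc_not_dual by blast
  have ne: "\<exists>z. z \<in> J" if J: "J \<in> L1" for J
  proof -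
    obtain x y where "lf L1 x y" "J = open_arc x y" using J by (rule lam_arcE[OF lam1])
    then show ?thesis using arc_nonempty lfD(1-3) by metis
  qed
  have JL: "JJ \<subseteq> L1" unfolding JJ_def by blast
  have qJ: "open_arc q w \<in> JJ" using lfD(4)[OF ls] unfolding JJ_def by blast
  have side: "open_arc x y \<in> JJ \<or> open_arc y x \<in> JJ" if xy: "lf L1 x y" for x y
  proof -
    note m = lfD(4)[OF xy] lfD(4)[OF lf_sym[OF lam1 xy]]
    have "open_arc y x = open_arc q w" if "open_arc x y = open_arc w q" using lf_inj[OF xy l that] by simp
    moreover have "open_arc x y = open_arc q w" if "open_arc y x = open_arc w q" using lf_inj[OF lf_sym[OF lam1 xy] l that] by simp
    ultimately show ?thesis using lf_cases[OF lam1 xy l] m qJ unfolding JJ_def by blast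
  qed
  have cov: "\<not> open_arc v u \<subseteq> open_arc x y"
    if uv: "lf L1 u v" "lf L1 x y" "open_arc u v \<in> JJ" "open_arc x y \<in> JJ" for u v x y
  proof
    assume s: "open_arc v u \<subseteq> open_arc x y"
    have xy: "open_arc x y \<subseteq> open_arc q w \<or> open_arc x y \<subset> open_arc w q" using uv(4) unfolding JJ_def by blast
    have "open_arc u v \<subseteq> open_arc q w \<or> open_arc u v \<subset> open_arc w q" using uv(3) unfolding JJ_def by blast
    then show False
    proof
      assume "open_arc u v \<subseteq> open_arc q w"
      then have "open_arc w q \<subseteq> open_arc v u" using lf_subset_dual[OF uv(1) ls] by blast
      then show False using s xy dj ne[OF lfD(4)[OF l]] by blast
    next
      assume a: "open_arc u v \<subset> open_arc w q"
      then have b: "open_arc q w \<subseteq> open_arc v u" using lf_subset_dual[OF uv(1) l] by blast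
      then have "open_arc v u = open_arc q w" using s xy dj ne[OF lfD(4)[OF ls]] by blast
      then have "v = q \<and> u = w" by (rule lf_inj[OF lf_sym[OF lam1 uv(1)] ls])
      then show False using a by blast
    qed
  qed
  have un: "\<Union>{J \<in> JJ. I \<subseteq> J} \<in> JJ" if I: "I \<in> JJ" for I
  proof -
    obtain z where z: "z \<in> I" using ne I JL by blast
    show ?thesis
    proof (cases "I \<subseteq> open_arc q w")
      case True
      then have "J \<subseteq> open_arc q w" if "J \<in> {J \<in> JJ. I \<subseteq> J}" for J using that z dj unfolding JJ_def by blast
      then have "\<Union>{J \<in> JJ. I \<subseteq> J} = open_arc q w" using qJ True by (intro subset_antisym) blast+
      then show ?thesis using qJ by simp
    next
      case False
      then have zw: "z \<in> open_arc w q" using z I unfolding JJ_def by blast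
      have mem: "J \<subset> open_arc w q \<and> z \<in> J \<and> J \<in> L1" if "J \<in> {J \<in> JJ. I \<subseteq> J}" for J
        using that z zw dj unfolding JJ_def by blast
      have sub: "\<Union>{J \<in> JJ. I \<subseteq> J} \<subseteq> open_arc w q" using mem by blast
      have U: "\<Union>{J \<in> JJ. I \<subseteq> J} \<in> L1"
      proof (rule lam_union_pt(1)[OF lam1 _ _ _ S wq, of _ z])
        show "w \<notin> \<Union>{J \<in> JJ. I \<subseteq> J}" "q \<notin> \<Union>{J \<in> JJ. I \<subseteq> J}" using sub arc_ends(1)[of w q] arc_ends(2)[of q w] by blast+
      qed (use I mem JL in blast)+
      \<comment> \<open>If the selected sides filled \<open>(w, q)\<close>, one of them would
        contain both \<open>z\<close> and \<open>f z\<close>. As all points of \<open>(w, q)\<close>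
        move in one direction, \<open>f\<close> would shift that interval onto an overlapping one,
        linked with it.\<close>
      have "\<Union>{J \<in> JJ. I \<subseteq> J} \<noteq> open_arc w q"
      proof
        assume e: "\<Union>{J \<in> JJ. I \<subseteq> J} = open_arc w q"
        have fz: "f z \<in> open_arc w q" "f z \<noteq> z"
          using oph_arc_mono[OF f zw] fx noF[OF zw] FixD(3)[OF arc_sub_S1(1)[OF zw]] by auto
        then obtain J where J: "J \<in> {J \<in> JJ. I \<subseteq> J}" "f z \<in> J" using e by blast
        note Jm = mem[OF J(1)]
        have JL1: "J \<in> L1" using Jm by blast
        obtain c d where cd: "lf L1 c d" "J = open_arc c d" using JL1 by (rule lam_arcE[OF lam1])
        have cn: "c \<noteq> w" using two_fixed_leaf[OF F, of d] cd Jm by blast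
        have dn: "d \<noteq> q" using two_fixed_leaf[OF F', of c] lf_sym[OF lam1 cd(1)] cd Jm by blast
        have av: "w \<notin> open_arc c d" "q \<notin> open_arc c d" using Jm cd(2) arc_ends(1)[of w q] arc_ends(2)[of q w] by blast+
        have zc: "z \<in> open_arc c d" "f z \<in> open_arc c d" using Jm J(2) cd(2) by blast+
        have o: "c \<in> open_arc w z" "d \<in> open_arc z q" "c \<in> open_arc w (f z)" "d \<in> open_arc (f z) q"
          using arc_avoid_left[OF zc(1) S(1) av(1)] arc_avoid_right[OF zc(1) S(2) av(2)]
            arc_avoid_left[OF zc(2) S(1) av(1)] arc_avoid_right[OF zc(2) S(2) av(2)] cn dn by blast+
        have cw: "c \<in> open_arc w q" "d \<in> open_arc w q" using o(1,2) arc_left_trans[OF _ zw] arc_right_trans[OF zw] by blast+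
        have fcd: "f c \<in> open_arc w q" "f d \<in> open_arc w q" "f c \<noteq> c" "f d \<noteq> d"
          using oph_arc_mono[OF f cw(1)] oph_arc_mono[OF f cw(2)] fx noF[OF cw(1)] noF[OF cw(2)]
            FixD(3)[OF arc_sub_S1(1)[OF cw(1)]] FixD(3)[OF arc_sub_S1(1)[OF cw(2)]] by auto
        have o': "f c \<in> open_arc w (f z)" "f d \<in> open_arc (f z) q"
          using oph_arc_mono[OF f o(1)] oph_arc_mono[OF f o(2)] fx by simp_all
        have lr: "f y \<in> open_arc w y \<or> f y \<in> open_arc y q" if y: "y \<in> open_arc w q" "f y \<in> open_arc w q" "f y \<noteq> y" for y
        proof -
          have "y \<in> S1" "f y \<in> S1" "cyc (Arg2pi w) (Arg2pi y) (Arg2pi q)" "cyc (Arg2pi w) (Arg2pi (f y)) (Arg2pi q)"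
            using y(1,2) arc_sub_S1 arc_memD by blast+
          then show ?thesis using y(3) S by (simp only: arc_cyc cyc_def S1_eq_iff) argo
        qed
        note l' = aut_lf[OF f f1 cd(1)]
        from lr[OF zw fz] show False
        proof
          assume "f z \<in> open_arc w z"
          then have "f c \<in> open_arc w c" "f d \<in> open_arc w d"
            using dc[OF zw cw(1)] dc[OF zw cw(2)] lr[OF cw(1) fcd(1,3)] lr[OF cw(2) fcd(2,4)] by blast+
          note m = this
          have cd': "c \<in> open_arc w (f d)"
            by (rule arc_left_trans[OF o(3) arc_between_left[OF fz(1) o'(2)]])
          have "f d \<in> open_arc c d" by (rule arc_between[OF cd' m(2)])
          moreover have "c \<in> open_arc (f c) d" by (rule arc_between[OF m(1) arc_left_trans[OF cd' m(2)]])
          then have "f c \<in> open_arc d c" using arc_rotate by blast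
          ultimately show False by (rule lf_unlinked[OF lam1 cd(1) lf_sym[OF lam1 l']])
        next
          assume "f z \<in> open_arc z q"
          then have "f c \<in> open_arc c q" "f d \<in> open_arc d q"
            using dc[OF cw(1) zw] dc[OF cw(2) zw] lr[OF cw(1) fcd(1,3)] lr[OF cw(2) fcd(2,4)] by blast+
          note m = this
          have cd': "f c \<in> open_arc w d"
            by (rule arc_left_trans[OF o'(1) arc_between_left[OF fz(1) o(4)]])
          have cc: "c \<in> open_arc w (f c)" by (rule arc_between_left[OF cw(1) m(1)])
          have "f c \<in> open_arc c d" by (rule arc_between[OF cc cd'])
          moreover have "d \<in> open_arc c (f d)"
            by (rule arc_between[OF arc_left_trans[OF cc cd'] arc_between_left[OF cw(2) m(2)]])
          then have "f d \<in> open_arc d c" using arc_rotate by blast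
          ultimately show False by (rule lf_unlinked[OF lam1 cd(1) l'])
        qed
      qed
      then show ?thesis using U sub unfolding JJ_def by blast
    qed
  qed
  define H where "H = maximal_elements JJ"
  have gH: "gap L1 H" unfolding H_def by (rule maximal_gap(1)[OF lam1 JL side cov un])
  have "K = open_arc q w" if "K \<in> JJ" "open_arc q w \<subseteq> K" for K
    using that dj ne[OF lfD(4)[OF ls]] unfolding JJ_def by blast
  then have qH: "open_arc q w \<in> H" using qJ unfolding H_def maximal_elements_def by blast
  obtain v where v: "lf L1 w v" "open_arc w v \<in> H" by (rule gap_next[OF veeringD(1)[OF V] gH qH ls])
  have "v = q" by (rule two_fixed_leaf[OF F v(1)])
  then have "open_arc w q \<in> JJ" using v(2) unfolding H_def maximal_elements_def by blast
  then show False using dj ne[OF lfD(4)[OF l]] unfolding JJ_def by blast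
qed

text \<open>Otherwise \<open>w\<close> would be a pivot whose tips are all fixed, while
  \<open>q\<close> is the only other fixed point.\<close>

lemma two_fixed_rainbow:
  assumes F: "Fix f = {w, q}" and wq: "w \<noteq> q"
  shows "rainbow_point L1 w"
proof (rule ccontr)
  assume n: "\<not> ?thesis"
  have w: "w \<in> Fix f" using F by simp
  obtain G where G: "crown_with_pivot L1 G w"
    using point_trichotomy[OF veeringD(1)[OF V] FixD(1)[OF w] two_fixed_not_endpoint[OF F wq] n] by blast
  obtain t where t: "crown_seq L1 G w t" "\<And>k. t k \<in> Fix f" using pivot_cases(2)[OF G w] not_single by blast
  have "t k = q" for k using t(2)[of k] crown_seqD(6)[OF t(1)] F by (metis insertE rangeI singletonD)
  then show False using lfD(3)[OF crown_seqD(3)[OF t(1), of 0]] by simp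
qed

text \<open>The last conclusion says that the points of both arcs move towards the same fixed point.
  It serves to exclude that a power has two fixed points exchanged by its root.\<close>

lemma two_fixed_points:
  assumes F: "Fix f = {w, q}" and wq: "w \<noteq> q"
  shows "hyperbolic f" "rainbow_point L1 w" "rainbow_point L1 q" "rainbow_point L2 w" "rainbow_point L2 q"
    "\<exists>a b. a \<in> open_arc w q \<and> b \<in> open_arc q w \<and> (f a \<in> open_arc w a \<and> f b \<in> open_arc b w \<or> f a \<in> open_arc a q \<and> f b \<in> open_arc q b)"
proof -
  have F': "Fix f = {q, w}" using F by blast
  show "rainbow_point L1 w" "rainbow_point L1 q" "rainbow_point L2 w" "rainbow_point L2 q"
    using two_fixed_rainbow[OF F wq] two_fixed_rainbow[OF F' wq[symmetric]]
      multi_fixed_aut.two_fixed_rainbow[OF flip_multi F wq] multi_fixed_aut.two_fixed_rainbow[OF flip_multi F' wq[symmetric]] by blast+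
  have "open_arc w q \<inter> Fix f = {}" "open_arc q w \<inter> Fix f = {}" using F by auto
  then have a: "adj w q" "adj q w" using F wq unfolding adj_def by auto
  have c: "att w \<and> rep q \<or> att q \<and> rep w"
    using att_or_rep[OF adj_free(1)[OF a(1)]] att_or_rep[OF adj_free(2)[OF a(1)]] adj_opposite[OF a(1)] by blast
  then show "hyperbolic f" unfolding hyperbolic_def using nt F F' wq att_attracting rep_repelling by metis
  have A: "\<exists>a b. a \<in> open_arc u v \<and> b \<in> open_arc v u \<and> f a \<in> open_arc u a \<and> f b \<in> open_arc b u"
    if att: "att u" and uv: "adj u v" "adj v u" for u v
  proof -
    obtain p r a b where h: "adj p u" "adj u r" "a \<in> open_arc p u" "b \<in> open_arc u r" "f a \<in> open_arc a u" "f b \<in> open_arc u b"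
      using att unfolding att_def by blast
    have "p = v" "r = v" using adj_unique_left[OF h(1) uv(2)] adj_unique_right[OF h(2) uv(1)] .
    then show ?thesis using h by blast
  qed
  from c show "\<exists>a b. a \<in> open_arc w q \<and> b \<in> open_arc q w \<and> (f a \<in> open_arc w a \<and> f b \<in> open_arc b w \<or> f a \<in> open_arc a q \<and> f b \<in> open_arc q b)"
    using A[OF _ a] A[OF _ a(2,1)] by blast
qed

end

section \<open>Automorphisms without fixed points\<close>

text \<open>Without fixed points neither side is mapped into itself. Of the four unlinked positions
  of a leaf and its image only those remain in which some side is displaced off itself.\<close>

lemma no_fixed_small_side:
  assumes L: "lamination_system L" and g: "oph g" "preserves g L" and F: "Fix g = {}" and l: "lf L u v"
  shows "g ` open_arc u v \<inter> open_arc u v = {} \<or> g ` open_arc v u \<inter> open_arc v u = {}"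
proof -
  note s = lfD(1-3)[OF l] and l' = aut_lf[OF g l] and ls = lf_sym[OF L l]
  have "\<not> open_arc (g u) (g v) \<subseteq> open_arc u v" "\<not> open_arc (g v) (g u) \<subseteq> open_arc v u"
    using oph_fixed_point[OF g(1) s] oph_fixed_point[OF g(1) lfD(1-3)[OF ls]] F by blast+
  then show ?thesis
    using lf_cases[OF L l' l] lf_disjoint_iff[OF l' l] lf_disjoint_iff[OF lf_sym[OF L l'] ls]
    unfolding oph_image_arc[OF g(1) s(1,2)] oph_image_arc[OF g(1) s(2,1)] by blast
qed

lemma preserved_gap_polygon:
  assumes Q: "quite_full L" and g: "oph g" and F: "Fix g = {}" and G: "gap L G" "preserves g G"
  shows "ideal_polygon L G"
proof -
  have "\<not> crown L G"
  proof
    assume "crown L G"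
    then obtain p where p: "crown_with_pivot L G p" unfolding crown_def by blast
    obtain t where t: "crown_seq L G p t" using crownE[OF quite_fullD(1)[OF Q] p] .
    have "p \<in> Fix g" using preserves_crown_pivot[OF g t G(2)] crown_seqD(2)[OF t] by (intro FixD(3))
    then show False using F by blast
  qed
  then show ?thesis using quite_fullD(2)[OF Q G(1)] by blast
qed

text \<open>Without an invariant leaf, the maximal intervals displaced from themselves form an invariant gap.\<close>

lemma no_fixed_invariant_polygon:
  assumes Q: "quite_full L" and g: "oph g" "preserves g L" and F: "Fix g = {}"
  shows "\<exists>G. ideal_polygon L G \<and> preserves g G"
proof -
  note L = quite_fullD(1)[OF Q]
  have e: "(\<lambda>J. g ` J) ` L = L" using g(2) unfolding preserves_def .
  have "\<exists>G. gap L G \<and> preserves g G"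
  proof (cases "\<exists>u v. lf L u v \<and> g u = v \<and> g v = u")
    \<comment> \<open>A leaf flipped by \<open>g\<close> has both sides displaced, which leaves no
      choice between them; but it is itself an invariant gap.\<close>
    case True
    then obtain u v where u: "lf L u v" "g u = v" "g v = u" by blast
    have "preserves g {open_arc u v, open_arc v u}"
      unfolding preserves_def using oph_image_arc[OF g(1) lfD(1,2)[OF u(1)]] oph_image_arc[OF g(1) lfD(2,1)[OF u(1)]] u(2,3) by auto
    then show ?thesis using leaf_gap(1)[OF L u(1)] by blast
  next
    case False
    define JJ where "JJ = {I \<in> L. g ` I \<inter> I = {}}"
    have JL: "JJ \<subseteq> L" unfolding JJ_def by blast
    have LS: "I \<subseteq> S1" if I: "I \<in> L" for I
    proof -
      obtain u v where "lf L u v" "I = open_arc u v" using I by (rule lam_arcE[OF L])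
      then show ?thesis using arc_sub_S1 by blast
    qed
    have side: "open_arc u v \<in> JJ \<or> open_arc v u \<in> JJ" if l: "lf L u v" for u v
      using no_fixed_small_side[OF L g F l] lfD(4)[OF l] lfD(4)[OF lf_sym[OF L l]] unfolding JJ_def by blast
    have cov: "\<not> open_arc v u \<subseteq> open_arc x y"
      if uv: "lf L u v" "lf L x y" "open_arc u v \<in> JJ" "open_arc x y \<in> JJ" for u v x y
    proof
      \<comment> \<open>If displaced sides covered, the side \<open>(v, u)\<close> would be
        displaced along with \<open>(u, v)\<close>, and \<open>g\<close> would flip the leaf, which
        is the case already settled.\<close>
      assume s: "open_arc v u \<subseteq> open_arc x y"
      note t = lfD(1-3)[OF uv(1)] and l' = aut_lf[OF g uv(1)] and ls = lf_sym[OF L uv(1)]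
      have "g ` open_arc v u \<inter> open_arc v u = {}" using s uv(4) unfolding JJ_def by blast
      then have "open_arc (g v) (g u) \<subseteq> open_arc u v"
        using lf_disjoint_iff[OF lf_sym[OF L l'] ls] unfolding oph_image_arc[OF g(1) t(2,1)] by blast
      then have "open_arc v u \<subseteq> open_arc (g u) (g v)" using lf_subset_dual[OF lf_sym[OF L l'] uv(1)] by blast
      moreover have "open_arc (g u) (g v) \<inter> open_arc u v = {}"
        using uv(3) oph_image_arc[OF g(1) t(1,2)] unfolding JJ_def by simp
      then have "open_arc (g u) (g v) \<subseteq> open_arc v u" using lf_disjoint_iff[OF l' uv(1)] by blast
      ultimately have "open_arc (g u) (g v) = open_arc v u" by blast
      then have "g u = v \<and> g v = u" by (rule lf_inj[OF l' ls])
      then show False using False uv(1) by blast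
    qed
    have un: "\<Union>{J \<in> JJ. I \<subseteq> J} \<in> JJ" if I: "I \<in> JJ" for I
    proof -
      have IL: "I \<in> L" using I JL by blast
      obtain u v where u: "lf L u v" "I = open_arc u v" using IL by (rule lam_arcE[OF L])
      obtain p where p: "p \<in> open_arc u v" using arc_nonempty[OF lfD(1-3)[OF u(1)]] by blast
      have "p \<in> S1" "p \<noteq> u" using p arc_sub_S1 by auto
      then obtain p' where p': "p' \<in> open_arc u p" using arc_nonempty[OF lfD(1)[OF u(1)], of p] by blast
      then have pI: "p \<in> I" "p' \<in> I" "p \<noteq> p'"
        unfolding u(2) using p arc_left_trans[OF p' p] arc_ends(2)[of p u] by blast+
      have pS: "p \<in> S1" "p' \<in> S1" using pI LS[OF IL] by blast+
      have ch: "J \<subseteq> K \<or> K \<subseteq> J" if JK: "J \<in> {J \<in> JJ. I \<subseteq> J}" "K \<in> {J \<in> JJ. I \<subseteq> J}" for J K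
      proof -
        have JKL: "J \<in> L" "K \<in> L" using JK JL by blast+
        obtain a b where a: "lf L a b" "J = open_arc a b" using JKL(1) by (rule lam_arcE[OF L])
        obtain c d where c: "lf L c d" "K = open_arc c d" using JKL(2) by (rule lam_arcE[OF L])
        have "\<not> open_arc b a \<subseteq> open_arc c d" using cov[OF a(1) c(1)] a(2) c(2) JK by blast
        then show ?thesis using lf_nested[OF L a(1) c(1)] a(2) c(2) JK pI(1) by blast
      qed
      \<comment> \<open>Displacement supplies the omitted points: the image of a point of
        \<open>I\<close> lies outside every displaced interval containing \<open>I\<close>, and two
        points of \<open>I\<close> have two images.\<close>
      have av: "g x \<notin> \<Union>{J \<in> JJ. I \<subseteq> J}" if "x \<in> I" for x using that unfolding JJ_def by blast
      have "g p \<noteq> g p'" using oph_eq[OF g(1) pS] pI(3) by simp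
      then have U: "\<Union>{J \<in> JJ. I \<subseteq> J} \<in> L"
        using I JL by (intro lam_union[OF L _ _ ch oph_S1[OF g(1) pS(1)] oph_S1[OF g(1) pS(2)] _ av[OF pI(1)] av[OF pI(2)]]) blast+
      have "g ` \<Union>{J \<in> JJ. I \<subseteq> J} \<inter> \<Union>{J \<in> JJ. I \<subseteq> J} = {}"
      proof (rule ccontr)
        assume "\<not> ?thesis"
        then obtain z J K where z: "J \<in> {J \<in> JJ. I \<subseteq> J}" "K \<in> {J \<in> JJ. I \<subseteq> J}" "z \<in> J" "g z \<in> K" by blast
        then obtain M where "M \<in> JJ" "z \<in> M" "g z \<in> M" using ch[OF z(1,2)] by blast
        then show False unfolding JJ_def by blast
      qed
      then show ?thesis using U unfolding JJ_def by blast
    qed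
    define G where "G = maximal_elements JJ"
    have gG: "gap L G" unfolding G_def by (rule maximal_gap(1)[OF L JL side cov un])
    have sub_iff: "g ` I \<subseteq> g ` J \<longleftrightarrow> I \<subseteq> J" if "I \<in> L" "J \<in> L" for I J
      using inj_on_image_subset_iff[OF oph_inj[OF g(1)] LS[OF that(1)] LS[OF that(2)]] .
    have img: "g ` I \<in> JJ \<longleftrightarrow> I \<in> JJ" if I: "I \<in> L" for I
    proof -
      have gI: "g ` I \<in> L" using imageI[OF I, of "\<lambda>J. g ` J"] unfolding e .
      have "g ` (g ` I) \<inter> g ` I = g ` (g ` I \<inter> I)"
        using inj_on_image_Int[OF oph_inj[OF g(1)] LS[OF gI] LS[OF I]] by simp
      then show ?thesis using I gI unfolding JJ_def by simp
    qed
    have pre: "\<exists>J\<in>L. K = g ` J" if "K \<in> L" for K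
    proof -
      have "K \<in> (\<lambda>J. g ` J) ` L" using that unfolding e .
      then show ?thesis by blast
    qed
    have mx: "g ` I \<in> G \<longleftrightarrow> I \<in> G" if I: "I \<in> L" for I
    proof
      assume a: "g ` I \<in> G"
      have "K = I" if K: "K \<in> JJ" "I \<subseteq> K" for K
      proof -
        have KL: "K \<in> L" using K JL by blast
        have "g ` K \<in> JJ" "g ` I \<subseteq> g ` K" using img[OF KL] K by blast+
        then have "g ` K = g ` I" using a unfolding G_def maximal_elements_def by blast
        then show ?thesis using sub_iff[OF KL I] sub_iff[OF I KL] by blast
      qed
      moreover have "I \<in> JJ" using a img[OF I] unfolding G_def maximal_elements_def by blast
      ultimately show "I \<in> G" unfolding G_def maximal_elements_def by blast
    next
      assume a: "I \<in> G"
      have "K = g ` I" if K: "K \<in> JJ" "g ` I \<subseteq> K" for K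
      proof -
        have "K \<in> L" using K JL by blast
        then obtain J where J: "J \<in> L" "K = g ` J" using pre by blast
        have "J \<in> JJ" "I \<subseteq> J" using img[OF J(1)] sub_iff[OF I J(1)] K J(2) by blast+
        then show ?thesis using a J(2) unfolding G_def maximal_elements_def by blast
      qed
      moreover have "g ` I \<in> JJ" using a img[OF I] unfolding G_def maximal_elements_def by blast
      ultimately show "g ` I \<in> G" unfolding G_def maximal_elements_def by blast
    qed
    have GL: "G \<subseteq> L" using gG unfolding gap_def by blast
    have "(\<lambda>I. g ` I) ` G = G"
    proof (intro subset_antisym subsetI)
      fix K assume "K \<in> (\<lambda>I. g ` I) ` G"
      then obtain I where "I \<in> G" "K = g ` I" by blast
      then show "K \<in> G" using mx GL by blast
    next
      fix K assume K: "K \<in> G"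
      then obtain J where "J \<in> L" "K = g ` J" using pre GL by blast
      then show "K \<in> (\<lambda>I. g ` I) ` G" using mx K by blast
    qed
    then show ?thesis using gG unfolding preserves_def by blast
  qed
  then obtain G where G: "gap L G" "preserves g G" by blast
  then show ?thesis using preserved_gap_polygon[OF Q g(1) F] by blast
qed

text \<open>If no element of \<open>G\<close> had all vertices of \<open>H\<close> in its closure,
  each element of one gap would lie in an element of the other, and disjointness would make the gaps
  equal.\<close>

lemma gap_separation:
  assumes L: "lamination_system L" and G: "gap L G" "gap L H" "G \<noteq> H"
  obtains u v where "lf L u v" "open_arc u v \<in> G" "vertices H \<inter> open_arc v u = {}"
proof (rule ccontr)
  assume n: "\<not> thesis"
  have no: "\<not> open_arc y x \<subseteq> open_arc u v"
    if "lf L u v" "open_arc u v \<in> G" "lf L x y" "open_arc x y \<in> H" for u v x y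
  proof
    assume "open_arc y x \<subseteq> open_arc u v"
    then have "open_arc v u \<subseteq> open_arc x y" using lf_subset_dual[OF lf_sym[OF L that(3)] that(1)] by blast
    then have "vertices H \<inter> open_arc v u = {}" using that(4) unfolding vertices_def by blast
    then show False using n that(1,2) \<open>\<And>u v. lf L u v \<Longrightarrow> open_arc u v \<in> G \<Longrightarrow> vertices H \<inter> open_arc v u = {} \<Longrightarrow> thesis\<close> by blast
  qed
  have HG: "\<exists>I\<in>G. J \<subseteq> I" if J: "J \<in> H" for J
  proof -
    obtain x y where x: "lf L x y" "J = open_arc x y" using gap_lfE[OF L G(2) J] .
    obtain M where M: "M \<in> G" "open_arc x y \<subseteq> M \<or> open_arc y x \<subseteq> M" using gap_leaf_side[OF G(1) x(1)] by blast
    obtain u v where u: "lf L u v" "M = open_arc u v" using gap_lfE[OF L G(1) M(1)] .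
    show ?thesis using no[OF u(1) _ x(1)] M u(2) x(2) J by blast
  qed
  have GH: "\<exists>J\<in>H. I \<subseteq> J" if I: "I \<in> G" for I
  proof -
    obtain u v where u: "lf L u v" "I = open_arc u v" using gap_lfE[OF L G(1) I] .
    obtain M where M: "M \<in> H" "open_arc u v \<subseteq> M \<or> open_arc v u \<subseteq> M" using gap_leaf_side[OF G(2) u(1)] by blast
    obtain x y where x: "lf L x y" "M = open_arc x y" using gap_lfE[OF L G(2) M(1)] .
    have "\<not> open_arc v u \<subseteq> open_arc x y"
      using no[OF u(1) _ x(1)] M(1) u(2) x(2) I lf_subset_dual[OF lf_sym[OF L u(1)] x(1)] by blast
    then show ?thesis using M u(2) x(2) by blast
  qed
  have ne: "\<exists>z. z \<in> I" if I: "I \<in> K" "gap L K" for I K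
  proof -
    obtain u v where "lf L u v" "I = open_arc u v" using gap_lfE[OF L I(2,1)] .
    then show ?thesis using arc_nonempty lfD(1-3) by metis
  qed
  have "I \<in> H" if I: "I \<in> G" for I
  proof -
    obtain J I' where J: "J \<in> H" "I \<subseteq> J" "I' \<in> G" "J \<subseteq> I'" using GH[OF I] HG by blast
    obtain z where "z \<in> I" using ne[OF I G(1)] by blast
    then have "I = I'" using gap_disjoint[OF G(1) I J(3)] J by blast
    then have "I = J" using J by blast
    then show ?thesis using J by blast
  qed
  moreover have "J \<in> G" if J: "J \<in> H" for J
  proof -
    obtain I J' where I: "I \<in> G" "J \<subseteq> I" "J' \<in> H" "I \<subseteq> J'" using HG[OF J] GH by blast
    obtain z where "z \<in> J" using ne[OF J G(2)] by blast
    then have "J = J'" using gap_disjoint[OF G(2) J I(3)] I by blast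
    then have "I = J" using I by blast
    then show ?thesis using I by blast
  qed
  ultimately show False using G(3) by blast
qed

text \<open>Distinct \<open>H\<close> and \<open>K\<close> are separated by an element
  \<open>(u, v)\<close> of \<open>H\<close>. It contains just one vertex of \<open>G\<close>,
  whereas each element of \<open>G\<close> contains a vertex of \<open>K\<close>. An element of
  \<open>G\<close> avoiding \<open>u\<close> and \<open>v\<close> would have both endpoints in
  \<open>(u, v)\<close>, one vertex too many. So each contains \<open>u\<close> or \<open>v\<close>;
  there are at most two, and \<open>G\<close> is a leaf.\<close>

lemma interleaving_unique:
  assumes V: "veering_pair L1 L2" and G: "nonleaf_gap L1 G"
    and H: "interleaving_pair L1 L2 G H" "interleaving_pair L1 L2 G K"
  shows "H = K"
proof (rule ccontr)
  assume n: "H \<noteq> K"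
  note lam1 = veeringD(3)[OF V] and lam2 = veeringD(4)[OF V]
  have g: "gap L1 G" "gap L2 H" "gap L2 K" and sG: "\<And>I. I \<in> G \<Longrightarrow> is_singleton (I \<inter> vertices K)"
    and sH: "\<And>I. I \<in> H \<Longrightarrow> is_singleton (I \<inter> vertices G)"
    using H unfolding interleaving_pair_def interleave_def by blast+
  obtain u v where u: "lf L2 u v" "open_arc u v \<in> H" "vertices K \<inter> open_arc v u = {}"
    by (rule gap_separation[OF lam2 g(2,3) n])
  note us = lfD(1-3)[OF u(1)]
  have E: "u \<notin> endpoints L1" "v \<notin> endpoints L1"
    using u(1) lf_sym[OF lam2 u(1)] endpoints_iff[OF lam2] veeringD(7)[OF V] by blast+
  obtain p where p: "open_arc u v \<inter> vertices G = {p}" using sH[OF u(2)] by (rule is_singletonE)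
  have cont: "u \<in> M \<or> v \<in> M" if M: "M \<in> G" for M
  proof (rule ccontr)
    assume nm: "\<not> (u \<in> M \<or> v \<in> M)"
    obtain x y where x: "lf L1 x y" "M = open_arc x y" using gap_lfE[OF lam1 g(1) M] .
    obtain m where m: "M \<inter> vertices K = {m}" using sG[OF M] by (rule is_singletonE)
    have mm: "m \<in> M" "m \<in> vertices K" using m by blast+
    have "m \<noteq> u" "m \<noteq> v" "m \<notin> open_arc v u" "m \<in> S1" using nm mm u(3) vertices_S1[of K] by blast+
    then have mu: "m \<in> open_arc u v" using arc_cases[OF us(1,2) _ us(3), of m] by blast
    have "x \<noteq> u" "y \<noteq> u" "x \<noteq> v" "y \<noteq> v" using E x(1) lf_sym[OF lam1 x(1)] endpoints_iff[OF lam1] by blast+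
    moreover have "m \<in> open_arc x y" "u \<notin> open_arc x y" "v \<notin> open_arc x y" using mm nm x(2) by blast+
    ultimately have "x \<in> open_arc u m" "y \<in> open_arc m v"
      using arc_avoid_left[of m x y u] arc_avoid_right[of m x y v] us by blast+
    then have "x \<in> open_arc u v" "y \<in> open_arc u v" using arc_left_trans[OF _ mu] arc_right_trans[OF mu] by blast+
    moreover have "x \<in> vertices G" "y \<in> vertices G" using gap_vertex[OF lam1 g(1) _ lfD(1-3)[OF x(1)]] M x(2) by blast+
    ultimately have "x = p" "y = p" using p by blast+
    then show False using lfD(3)[OF x(1)] by blast
  qed
  have two: "M = N \<or> N = O' \<or> M = O'" if "M \<in> G" "N \<in> G" "O' \<in> G" for M N O'
    using cont[OF that(1)] cont[OF that(2)] cont[OF that(3)] gap_disjoint[OF g(1)] that by blast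
  obtain x y where x: "lf L1 x y" "open_arc x y \<in> G" by (rule gap_nonempty[OF lam1 g(1)])
  note Q1 = veeringD(1)[OF V]
  obtain z where z: "lf L1 y z" "open_arc y z \<in> G" by (rule gap_next[OF Q1 g(1) x(2,1)])
  obtain w where w: "lf L1 z w" "open_arc z w \<in> G" by (rule gap_next[OF Q1 g(1) z(2,1)])
  have "open_arc x y \<noteq> open_arc y z" "open_arc y z \<noteq> open_arc z w"
    using lf_inj[OF x(1) z(1)] lf_inj[OF z(1) w(1)] lfD(3)[OF x(1)] lfD(3)[OF z(1)] by blast+
  then have "open_arc x y = open_arc z w" using two[OF x(2) z(2) w(2)] by blast
  then have zx: "z = x" using lf_inj[OF x(1) w(1)] by blast
  have "G = {open_arc x y, open_arc y x}"
  proof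
    show "{open_arc x y, open_arc y x} \<subseteq> G" using x(2) z(2) zx by blast
    show "G \<subseteq> {open_arc x y, open_arc y x}"
      using two[OF _ x(2) z(2)] \<open>open_arc x y \<noteq> open_arc y z\<close> zx by blast
  qed
  then show False using G leaves_lf[OF x(1)] unfolding nonleaf_gap_def by simp
qed

text \<open>The image of a partner of \<open>G\<close> is again a partner of \<open>G\<close>, and
  partners are unique.\<close>

lemma no_fixed_preserved_partner:
  assumes V: "veering_pair L1 L2" and g: "oph g" "preserves g L1" "preserves g L2" and F: "Fix g = {}"
    and G: "nonleaf_gap L1 G" "preserves g G"
  shows "\<exists>H. interleaving_pair L1 L2 G H \<and> preserves g H"
proof -
  note lam1 = veeringD(3)[OF V] and lam2 = veeringD(4)[OF V]
  obtain H where H: "interleaving_pair L1 L2 G H" using veeringD(8)[OF V G(1)] by blast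
  have gp: "gap L1 G" "gap L2 H" and s: "\<And>I. I \<in> G \<Longrightarrow> is_singleton (I \<inter> vertices H)" "\<And>I. I \<in> H \<Longrightarrow> is_singleton (I \<inter> vertices G)"
    using H unfolding interleaving_pair_def interleave_def by blast+
  have e: "(\<lambda>I. g ` I) ` G = G" using G(2) unfolding preserves_def .
  have vG: "g ` vertices G = vertices G" using gap_image(2)[OF lam1 g(1,2) gp(1)] e by simp
  note iH = gap_image[OF lam2 g(1,3) gp(2)]
  have sub: "I \<subseteq> S1" if I: "I \<in> K" "gap L K" "lamination_system L" for I K L
  proof -
    obtain u v where "lf L u v" "I = open_arc u v" using gap_lfE[OF I(3,2,1)] .
    then show ?thesis using arc_sub_S1 by blast
  qed
  have im: "is_singleton (g ` I \<inter> g ` Y)" if I: "is_singleton (I \<inter> Y)" "I \<subseteq> S1" "Y \<subseteq> S1" for I Y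
  proof -
    have "g ` I \<inter> g ` Y = g ` (I \<inter> Y)" using inj_on_image_Int[OF oph_inj[OF g(1)] I(2,3)] by simp
    then show ?thesis using I(1) unfolding is_singleton_def by auto
  qed
  have "interleave G ((`) g ` H)" unfolding interleave_def
  proof (intro conjI ballI)
    fix I assume "I \<in> G"
    then have "I \<in> (\<lambda>I. g ` I) ` G" unfolding e .
    then obtain J where J: "J \<in> G" "I = g ` J" by blast
    show "is_singleton (I \<inter> vertices ((`) g ` H))"
      unfolding J(2) iH(2) using im[OF s(1)[OF J(1)] sub[OF J(1) gp(1) lam1] vertices_S1] .
  next
    fix I assume "I \<in> (`) g ` H"
    then obtain J where J: "J \<in> H" "I = g ` J" by blast
    show "is_singleton (I \<inter> vertices G)"
      using im[OF s(2)[OF J(1)] sub[OF J(1) gp(2) lam2] vertices_S1] unfolding J(2) vG .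
  qed
  then have "interleaving_pair L1 L2 G ((`) g ` H)" unfolding interleaving_pair_def using gp(1) iH(1) by blast
  then have "(`) g ` H = H" by (rule interleaving_unique[OF V G(1) _ H])
  then show ?thesis using H unfolding preserves_def by auto
qed

lemma preserved_leaf_swap:
  assumes L: "lamination_system L" and g: "oph g" "preserves g L" and F: "Fix g = {}"
    and l: "lf L u v" and G: "preserves g {open_arc u v, open_arc v u}"
  shows "g u = v" "g v = u"
proof -
  note s = lfD(1-3)[OF l]
  have "g ` open_arc u v \<in> (\<lambda>I. g ` I) ` {open_arc u v, open_arc v u}" by blast
  then have "g ` open_arc u v \<in> {open_arc u v, open_arc v u}" unfolding G[unfolded preserves_def] .
  then have "open_arc (g u) (g v) = open_arc u v \<or> open_arc (g u) (g v) = open_arc v u"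
    unfolding oph_image_arc[OF g(1) s(1,2)] by blast
  moreover have "g u \<noteq> u" using FixD(3)[OF s(1), of g] F by blast
  ultimately have "g u = v \<and> g v = u"
    using lf_inj[OF aut_lf[OF g l] l] lf_inj[OF aut_lf[OF g l] lf_sym[OF L l]] by blast
  then show "g u = v" "g v = u" by blast+
qed

lemma linked_leaves_interleave:
  assumes l: "lf L1 u v" "lf L2 x y" and xy: "x \<in> open_arc u v" "y \<in> open_arc v u"
  shows "interleave {open_arc u v, open_arc v u} {open_arc x y, open_arc y x}"
proof -
  have S: "u \<in> S1" "v \<in> S1" "x \<in> S1" "y \<in> S1" using lfD[OF l(1)] lfD[OF l(2)] by blast+
  have c: "cyc (Arg2pi u) (Arg2pi x) (Arg2pi v)" "cyc (Arg2pi v) (Arg2pi y) (Arg2pi u)" using xy arc_memD by blast+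
  have m: "v \<in> open_arc x y" "u \<in> open_arc y x" using c S by (simp_all only: arc_cyc cyc_def) argo+
  note v1 = vertices_leaf[OF l(1), unfolded leaf_lf[OF l(1)]] and v2 = vertices_leaf[OF l(2), unfolded leaf_lf[OF l(2)]]
  have "open_arc u v \<inter> {x, y} = {x}" "open_arc v u \<inter> {x, y} = {y}" "open_arc x y \<inter> {u, v} = {v}" "open_arc y x \<inter> {u, v} = {u}"
    using xy m arc_not_dual[OF xy(1)] arc_not_dual[OF xy(2)] arc_not_dual[OF m(1)] arc_not_dual[OF m(2)] by auto
  then show ?thesis unfolding interleave_def v1 v2 by (simp add: is_singleton_def)
qed

text \<open>An invariant non-leaf polygon in either system brings its unique partner with it. If
  both invariant polygons are leaves, \<open>g\<close> exchanges the endpoints of each, which forces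
  them to be linked, and linked leaves interleave.\<close>

lemma no_fixed_preserved_pair:
  assumes V: "veering_pair L1 L2" and g: "oph g" "preserves g L1" "preserves g L2" and F: "Fix g = {}"
  shows "\<exists>G H. preserved_interleaving_pair L1 L2 g G H \<and> ideal_polygon L1 G \<and> ideal_polygon L2 H"
proof -
  note lam1 = veeringD(3)[OF V] and lam2 = veeringD(4)[OF V]
  have fin: ?thesis if "interleaving_pair L1 L2 G H" "preserves g G" "preserves g H" for G H
    using that preserved_gap_polygon[OF veeringD(1)[OF V] g(1) F] preserved_gap_polygon[OF veeringD(2)[OF V] g(1) F]
    unfolding preserved_interleaving_pair_def interleaving_pair_def by blast
  obtain G where G: "ideal_polygon L1 G" "preserves g G" using no_fixed_invariant_polygon[OF veeringD(1)[OF V] g(1,2) F] by blast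
  obtain H where H: "ideal_polygon L2 H" "preserves g H" using no_fixed_invariant_polygon[OF veeringD(2)[OF V] g(1,3) F] by blast
  have gp: "gap L1 G" "gap L2 H" using G(1) H(1) unfolding ideal_polygon_def by blast+
  consider "nonleaf_gap L1 G" | "nonleaf_gap L2 H" | "G \<in> leaves L1" "H \<in> leaves L2"
    using gp unfolding nonleaf_gap_def by blast
  then show ?thesis
  proof cases
    case 1
    then show ?thesis using no_fixed_preserved_partner[OF V g F 1 G(2)] fin G(2) by blast
  next
    case 2
    obtain K where K: "interleaving_pair L2 L1 H K" "preserves g K"
      using no_fixed_preserved_partner[OF veering_sym[OF V] g(1,3,2) F 2 H(2)] by blast
    have "interleaving_pair L1 L2 K H" using K(1) unfolding interleaving_pair_def interleave_def by blast
    then show ?thesis using fin K(2) H(2) by blast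
  next
    case 3
    obtain u v where u: "lf L1 u v" "G = {open_arc u v, open_arc v u}" using 3(1) by (rule leavesE[OF lam1])
    obtain x y where x: "lf L2 x y" "H = {open_arc x y, open_arc y x}" using 3(2) by (rule leavesE[OF lam2])
    have gu: "g u = v" "g v = u" using preserved_leaf_swap[OF lam1 g(1,2) F u(1)] G(2) u(2) by blast+
    have gx: "g x = y" using preserved_leaf_swap[OF lam2 g(1,3) F x(1)] H(2) x(2) by blast
    have "x \<noteq> u" "x \<noteq> v"
      using x(1) u(1) lf_sym[OF lam1 u(1)] endpoints_iff[OF lam1] endpoints_iff[OF lam2] veeringD(7)[OF V] by blast+
    then consider "x \<in> open_arc u v" | "x \<in> open_arc v u"
      using arc_cases[OF lfD(1,2)[OF u(1)] lfD(1)[OF x(1)] lfD(3)[OF u(1)]] by blast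
    then have "interleave G H"
    proof cases
      case 1
      then have "y \<in> open_arc v u" using oph_arc_mono[OF g(1) 1] gu gx by simp
      then show ?thesis unfolding u(2) x(2) by (rule linked_leaves_interleave[OF u(1) x(1) 1])
    next
      case 2
      then have "y \<in> open_arc u v" using oph_arc_mono[OF g(1) 2] gu gx by simp
      then have "interleave {open_arc v u, open_arc u v} {open_arc x y, open_arc y x}"
        by (rule linked_leaves_interleave[OF lf_sym[OF lam1 u(1)] x(1) 2])
      then show ?thesis unfolding u(2) x(2) by (simp only: insert_commute)
    qed
    then show ?thesis using fin[of G H] gp G(2) H(2) unfolding interleaving_pair_def by blast
  qed
qed

section \<open>Classification of automorphisms\<close>

lemma elliptic_no_fixed:
  assumes g: "oph g" and el: "elliptic g"
  shows "Fix g = {}"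
proof (rule ccontr)
  assume "Fix g \<noteq> {}"
  then obtain p where p: "p \<in> Fix g" by blast
  obtain n where n: "n > 0" "\<forall>x\<in>S1. (g ^^ n) x = x" "nontrivial g" using el unfolding elliptic_def by blast
  have "g x = x" if "x \<in> S1" for x using periodic_imp_fixed[OF g p that _ n(1)] n(2) that by blast
  then show False using n(3) unfolding nontrivial_def by blast
qed

lemma Fix_nonempty_classification:
  assumes V: "veering_pair L1 L2" and g: "oph g" "preserves g L1" "preserves g L2" "nontrivial g" and ne: "Fix g \<noteq> {}"
  shows
    "(parabolic g \<and>
        (\<exists>G1 G2 p. preserved_interleaving_pair L1 L2 g G1 G2 \<and>
           crown_with_pivot L1 G1 p \<and> crown_with_pivot L2 G2 p \<and> Fix g = {p})) \<or>
     (hyperbolic g \<and> (\<forall>p\<in>Fix g. rainbow_point L1 p \<and> rainbow_point L2 p)) \<or>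
     (properly_pseudo_Anosov L1 L2 g \<and>
        (\<exists>G1 G2. preserved_interleaving_pair L1 L2 g G1 G2 \<and>
           real_gap L1 G1 \<and> real_gap L2 G2 \<and>
           vertices G1 \<union> vertices G2 = Fix g \<and>
           (attracting_gap g G1 \<and> repelling_gap g G2 \<or>
            attracting_gap g G2 \<and> repelling_gap g G1)))"
proof -
  have fa: "fixed_aut L1 L2 g" by (intro fixed_aut.intro V g ne)
  obtain u where u: "u \<in> Fix g" using ne by blast
  consider "Fix g = {u}" | q where "q \<noteq> u" "Fix g = {u, q}" | q r where "q \<in> Fix g" "r \<in> Fix g" "q \<noteq> u" "r \<noteq> u" "q \<noteq> r"
    using u by blast
  then show ?thesis
  proof cases
    case 1
    obtain G H where GH: "crown_with_pivot L1 G u" "crown_with_pivot L2 H u" "interleaving_pair L1 L2 G H" "preserves g G" "preserves g H"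
      using fixed_aut.single_fixed_point[OF fa 1] by blast
    then have "preserved_interleaving_pair L1 L2 g G H" unfolding preserved_interleaving_pair_def by blast
    moreover have "parabolic g" unfolding parabolic_def using g(4) 1 by blast
    ultimately show ?thesis using GH(1,2) 1 by blast
  next
    case 2
    have q: "q \<in> Fix g" using 2(2) by simp
    have "multi_fixed_aut L1 L2 g"
      by (intro multi_fixed_aut.intro fa multi_fixed_aut_axioms.intro bexI[OF _ u] bexI[OF _ q]) (rule 2(1)[symmetric])
    note r = multi_fixed_aut.two_fixed_points[OF this 2(2) 2(1)[symmetric]]
    have "\<forall>p\<in>Fix g. rainbow_point L1 p \<and> rainbow_point L2 p" unfolding 2(2) using r by simp
    then show ?thesis using r(1) by blast
  next
    case 3
    have m: "multi_fixed_aut L1 L2 g"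
      by (intro multi_fixed_aut.intro fa multi_fixed_aut_axioms.intro bexI[OF _ u] bexI[OF _ 3(1)]) (rule 3(3)[symmetric])
    have "many_fixed_aut L1 L2 g"
      by (intro many_fixed_aut.intro m many_fixed_aut_axioms.intro bexI[OF _ u] bexI[OF _ 3(1)] bexI[OF _ 3(2)] conjI)
        (use 3 in auto)
    then obtain G H where GH: "preserved_interleaving_pair L1 L2 g G H" "real_gap L1 G" "real_gap L2 H"
      "vertices G \<union> vertices H = Fix g" "attracting_gap g G \<and> repelling_gap g H \<or> attracting_gap g H \<and> repelling_gap g G"
      by (rule many_fixed_aut.many_fixed_points)
    have "\<not> parabolic g" unfolding parabolic_def using u 3 by (metis singletonD)
    moreover have "\<not> elliptic g" using elliptic_no_fixed[OF g(1)] ne by blast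
    moreover have "g \<in> Aut L1 L2" unfolding Aut_def using g by blast
    ultimately have "properly_pseudo_Anosov L1 L2 g"
      unfolding properly_pseudo_Anosov_def pA_like_def using GH(1) ne by blast
    then show ?thesis using GH by blast
  qed
qed

lemma funpow_fixed: "h z = z \<Longrightarrow> (h ^^ n) z = z"
  by (induction n) auto

lemma preserved_endpoints:
  assumes L: "lamination_system L" and g: "oph g" "preserves g L" and x: "x \<in> S1"
  shows "g x \<in> endpoints L \<longleftrightarrow> x \<in> endpoints L"
proof
  assume "g x \<in> endpoints L"
  then obtain y where y: "lf L (g x) y" using endpoints_iff[OF L] by blast
  have "y \<in> g ` S1" using lfD(2)[OF y] oph_surj[OF g(1)] by blast
  then obtain z where "z \<in> S1" "y = g z" by blast
  then show "x \<in> endpoints L" using aut_lf_rev[OF L g x] y endpoints_iff[OF L] by blast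
next
  assume "x \<in> endpoints L"
  then show "g x \<in> endpoints L" using aut_lf[OF g] endpoints_iff[OF L] by blast
qed

text \<open>The orbit of a vertex stays in the finite vertex set, and injectivity turns the first
  coincidence into a return to the start.\<close>

lemma periodic_point_on_polygon:
  assumes L: "lamination_system L" and g: "oph g" "preserves g L" and G: "ideal_polygon L G" "preserves g G"
  obtains x m where "x \<in> S1" "m > 0" "(g ^^ m) x = x"
proof -
  have gG: "gap L G" "finite (vertices G)" using G(1) unfolding ideal_polygon_def by blast+
  obtain u v where u: "lf L u v" "open_arc u v \<in> G" by (rule gap_nonempty[OF L gG(1)])
  have x: "u \<in> vertices G" "u \<in> S1" using gap_vertex[OF L gG(1) u(2)] lfD[OF u(1)] by blast+
  have "g ` vertices G = vertices G" using gap_image(2)[OF L g gG(1)] G(2) unfolding preserves_def by simp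
  then have "(g ^^ n) u \<in> vertices G" for n using x(1) by (induction n) auto
  then have "range (\<lambda>n. (g ^^ n) u) \<subseteq> vertices G" by blast
  then have "finite (range (\<lambda>n. (g ^^ n) u))" using gG(2) by (rule finite_subset)
  then have "\<not> inj (\<lambda>n. (g ^^ n) u)" using finite_imageD[of "\<lambda>n. (g ^^ n) u" UNIV] by auto
  then obtain a b where "a \<noteq> b" "(g ^^ a) u = (g ^^ b) u" unfolding inj_def by blast
  then obtain i j where ij: "i < j" "(g ^^ i) u = (g ^^ j) u" by (metis linorder_neqE_nat)
  have "(g ^^ i) ((g ^^ (j - i)) u) = (g ^^ i) u" using ij funpow_add[of i "j - i" g] by simp
  then have "(g ^^ (j - i)) u = u"
    using oph_eq[OF oph_funpow[OF g(1)] oph_S1[OF oph_funpow[OF g(1)] x(2)] x(2)] by blast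
  then show ?thesis using that[OF x(2), of "j - i"] ij(1) by simp
qed

text \<open>A power \<open>f\<close> fixes a vertex of an invariant polygon. As \<open>g\<close>
  commutes with \<open>f\<close>, it permutes \<open>Fix f\<close>, and the pair found for
  \<open>f\<close> is invariant under \<open>g\<close> because its vertices are given by
  \<open>Fix f\<close> and the endpoint sets.\<close>

lemma Fix_empty_classification:
  assumes V: "veering_pair L1 L2" and g: "oph g" "preserves g L1" "preserves g L2" "nontrivial g"
    and F: "Fix g = {}" and nel: "\<not> elliptic g"
  shows "pA_like L1 L2 g \<and>
        (\<exists>G1 G2. preserved_interleaving_pair L1 L2 g G1 G2 \<and>
           ideal_polygon L1 G1 \<and> ideal_polygon L2 G2 \<and> real_gap L1 G1 \<and> real_gap L2 G2 \<and>
           vertices G1 \<union> vertices G2 = Per g)"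
proof -
  note lam1 = veeringD(3)[OF V] and lam2 = veeringD(4)[OF V]
  obtain P where P: "ideal_polygon L1 P" "preserves g P" using no_fixed_invariant_polygon[OF veeringD(1)[OF V] g(1,2) F] by blast
  obtain x m where x: "x \<in> S1" "m > 0" "(g ^^ m) x = x" by (rule periodic_point_on_polygon[OF lam1 g(1,2) P])
  define f where "f = g ^^ m"
  have f: "oph f" "preserves f L1" "preserves f L2"
    unfolding f_def using oph_funpow[OF g(1)] preserves_funpow[OF g(2)] preserves_funpow[OF g(3)] by blast+
  have nt: "nontrivial f"
  proof (rule ccontr)
    assume "\<not> nontrivial f"
    then have "\<forall>x\<in>S1. (g ^^ m) x = x" unfolding nontrivial_def f_def by blast
    then show False using nel x(2) g(4) unfolding elliptic_def by blast
  qed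
  have xF: "x \<in> Fix f" using x unfolding f_def by (intro FixD(3))
  have comm: "f (g z) = g (f z)" for z unfolding f_def by (simp add: funpow_swap1)
  have nofix: "g z \<noteq> z" if "z \<in> S1" for z using FixD(3)[OF that, of g] F by blast
  have gF: "g z \<in> Fix f \<longleftrightarrow> z \<in> Fix f" if z: "z \<in> S1" for z
  proof -
    have "g z \<in> Fix f \<longleftrightarrow> f (g z) = g z" using oph_S1[OF g(1) z] unfolding Fix_def by blast
    also have "\<dots> \<longleftrightarrow> f z = z" unfolding comm by (rule oph_eq[OF g(1) oph_S1[OF f(1) z] z])
    finally show ?thesis using z unfolding Fix_def by blast
  qed
  have gxF: "g x \<in> Fix f" using gF[OF x(1)] xF by blast
  have ne: "g x \<noteq> x" by (rule nofix[OF x(1)])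
  have fa: "fixed_aut L1 L2 f" by (intro fixed_aut.intro V f nt) (use xF in blast)
  have mu: "multi_fixed_aut L1 L2 f"
    by (intro multi_fixed_aut.intro fa multi_fixed_aut_axioms.intro bexI[OF _ xF] bexI[OF _ gxF]) (rule ne[symmetric])
  \<comment> \<open>With only these two points, \<open>g\<close> would exchange them and the two
    arcs. Conjugation by \<open>g\<close> would carry motion towards one point into motion towards
    the other, whereas \<open>f\<close> moves both arcs towards the same point.\<close>
  have "Fix f \<noteq> {x, g x}"
  proof
    assume e: "Fix f = {x, g x}"
    have gx: "g x \<in> S1" by (rule oph_S1[OF g(1) x(1)])
    have "g (g x) \<in> {x, g x}" unfolding e[symmetric] using gF[OF gx] gxF by blast
    then have ggx: "g (g x) = x" using nofix[OF gx] by blast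
    obtain a b where ab: "a \<in> open_arc x (g x)" "b \<in> open_arc (g x) x"
      "f a \<in> open_arc x a \<and> f b \<in> open_arc b x \<or> f a \<in> open_arc a (g x) \<and> f b \<in> open_arc (g x) b"
      using multi_fixed_aut.two_fixed_points(6)[OF mu e ne[symmetric]] by blast
    have ga: "g a \<in> open_arc (g x) x" using oph_arc_mono[OF g(1) ab(1)] ggx by simp
    have fx: "f (g x) = g x" "f x = x" using FixD(2)[OF gxF] FixD(2)[OF xF] .
    have no: "open_arc (g x) x \<inter> Fix f = {}" unfolding e by auto
    note dc = direction_constant[OF f(1) gx x(1) fx no]
    from ab(3) show False
    proof
      assume h: "f a \<in> open_arc x a \<and> f b \<in> open_arc b x"
      then have "f (g a) \<in> open_arc (g x) (g a)" using oph_arc_mono[OF g(1), of "f a" x a] comm by simp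
      then show False using dc[OF ga ab(2)] h by blast
    next
      assume h: "f a \<in> open_arc a (g x) \<and> f b \<in> open_arc (g x) b"
      then have "f (g a) \<in> open_arc (g a) x" using oph_arc_mono[OF g(1), of "f a" a "g x"] comm ggx by simp
      then show False using dc[OF ab(2) ga] h by blast
    qed
  qed
  then obtain r where r: "r \<in> Fix f" "r \<noteq> x" "r \<noteq> g x" using xF gxF by blast
  have "many_fixed_aut L1 L2 f"
    by (intro many_fixed_aut.intro mu many_fixed_aut_axioms.intro bexI[OF _ xF] bexI[OF _ gxF] bexI[OF _ r(1)] conjI)
      (use ne r in auto)
  then obtain G H W where GH: "preserved_interleaving_pair L1 L2 f G H" "real_gap L1 G" "real_gap L2 H"
    "vertices G \<union> vertices H = Fix f" "vertices G = (Fix f \<inter> endpoints L1) \<union> W" "vertices H = (Fix f \<inter> endpoints L2) \<union> W"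
    "W \<subseteq> Fix f - endpoints L1 - endpoints L2" "Fix f - endpoints L1 - endpoints L2 \<subseteq> W" "W = {} \<or> (\<exists>w. W = {w})"
    by (rule many_fixed_aut.many_fixed_points)
  \<comment> \<open>A single point of \<open>W\<close> would be fixed by \<open>g\<close>, since
    \<open>g\<close> preserves \<open>Fix f\<close> and both endpoint sets.\<close>
  have W: "W = {}"
  proof (rule ccontr)
    assume "W \<noteq> {}"
    then obtain w where w: "W = {w}" using GH(9) by blast
    then have wf: "w \<in> Fix f" "w \<notin> endpoints L1" "w \<notin> endpoints L2" using GH(7) by blast+
    note wS = FixD(1)[OF wf(1)]
    have "g w \<in> W" using GH(8) gF[OF wS] preserved_endpoints[OF lam1 g(1,2) wS] preserved_endpoints[OF lam2 g(1,3) wS] wf by blast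
    then show False using w nofix[OF wS] by simp
  qed
  have inv: "g ` (Fix f \<inter> endpoints L) = Fix f \<inter> endpoints L" if L: "lamination_system L" "preserves g L" for L
  proof (intro subset_antisym subsetI)
    fix z assume "z \<in> g ` (Fix f \<inter> endpoints L)"
    then obtain y where y: "y \<in> Fix f" "y \<in> endpoints L" "z = g y" by blast
    show "z \<in> Fix f \<inter> endpoints L"
      using gF[OF FixD(1)[OF y(1)]] preserved_endpoints[OF L(1) g(1) L(2) FixD(1)[OF y(1)]] y by blast
  next
    fix z assume z: "z \<in> Fix f \<inter> endpoints L"
    then have "z \<in> g ` S1" using FixD(1) oph_surj[OF g(1)] by blast
    then obtain y where y: "y \<in> S1" "z = g y" by blast
    then show "z \<in> g ` (Fix f \<inter> endpoints L)"
      using gF[OF y(1)] preserved_endpoints[OF L(1) g(1) L(2) y(1)] z by blast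
  qed
  have gp: "gap L1 G" "gap L2 H" and ip: "interleaving_pair L1 L2 G H"
    using GH(1) unfolding preserved_interleaving_pair_def interleaving_pair_def by blast+
  have "(`) g ` G = G"
    using gap_image[OF lam1 g(1,2) gp(1)] inv[OF lam1 g(2)] GH(5) W by (intro gap_eqI[OF lam1 _ gp(1)]) auto
  moreover have "(`) g ` H = H"
    using gap_image[OF lam2 g(1,3) gp(2)] inv[OF lam2 g(3)] GH(6) W by (intro gap_eqI[OF lam2 _ gp(2)]) auto
  ultimately have pr: "preserves g G" "preserves g H" unfolding preserves_def by simp_all
  have pair: "preserved_interleaving_pair L1 L2 g G H" unfolding preserved_interleaving_pair_def using ip pr by blast
  have poly: "ideal_polygon L1 G" "ideal_polygon L2 H"
    using preserved_gap_polygon[OF veeringD(1)[OF V] g(1) F gp(1) pr(1)]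
      preserved_gap_polygon[OF veeringD(2)[OF V] g(1) F gp(2) pr(2)] .
  have "Per g = Fix f"
  proof (intro subset_antisym subsetI)
    fix z assume "z \<in> Per g"
    then obtain n where n: "z \<in> S1" "n > 0" "(g ^^ n) z = z" unfolding Per_def by blast
    \<comment> \<open>A periodic point of \<open>g\<close> is periodic for \<open>f\<close>, and
      since \<open>f\<close> has a fixed point, it is fixed by \<open>f\<close>.\<close>
    have "(f ^^ n) z = ((g ^^ n) ^^ m) z" unfolding f_def by (simp add: funpow_mult mult.commute)
    also have "\<dots> = z" by (rule funpow_fixed[where h = "g ^^ n", OF n(3)])
    finally have "f z = z" by (rule periodic_imp_fixed[OF f(1) xF n(1) _ n(2)])
    then show "z \<in> Fix f" using n(1) by (intro FixD(3))
  next
    fix z assume z: "z \<in> Fix f"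
    then show "z \<in> Per g" unfolding Per_def using FixD(1,2)[OF z] x(2) unfolding f_def by blast
  qed
  moreover have "pA_like L1 L2 g"
    unfolding pA_like_def Aut_def parabolic_def using nel F pair g by blast
  ultimately show ?thesis using pair poly GH(2-4) by blast
qed

theorem theorem15p12:
  fixes L1 L2 :: "complex set set" and g :: "complex \<Rightarrow> complex"
  assumes "veering_pair L1 L2"
    and "g \<in> Aut L1 L2"
    and "nontrivial g"
  shows
    "(elliptic g \<and>
        (\<exists>G1 G2. preserved_interleaving_pair L1 L2 g G1 G2 \<and>
           ideal_polygon L1 G1 \<and> ideal_polygon L2 G2)) \<or>
     (parabolic g \<and>
        (\<exists>G1 G2 p. preserved_interleaving_pair L1 L2 g G1 G2 \<and>
           crown_with_pivot L1 G1 p \<and> crown_with_pivot L2 G2 p \<and> Fix g = {p})) \<or>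
     (hyperbolic g \<and> (\<forall>p\<in>Fix g. rainbow_point L1 p \<and> rainbow_point L2 p)) \<or>
     (pA_like L1 L2 g \<and> Fix g = {} \<and>
        (\<exists>G1 G2. preserved_interleaving_pair L1 L2 g G1 G2 \<and>
           ideal_polygon L1 G1 \<and> ideal_polygon L2 G2 \<and> real_gap L1 G1 \<and> real_gap L2 G2 \<and>
           vertices G1 \<union> vertices G2 = Per g)) \<or>
     (properly_pseudo_Anosov L1 L2 g \<and>
        (\<exists>G1 G2. preserved_interleaving_pair L1 L2 g G1 G2 \<and>
           real_gap L1 G1 \<and> real_gap L2 G2 \<and>
           vertices G1 \<union> vertices G2 = Fix g \<and>
           (attracting_gap g G1 \<and> repelling_gap g G2 \<or>
            attracting_gap g G2 \<and> repelling_gap g G1)))"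
proof -
  have g: "oph g" "preserves g L1" "preserves g L2"
    using assms(2) unfolding Aut_def by blast+
  consider "Fix g \<noteq> {}" | "Fix g = {}" "elliptic g" | "Fix g = {}" "\<not> elliptic g"
    by blast
  then show ?thesis
  proof cases
    case 1
    show ?thesis using Fix_nonempty_classification[OF assms(1) g assms(3) 1] by blast
  next
    case 2
    show ?thesis using no_fixed_preserved_pair[OF assms(1) g 2(1)] 2(2) by blast
  next
    case 3
    show ?thesis using Fix_empty_classification[OF assms(1) g assms(3) 3] 3(1) by blast
  qed
qed

end
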